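(* The Lie algebroid $(E_0,[\cdot,\cdot],\rho)$ over $\mathbb{O}^2$, and similarly the Lie groupoid $\mathcal{G}\Rightarrow\mathbb{O}^2$ (both described in the context), have the minimal dimension among Lie algebroids and Lie groupoids over $\mathbb{O}^2$ which induce the singular octonionic Hopf foliation $\mathcal{F}_{OH}$. That is, every Lie algebroid over $\mathbb{O}^2$ inducing $\mathcal{F}_{OH}$ has rank at least $\mathrm{rank}(E_0)$, and every Lie groupoid over $\mathbb{O}^2$ inducing $\mathcal{F}_{OH}$ has a manifold of arrows of dimension at least $\dim\mathcal{G}$.
   Context: $\mathbb{O}\cong\mathbb{R}^8$ denotes the octonions: the real unital non-associative algebra with orthonormal basis $e_0=1,e_1,\dots,e_7$ and $e_i\cdot e_j=-\delta_{ij}1+\sum_k\epsilon_{ijk}e_k$ for $1\le i,j\le 7$, where $\epsilon_{ijk}$ is completely antisymmetric, equal to $1$ for $ijk\in\{123,145,176,246,257,347,365\}$, and $0$ for all triples that are not permutations of these; $\langle\cdot,\cdot\rangle$, $\|\cdot\|$ are the Euclidean inner product and norm and $\overline{a}=2\langle a,1\rangle 1-a$ is conjugation. $(x,y)$ denotes the point of the base $\mathbb{O}^2\cong\mathbb{R}^{16}$, and vector fields on $\mathbb{O}^2$ are identified with pairs of $\mathbb{O}$-valued functions. Lie algebroid: $E_0=\mathbb{O}^2\times\mathbb{O}^2\to\mathbb{O}^2$ is the trivial bundle with fiber $\mathbb{O}^2$, with anchor $$\rho\begin{pmatrix}u \\ v\end{pmatrix}=\begin{pmatrix}\|x\|^2u+(x\cdot\overline{y})\cdot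 v-(\langle x,u\rangle+\langle y,v\rangle)x \\ \|y\|^2v+(y\cdot\overline{x})\cdot u-(\langle x,u\rangle+\langle y,v\rangle)y\end{pmatrix}$$ and bracket on constant sections (extended by the Leibniz rule) $$\left[\begin{pmatrix}u \\ v\end{pmatrix},\begin{pmatrix}u' \\ v'\end{pmatrix}\right]=(\langle x,u\rangle+\langle y,v\rangle)\begin{pmatrix}u' \\ v'\end{pmatrix}-(\langle x,u'\rangle+\langle y,v'\rangle)\begin{pmatrix}u \\ v\end{pmatrix}.$$ It is the Lie algebroid of the Lie groupoid $\mathcal{G}\Rightarrow\mathbb{O}^2$ defined as follows. With $\lambda(F,G,x,y)=\sqrt{1+2(\langle x,F\rangle+\langle y,G\rangle+\langle x\cdot\overline{y},F\cdot\overline{G}\rangle)+\|x\|^2\|F\|^2+\|y\|^2\|G\|^2}$, let $\mathcal{G}=\{(F,G,x,y)\in\mathbb{O}^2\times\mathbb{O}^2:\lambda\neq0\}$; for $g=(F,G,x,y)$: $\mathrm{s}(g)=(x,y)$, $\mathrm{t}(g)=\frac{1}{\lambda(g)}(x+\|x\|^2F+(x\cdot\overline{y})\cdot G,\ y+\|y\|^2G+(y\cdot\overline{x})\cdot F)$; for $\mathrm{s}(g')=\mathrm{t}(g)$, $g'=(F',G',x',y')$: $g'\cdot g=(F+\lambda(g)F',G+\lambda(g)G',x,y)$; units $(0,0,x,y)$; inverse $g^{-1}=(-F/\lambda(g),-G/\lambda(g),\mathrm{t}(g))$. A Lie algebroid $E\to M$ with anchor $\rho_E$ induces the singular foliation $\mathcal{F}_E=\langle\{\rho_E(a):a\in\Gamma(E)\}\rangle_{C_c^\infty(M)}\subset\mathfrak{X}_c(M)$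 ($C_c^\infty(M)$-linear span, smooth setting). A Lie groupoid induces the singular foliation induced by its Lie algebroid. The singular octonionic Hopf foliation $\mathcal{F}_{OH}$ is the singular foliation on $\mathbb{O}^2$ induced by $(E_0,[\cdot,\cdot],\rho)$. *)

theory Defs
  imports "HOL-Analysis.Analysis"
begin

section \<open>Smooth functions\<close>

text \<open>Meant for open \<open>S\<close> only: the derivatives are taken in the ambient space.\<close>

primrec Ck_on :: "nat \<Rightarrow> 'a::euclidean_space set \<Rightarrow> ('a \<Rightarrow> 'b::real_normed_vector) \<Rightarrow> bool" where
  "Ck_on 0 S f \<longleftrightarrow> continuous_on S f"
| "Ck_on (Suc k) S f \<longleftrightarrow>
     (\<forall>x\<in>S. f differentiable (at x)) \<and>
     (\<forall>v. Ck_on k S (\<lambda>x. frechet_derivative f (at x) v))"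

definition smooth_on :: "'a::euclidean_space set \<Rightarrow> ('a \<Rightarrow> 'b::real_normed_vector) \<Rightarrow> bool" where
  "smooth_on S f \<longleftrightarrow> (\<forall>k. Ck_on k S f)"

definition smooth_compact_support :: "('a::euclidean_space \<Rightarrow> real) \<Rightarrow> bool" where
  "smooth_compact_support f \<longleftrightarrow> smooth_on UNIV f \<and> compact (closure {x. f x \<noteq> 0})"

text \<open>The \<open>C\<^sub>c\<^sup>\<infinity>(M)\<close>-linear span of a set of vector fields on a Euclidean space \<open>M\<close>; vector fields
  are identified with maps \<open>M \<Rightarrow> M\<close>.\<close>

definition Cc_span :: "('m::euclidean_space \<Rightarrow> 'm) set \<Rightarrow> ('m \<Rightarrow> 'm) set" where
  "Cc_span S = {X. \<exists>(n::nat) f Y. (\<forall>i<n. smooth_compact_support (f i) \<and> Y i \<in> S) \<and>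
                    X = (\<lambda>x. \<Sum>i<n. f i x *\<^sub>R Y i x)}"


section \<open>Vector bundles and Lie algebroids over a Euclidean space\<close>

text \<open>A vector bundle over the manifold \<open>'m\<close> is a family of vector spaces (subspaces of an arbitrary
  real vector space \<open>'e\<close>, which only carries the fibrewise linear structure) together with local
  frames that cover the base and have smooth transition functions.  The frame \<open>(U, b)\<close> consists of
  the local sections \<open>b 0, \<dots>, b (r - 1)\<close> over \<open>U\<close>, \<open>r\<close> being the rank; these frames define the smooth
  structure, so smoothness does not refer to any topology on \<open>'e\<close>.\<close>

record ('m, 'e) vbundle =
  vb_rank :: nat
  vb_fibre :: "'m \<Rightarrow> 'e set"
  vb_frames :: "('m set \<times> (nat \<Rightarrow> 'm \<Rightarrow> 'e)) set"

definition vector_bundle :: "('m::euclidean_space, 'e::real_vector, 'z) vbundle_scheme \<Rightarrow> bool" where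
  "vector_bundle E \<longleftrightarrow>
     (\<forall>x. \<exists>(U, b)\<in>vb_frames E. x \<in> U) \<and>
     (\<forall>(U, b)\<in>vb_frames E. open U \<and>
        (\<forall>x\<in>U. inj_on (\<lambda>i. b i x) {..<vb_rank E} \<and>
                independent ((\<lambda>i. b i x) ` {..<vb_rank E}) \<and>
                span ((\<lambda>i. b i x) ` {..<vb_rank E}) = vb_fibre E x)) \<and>
     (\<forall>(U, b)\<in>vb_frames E. \<forall>(V, c)\<in>vb_frames E. \<exists>g :: nat \<Rightarrow> nat \<Rightarrow> 'm \<Rightarrow> real.
        (\<forall>i<vb_rank E. \<forall>j<vb_rank E. smooth_on (U \<inter> V) (g i j)) \<and>
        (\<forall>x\<in>U \<inter> V. \<forall>j<vb_rank E. c j x = (\<Sum>i<vb_rank E. g i j x *\<^sub>R b i x)))"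

definition smooth_section ::
    "('m::euclidean_space, 'e::real_vector, 'z) vbundle_scheme \<Rightarrow> ('m \<Rightarrow> 'e) \<Rightarrow> bool" where
  "smooth_section E a \<longleftrightarrow>
     (\<forall>x. a x \<in> vb_fibre E x) \<and>
     (\<forall>(U, b)\<in>vb_frames E. \<exists>f :: nat \<Rightarrow> 'm \<Rightarrow> real.
        (\<forall>i<vb_rank E. smooth_on U (f i)) \<and>
        (\<forall>x\<in>U. a x = (\<Sum>i<vb_rank E. f i x *\<^sub>R b i x)))"

record ('m, 'e) algebroid = "('m, 'e) vbundle" +
  la_anchor :: "'m \<Rightarrow> 'e \<Rightarrow> 'm"
  la_bracket :: "('m \<Rightarrow> 'e) \<Rightarrow> ('m \<Rightarrow> 'e) \<Rightarrow> 'm \<Rightarrow> 'e"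

text \<open>That the anchor maps brackets to brackets of vector fields follows from the axioms below.\<close>

definition lie_algebroid :: "('m::euclidean_space, 'e::real_vector) algebroid \<Rightarrow> bool" where
  "lie_algebroid E \<longleftrightarrow>
     vector_bundle E \<and>
     (\<forall>x. \<forall>v\<in>vb_fibre E x. \<forall>w\<in>vb_fibre E x. \<forall>r s :: real.
        la_anchor E x (r *\<^sub>R v + s *\<^sub>R w) = r *\<^sub>R la_anchor E x v + s *\<^sub>R la_anchor E x w) \<and>
     (\<forall>(U, b)\<in>vb_frames E. \<forall>i<vb_rank E. smooth_on U (\<lambda>x. la_anchor E x (b i x))) \<and>
     (\<forall>a b. smooth_section E a \<and> smooth_section E b \<longrightarrow> smooth_section E (la_bracket E a b)) \<and>
     (\<forall>a b c. \<forall>r s :: real. smooth_section E a \<and> smooth_section E b \<and> smooth_section E c \<longrightarrow>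
        la_bracket E a (\<lambda>x. r *\<^sub>R b x + s *\<^sub>R c x) =
          (\<lambda>x. r *\<^sub>R la_bracket E a b x + s *\<^sub>R la_bracket E a c x)) \<and>
     (\<forall>a b. smooth_section E a \<and> smooth_section E b \<longrightarrow>
        la_bracket E a b = (\<lambda>x. - la_bracket E b a x)) \<and>
     (\<forall>a b c. smooth_section E a \<and> smooth_section E b \<and> smooth_section E c \<longrightarrow>
        (\<forall>x. la_bracket E a (la_bracket E b c) x + la_bracket E b (la_bracket E c a) x +
              la_bracket E c (la_bracket E a b) x = 0)) \<and>
     (\<forall>(f :: 'm \<Rightarrow> real) a b. smooth_on UNIV f \<and> smooth_section E a \<and> smooth_section E b \<longrightarrow>
        la_bracket E a (\<lambda>x. f x *\<^sub>R b x) =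
          (\<lambda>x. f x *\<^sub>R la_bracket E a b x +
               frechet_derivative f (at x) (la_anchor E x (a x)) *\<^sub>R b x))"

definition algebroid_foliation ::
    "('m::euclidean_space, 'e::real_vector) algebroid \<Rightarrow> ('m \<Rightarrow> 'm) set" where
  "algebroid_foliation E = Cc_span {(\<lambda>x. la_anchor E x (a x)) | a. smooth_section E a}"


section \<open>Smooth manifolds and Lie groupoids over a Euclidean space\<close>

text \<open>A chart is a pair of its domain and its coordinate map.  The space \<open>X\<close> need not be Hausdorff or
  second countable, as is customary for the manifold of arrows of a Lie groupoid.\<close>

definition smooth_atlas :: "'p topology \<Rightarrow> ('p set \<times> ('p \<Rightarrow> 'a::euclidean_space)) set \<Rightarrow> bool" where
  "smooth_atlas X A \<longleftrightarrow>
     (\<Union>(U, \<phi>)\<in>A. U) = topspace X \<and>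
     (\<forall>(U, \<phi>)\<in>A. openin X U \<and> open (\<phi> ` U) \<and>
        homeomorphic_map (subtopology X U) (top_of_set (\<phi> ` U)) \<phi>) \<and>
     (\<forall>(U, \<phi>)\<in>A. \<forall>(V, \<psi>)\<in>A. smooth_on (\<phi> ` (U \<inter> V)) (\<psi> \<circ> inv_into U \<phi>))"

definition euclidean_atlas :: "('a::euclidean_space set \<times> ('a \<Rightarrow> 'a)) set" where
  "euclidean_atlas = {(UNIV, id)}"

definition prod_atlas ::
    "('p set \<times> ('p \<Rightarrow> 'a)) set \<Rightarrow> ('q set \<times> ('q \<Rightarrow> 'b)) set \<Rightarrow> (('p \<times> 'q) set \<times> ('p \<times> 'q \<Rightarrow> 'a \<times> 'b)) set"
  where "prod_atlas A B = {(U \<times> V, map_prod \<phi> \<psi>) | U \<phi> V \<psi>. (U, \<phi>) \<in> A \<and> (V, \<psi>) \<in> B}"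

text \<open>Smoothness of a map on a subset \<open>D\<close> of a manifold: in charts, it extends locally to a smooth map on
  an open set.  For \<open>D\<close> the whole manifold, or an embedded submanifold, this is the usual notion.\<close>

definition smooth_map ::
    "('p set \<times> ('p \<Rightarrow> 'a::euclidean_space)) set \<Rightarrow> 'p set \<Rightarrow> ('q set \<times> ('q \<Rightarrow> 'b::euclidean_space)) set \<Rightarrow>
     ('p \<Rightarrow> 'q) \<Rightarrow> bool" where
  "smooth_map A D B f \<longleftrightarrow>
     (\<forall>p\<in>D. \<exists>(U, \<phi>)\<in>A. \<exists>(V, \<psi>)\<in>B. p \<in> U \<and> f p \<in> V \<and>
        (\<exists>N F. open N \<and> \<phi> p \<in> N \<and> smooth_on N F \<and>
           (\<forall>q\<in>D \<inter> U. \<phi> q \<in> N \<longrightarrow> f q \<in> V \<and> \<psi> (f q) = F (\<phi> q))))"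

text \<open>The differential at \<open>p\<close>, in the chart \<open>\<kappa>\<close>, of a map from a manifold to a Euclidean space.\<close>

definition chart_diff ::
    "'p set \<times> ('p \<Rightarrow> 'a::euclidean_space) \<Rightarrow> ('p \<Rightarrow> 'b::euclidean_space) \<Rightarrow> 'p \<Rightarrow> 'a \<Rightarrow> 'b" where
  "chart_diff \<kappa> f p = frechet_derivative (f \<circ> inv_into (fst \<kappa>) (snd \<kappa>)) (at (snd \<kappa> p))"

record ('m, 'g, 'c) groupoid =
  gp_top :: "'g topology"
  gp_charts :: "('g set \<times> ('g \<Rightarrow> 'c)) set"
  gp_source :: "'g \<Rightarrow> 'm"
  gp_target :: "'g \<Rightarrow> 'm"
  gp_unit :: "'m \<Rightarrow> 'g"
  gp_mult :: "'g \<Rightarrow> 'g \<Rightarrow> 'g"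
  gp_inv :: "'g \<Rightarrow> 'g"

abbreviation gp_arrows :: "('m, 'g, 'c) groupoid \<Rightarrow> 'g set" where
  "gp_arrows H \<equiv> topspace (gp_top H)"

definition gp_composable :: "('m, 'g, 'c) groupoid \<Rightarrow> ('g \<times> 'g) set" where
  "gp_composable H = {(h, g). h \<in> gp_arrows H \<and> g \<in> gp_arrows H \<and> gp_source H h = gp_target H g}"

text \<open>The dimension of the manifold of arrows, which is modelled on \<open>'c\<close>.\<close>

definition gp_dim :: "('m, 'g, 'c::euclidean_space) groupoid \<Rightarrow> nat" where
  "gp_dim H = DIM('c)"

definition lie_groupoid :: "('m::euclidean_space, 'g, 'c::euclidean_space) groupoid \<Rightarrow> bool" where
  "lie_groupoid H \<longleftrightarrow>
     (\<forall>x. gp_unit H x \<in> gp_arrows H \<and> gp_source H (gp_unit H x) = x \<and> gp_target H (gp_unit H x) = x) \<and>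
     (\<forall>(h, g)\<in>gp_composable H. gp_mult H h g \<in> gp_arrows H \<and>
        gp_source H (gp_mult H h g) = gp_source H g \<and> gp_target H (gp_mult H h g) = gp_target H h) \<and>
     (\<forall>k h g. (k, h) \<in> gp_composable H \<and> (h, g) \<in> gp_composable H \<longrightarrow>
        gp_mult H k (gp_mult H h g) = gp_mult H (gp_mult H k h) g) \<and>
     (\<forall>g\<in>gp_arrows H. gp_mult H g (gp_unit H (gp_source H g)) = g \<and>
        gp_mult H (gp_unit H (gp_target H g)) g = g) \<and>
     (\<forall>g\<in>gp_arrows H. gp_inv H g \<in> gp_arrows H \<and>
        gp_source H (gp_inv H g) = gp_target H g \<and> gp_target H (gp_inv H g) = gp_source H g \<and>
        gp_mult H (gp_inv H g) g = gp_unit H (gp_source H g) \<and>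
        gp_mult H g (gp_inv H g) = gp_unit H (gp_target H g)) \<and>
     smooth_atlas (gp_top H) (gp_charts H) \<and>
     smooth_map (gp_charts H) (gp_arrows H) euclidean_atlas (gp_source H) \<and>
     smooth_map (gp_charts H) (gp_arrows H) euclidean_atlas (gp_target H) \<and>
     (\<forall>\<kappa>\<in>gp_charts H. \<forall>g\<in>fst \<kappa>.
        surj (chart_diff \<kappa> (gp_source H) g) \<and> surj (chart_diff \<kappa> (gp_target H) g)) \<and>
     smooth_map euclidean_atlas UNIV (gp_charts H) (gp_unit H) \<and>
     smooth_map (gp_charts H) (gp_arrows H) (gp_charts H) (gp_inv H) \<and>
     smooth_map (prod_atlas (gp_charts H) (gp_charts H)) (gp_composable H) (gp_charts H)
       (\<lambda>(h, g). gp_mult H h g)"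

text \<open>Smooth sections of the Lie algebroid of \<open>H\<close>, i.e. of the restriction to the units of the kernel of
  the differential of the source map.  A section assigns to a chart \<open>\<kappa>\<close> and a base point \<open>x\<close> whose unit lies
  in the domain of \<open>\<kappa>\<close> the coordinates in \<open>\<kappa>\<close> of a tangent vector at that unit; the last condition is the
  transformation law under change of charts.\<close>

definition groupoid_section ::
    "('m::euclidean_space, 'g, 'c::euclidean_space) groupoid \<Rightarrow> ('g set \<times> ('g \<Rightarrow> 'c) \<Rightarrow> 'm \<Rightarrow> 'c) \<Rightarrow> bool"
  where
  "groupoid_section H a \<longleftrightarrow>
     (\<forall>\<kappa>\<in>gp_charts H. smooth_on {x. gp_unit H x \<in> fst \<kappa>} (a \<kappa>)) \<and>
     (\<forall>\<kappa>\<in>gp_charts H. \<forall>x. gp_unit H x \<in> fst \<kappa> \<longrightarrow>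
        chart_diff \<kappa> (gp_source H) (gp_unit H x) (a \<kappa> x) = 0) \<and>
     (\<forall>\<kappa>\<in>gp_charts H. \<forall>\<kappa>'\<in>gp_charts H. \<forall>x. gp_unit H x \<in> fst \<kappa> \<inter> fst \<kappa>' \<longrightarrow>
        a \<kappa>' x = chart_diff \<kappa> (snd \<kappa>') (gp_unit H x) (a \<kappa> x))"

text \<open>The singular foliation induced by the Lie algebroid of \<open>H\<close>.  Its anchor is the differential of the
  target map; the bracket does not enter.\<close>

definition groupoid_foliation ::
    "('m::euclidean_space, 'g, 'c::euclidean_space) groupoid \<Rightarrow> ('m \<Rightarrow> 'm) set" where
  "groupoid_foliation H = Cc_span {X. \<exists>a. groupoid_section H a \<and>
     (\<forall>\<kappa>\<in>gp_charts H. \<forall>x. gp_unit H x \<in> fst \<kappa> \<longrightarrow>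
        X x = chart_diff \<kappa> (gp_target H) (gp_unit H x) (a \<kappa> x))}"


section \<open>Octonions\<close>

text \<open>The index type \<open>8\<close> has the elements \<open>0, \<dots>, 7\<close>.  The unit is \<open>oct_e 0\<close>; the library's \<open>1\<close> and \<open>(*)\<close>
  on \<open>real ^ 8\<close> are componentwise and play no role.\<close>

type_synonym oct = "real ^ 8"

definition oct_e :: "8 \<Rightarrow> oct" where
  "oct_e i = axis i 1"

definition oct_triples :: "(8 \<times> 8 \<times> 8) set" where
  "oct_triples = {(1,2,3), (1,4,5), (1,7,6), (2,4,6), (2,5,7), (3,4,7), (3,6,5)}"

definition oct_eps :: "8 \<Rightarrow> 8 \<Rightarrow> 8 \<Rightarrow> real" where
  "oct_eps i j k =
     (if (i,j,k) \<in> oct_triples \<or> (j,k,i) \<in> oct_triples \<or> (k,i,j) \<in> oct_triples then 1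
      else if (j,i,k) \<in> oct_triples \<or> (i,k,j) \<in> oct_triples \<or> (k,j,i) \<in> oct_triples then -1
      else 0)"

definition oct_basis_mult :: "8 \<Rightarrow> 8 \<Rightarrow> oct" where
  "oct_basis_mult i j =
     (if i = 0 then oct_e j
      else if j = 0 then oct_e i
      else (if i = j then - oct_e 0 else 0) + (\<Sum>k\<in>UNIV - {0}. oct_eps i j k *\<^sub>R oct_e k))"

definition oct_mult :: "oct \<Rightarrow> oct \<Rightarrow> oct" (infixl "\<odot>" 70) where
  "a \<odot> b = (\<Sum>i\<in>UNIV. \<Sum>j\<in>UNIV. (a $ i * b $ j) *\<^sub>R oct_basis_mult i j)"

definition oct_cnj :: "oct \<Rightarrow> oct" where
  "oct_cnj a = (2 * (a \<bullet> oct_e 0)) *\<^sub>R oct_e 0 - a"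


section \<open>The singular octonionic Hopf foliation\<close>

fun OH_anchor :: "oct \<times> oct \<Rightarrow> oct \<times> oct \<Rightarrow> oct \<times> oct" where
  "OH_anchor (x, y) (u, v) =
     ((norm x)\<^sup>2 *\<^sub>R u + (x \<odot> oct_cnj y) \<odot> v - (x \<bullet> u + y \<bullet> v) *\<^sub>R x,
      (norm y)\<^sup>2 *\<^sub>R v + (y \<odot> oct_cnj x) \<odot> u - (x \<bullet> u + y \<bullet> v) *\<^sub>R y)"

text \<open>The bracket of constant sections at the point \<open>p\<close>.  Note that
  \<open>(x, y) \<bullet> (u, v) = x \<bullet> u + y \<bullet> v\<close>.\<close>

definition OH_const_bracket :: "oct \<times> oct \<Rightarrow> oct \<times> oct \<Rightarrow> oct \<times> oct \<Rightarrow> oct \<times> oct" where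
  "OH_const_bracket p w w' = (p \<bullet> w) *\<^sub>R w' - (p \<bullet> w') *\<^sub>R w"

text \<open>The Leibniz rule applied to \<open>a = \<Sum>i. a\<^sub>i *\<^sub>R e\<^sub>i\<close> and \<open>b = \<Sum>j. b\<^sub>j *\<^sub>R e\<^sub>j\<close>, for constant sections \<open>e\<^sub>i\<close>,
  gives the bracket of arbitrary sections of the trivial bundle.\<close>

definition OH_bracket ::
    "(oct \<times> oct \<Rightarrow> oct \<times> oct) \<Rightarrow> (oct \<times> oct \<Rightarrow> oct \<times> oct) \<Rightarrow> oct \<times> oct \<Rightarrow> oct \<times> oct" where
  "OH_bracket a b p =
     OH_const_bracket p (a p) (b p)
     + frechet_derivative b (at p) (OH_anchor p (a p))
     - frechet_derivative a (at p) (OH_anchor p (b p))"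

definition OH_frame :: "nat \<Rightarrow> oct \<times> oct \<Rightarrow> oct \<times> oct" where
  "OH_frame i p = (if i < 8 then (oct_e (of_nat i), 0) else (0, oct_e (of_nat (i - 8))))"

definition OH_algebroid :: "(oct \<times> oct, oct \<times> oct) algebroid" where
  "OH_algebroid =
     \<lparr> vb_rank = 16, vb_fibre = (\<lambda>_. UNIV), vb_frames = {(UNIV, OH_frame)},
       la_anchor = OH_anchor, la_bracket = OH_bracket \<rparr>"

definition OH_foliation :: "(oct \<times> oct \<Rightarrow> oct \<times> oct) set" where
  "OH_foliation = algebroid_foliation OH_algebroid"

text \<open>The arrow \<open>(F, G, x, y)\<close> is written \<open>((F, G), (x, y))\<close>.\<close>

type_synonym OH_arrow = "(oct \<times> oct) \<times> (oct \<times> oct)"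

fun OH_lambda :: "OH_arrow \<Rightarrow> real" where
  "OH_lambda ((F, G), (x, y)) =
     sqrt (1 + 2 * (x \<bullet> F + y \<bullet> G + (x \<odot> oct_cnj y) \<bullet> (F \<odot> oct_cnj G))
           + (norm x)\<^sup>2 * (norm F)\<^sup>2 + (norm y)\<^sup>2 * (norm G)\<^sup>2)"

fun OH_target :: "OH_arrow \<Rightarrow> oct \<times> oct" where
  "OH_target ((F, G), (x, y)) =
     (1 / OH_lambda ((F, G), (x, y))) *\<^sub>R
       (x + (norm x)\<^sup>2 *\<^sub>R F + (x \<odot> oct_cnj y) \<odot> G,
        y + (norm y)\<^sup>2 *\<^sub>R G + (y \<odot> oct_cnj x) \<odot> F)"

definition OH_mult :: "OH_arrow \<Rightarrow> OH_arrow \<Rightarrow> OH_arrow" where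
  "OH_mult g' g = (fst g + OH_lambda g *\<^sub>R fst g', snd g)"

definition OH_inv :: "OH_arrow \<Rightarrow> OH_arrow" where
  "OH_inv g = (- (1 / OH_lambda g) *\<^sub>R fst g, OH_target g)"

definition OH_groupoid :: "(oct \<times> oct, OH_arrow, OH_arrow) groupoid" where
  "OH_groupoid =
     \<lparr> gp_top = top_of_set {g. OH_lambda g \<noteq> 0}, gp_charts = {({g. OH_lambda g \<noteq> 0}, id)},
       gp_source = snd, gp_target = OH_target, gp_unit = (\<lambda>p. (0, p)),
       gp_mult = OH_mult, gp_inv = OH_inv \<rparr>"

end

theory Submission
  imports Defs
begin

text \<open>Write \<open>p = (x, y)\<close> and \<open>OH_anchor p w = OH_Phi p w - (p \<bullet> w) *\<^sub>R p\<close>.  The map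
  \<open>OH_Phi p\<close> is symmetric, depends on \<open>p\<close> only through \<open>x \<bullet> x\<close>, \<open>y \<bullet> y\<close> and
  \<open>x \<odot> oct_cnj y\<close>, and these three quantities are constant along the leaves.  Since
  \<open>\<lambda>\<^sup>2 = 1 + 2 (p \<bullet> f) + f \<bullet> OH_Phi p f\<close> and the target of \<open>(f, p)\<close> is
  \<open>(p + OH_Phi p f) / \<lambda>\<close>, the groupoid axioms and the Jacobi identity become linear algebra with a
  fixed symmetric operator.

  For minimality, the anchor is homogeneous quadratic in \<open>p\<close>, so the coefficients at the origin of an
  element of the foliation with respect to the constant frame are determined by the element.  If
  vector fields \<open>B\<^sub>i\<close> generate the foliation near the origin, these coefficient vectors for the \<open>B\<^sub>i\<close>
  span \<open>\<real>\<^sup>1\<^sup>6\<close>.  A Lie algebroid of rank \<open>r\<close> provides \<open>r\<close> such generators; for a Lie groupoid the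
  coefficients of the generators range over the kernel of the differential of the source map.\<close>

section \<open>Smooth functions\<close>

text \<open>At \<open>p\<close> the anchor annihilates \<open>p\<close> itself, so its pointwise
  rank never reaches 16, and at the origin it is 0. The bound must therefore come from counting
  generators of the foliation near the origin, not from dimensions of leaves. Elements of a
  foliation have compact support, while frames are local. Every generator thus enters multiplied by
  a bump function that is nonzero at the origin and is divided out there. On the groupoid side no
  smooth frame of the kernel of the source differential is chosen. A basis of the whole model space
  is projected onto the kernel instead. This gives too many generators, but the coefficient vectors
  at the origin can be taken in the kernel, whose dimension is 16 less than that of the arrows;
  surjectivity onto a space of dimension 16 then gives 16 + 16. Since octonions do not associate,
  each triple product is arranged so that an element stands next to its own conjugate, or as a
  polarised pair of such products; alternativity and adjointness of multiplications then
  suffice.\<close>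

lemma frechet_derivative_cong_open:
  assumes "open S" "x \<in> S" "\<And>y. y \<in> S \<Longrightarrow> f y = g y"
  shows "frechet_derivative f (at x) = frechet_derivative g (at x)"
proof -
  have "(f has_derivative f') (at x) \<longleftrightarrow> (g has_derivative f') (at x)" for f'
    using assms has_derivative_transform_within_open by metis
  then show ?thesis
    by (simp add: frechet_derivative_def)
qed

lemma differentiable_cong_open:
  assumes "open S" "x \<in> S" "\<And>y. y \<in> S \<Longrightarrow> f y = g y"
  shows "f differentiable (at x) \<longleftrightarrow> g differentiable (at x)"
  using assms has_derivative_transform_within_open unfolding differentiable_def by metis

lemma has_derivative_frechet:
  assumes "f differentiable (at x)"
  shows "(f has_derivative frechet_derivative f (at x)) (at x)"
  using assms frechet_derivative_works by blast

lemma frechet_derivative_eqI: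
  assumes "(f has_derivative f') (at x)"
  shows "frechet_derivative f (at x) = f'"
  using frechet_derivative_at[OF assms] by simp

section \<open>Calculus of finitely often differentiable functions on open sets\<close>

lemma Ck_on_subset: "Ck_on k S f \<Longrightarrow> T \<subseteq> S \<Longrightarrow> Ck_on k T f"
  by (induction k arbitrary: f) (auto intro: continuous_on_subset)

lemma Ck_on_cong:
  assumes "Ck_on k S f" "open S" "\<And>x. x \<in> S \<Longrightarrow> f x = g x"
  shows "Ck_on k S g"
  using assms
proof (induction k arbitrary: f g)
  case 0
  then show ?case using continuous_on_cong by (metis Ck_on.simps(1))
next
  case (Suc k)
  have "Ck_on k S (\<lambda>x. frechet_derivative g (at x) v)" for v
  proof (rule Suc.IH)
    show "Ck_on k S (\<lambda>x. frechet_derivative f (at x) v)"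
      using Suc.prems by simp
  qed (use Suc.prems frechet_derivative_cong_open[OF Suc.prems(2) _ Suc.prems(3)] in auto)
  moreover have "\<forall>x\<in>S. g differentiable (at x)"
    using Suc.prems differentiable_cong_open[OF Suc.prems(2) _ Suc.prems(3)] by auto
  ultimately show ?case by simp
qed

lemma Ck_on_local:
  assumes "\<And>x. x \<in> S \<Longrightarrow> \<exists>T. open T \<and> x \<in> T \<and> Ck_on k (S \<inter> T) f" "open S"
  shows "Ck_on k S f"
  using assms
proof (induction k arbitrary: f)
  case 0
  show ?case
  proof (simp, rule continuous_at_imp_continuous_on, rule ballI)
    fix x assume "x \<in> S"
    then obtain T where T: "open T" "x \<in> T" "continuous_on (S \<inter> T) f" 
      using 0 by (metis Ck_on.simps(1))
    then show "isCont f x"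
      using \<open>x \<in> S\<close> 0(2) by (metis IntI continuous_on_eq_continuous_at open_Int)
  qed
next
  case (Suc k)
  have "Ck_on k S (\<lambda>x. frechet_derivative f (at x) v)" for v
    by (rule Suc.IH) (use Suc.prems in \<open>fastforce+\<close>)
  moreover have "\<forall>x\<in>S. f differentiable (at x)"
    using Suc.prems by fastforce
  ultimately show ?case by simp
qed

text \<open>\<open>Ck_on (Suc k)\<close> does not contain \<open>Ck_on k\<close> literally, so
  lowering the order takes an induction; its base case is that differentiability implies
  continuity.\<close>

lemma Ck_on_Suc_imp: "Ck_on (Suc k) S f \<Longrightarrow> Ck_on k S f"
proof (induction k arbitrary: f)
  case 0
  then show ?case
    by (auto intro!: continuous_at_imp_continuous_on differentiable_imp_continuous_within)
next
  case (Suc k)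
  then show ?case by (metis Ck_on.simps(2))
qed

lemma Ck_on_imp_continuous_on: "Ck_on k S f \<Longrightarrow> continuous_on S f"
  by (induction k) (use Ck_on_Suc_imp Ck_on.simps(1) in blast)+

lemma Ck_on_SucI:
  assumes "open S" "\<And>x. x \<in> S \<Longrightarrow> (f has_derivative f' x) (at x)"
    and "\<And>v. Ck_on k S (\<lambda>x. f' x v)"
  shows "Ck_on (Suc k) S f"
proof -
  have "Ck_on k S (\<lambda>x. frechet_derivative f (at x) v)" for v
    by (rule Ck_on_cong[OF assms(3)[of v] assms(1)]) (simp add: frechet_derivative_eqI[OF assms(2)])
  then show ?thesis using assms(2) by (auto simp: differentiable_def)
qed

lemma Ck_on_const [simp]: "Ck_on k S (\<lambda>x. c)"
  by (induction k arbitrary: c) auto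

lemma Ck_on_bounded_linear: 
  assumes "bounded_linear f"
  shows "Ck_on k S f"
proof -
  have f: "(f has_derivative f) (at x)" for x
    using assms by (rule bounded_linear_imp_has_derivative)
  show ?thesis
  proof (cases k)
    case 0
    then show ?thesis using assms by (simp add: linear_continuous_on)
  next
    case (Suc m)
    show ?thesis unfolding Suc Ck_on.simps(2) frechet_derivative_eqI[OF f]
      using f by (auto simp: differentiable_def)
  qed
qed

lemma Ck_on_add:
  assumes "open S" "Ck_on k S f" "Ck_on k S g"
  shows "Ck_on k S (\<lambda>x. f x + g x)"
  using assms(2,3)
proof (induction k arbitrary: f g)
  case 0
  then show ?case by (auto intro: continuous_intros)
next
  case (Suc k)
  show ?case
  proof (rule Ck_on_SucI[OF \<open>open S\<close>])
    show "((\<lambda>x. f x + g x) has_derivative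
        (\<lambda>v. frechet_derivative f (at x) v + frechet_derivative g (at x) v)) (at x)" if "x \<in> S" for x
      using Suc.prems that by (intro has_derivative_add has_derivative_frechet) auto
  qed (use Suc in auto)
qed

lemma Ck_on_sum:
  assumes "open S" "\<And>i. i \<in> I \<Longrightarrow> Ck_on k S (f i)"
  shows "Ck_on k S (\<lambda>x. \<Sum>i\<in>I. f i x)"
proof (cases "finite I")
  case True
  then show ?thesis using assms(2)
    by (induction I rule: finite_induct) (auto intro: Ck_on_add[OF \<open>open S\<close>])
qed auto

text \<open>The product rule gives two terms of the same bilinear shape, so the induction closes.
  One lemma thereby covers scaling, real products, inner products and the octonion product.\<close>

lemma Ck_on_bilinear:
  assumes "bounded_bilinear B" "open S" "Ck_on k S f" "Ck_on k S g"
  shows "Ck_on k S (\<lambda>x. B (f x) (g x))"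
  using assms(3,4)
proof (induction k arbitrary: f g)
  case 0
  then show ?case by (auto intro: bounded_bilinear.continuous_on[OF assms(1)])
next
  case (Suc k)
  show ?case
  proof (rule Ck_on_SucI[OF \<open>open S\<close>])
    show "((\<lambda>x. B (f x) (g x)) has_derivative
        (\<lambda>v. B (f x) (frechet_derivative g (at x) v) + B (frechet_derivative f (at x) v) (g x))) (at x)"
      if "x \<in> S" for x
      using Suc.prems that 
      by (intro bounded_bilinear.FDERIV[OF assms(1)] has_derivative_frechet) auto
    show "Ck_on k S (\<lambda>x. B (f x) (frechet_derivative g (at x) v) + B (frechet_derivative f (at x) v) (g x))" for v
      using Suc.prems Ck_on_Suc_imp[OF Suc.prems(1)] Ck_on_Suc_imp[OF Suc.prems(2)]
      by (intro Ck_on_add[OF \<open>open S\<close>] Suc.IH) auto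
  qed
qed

text \<open>\<open>Ck_on\<close> speaks of derivatives in fixed directions only. A direction that
  varies with the point is expanded in the basis, which turns it into scalar coefficients of
  derivatives in fixed directions.\<close>

lemma frechet_derivative_euclidean_sum:
  fixes f :: "'a::euclidean_space \<Rightarrow> 'b::real_normed_vector"
  assumes "f differentiable (at x)"
  shows "frechet_derivative f (at x) v = (\<Sum>b\<in>Basis. (v \<bullet> b) *\<^sub>R frechet_derivative f (at x) b)"
proof -
  have "frechet_derivative f (at x) v = frechet_derivative f (at x) (\<Sum>b\<in>Basis. (v \<bullet> b) *\<^sub>R b)"
    by (simp add: euclidean_representation)
  also have "\<dots> = (\<Sum>b\<in>Basis. (v \<bullet> b) *\<^sub>R frechet_derivative f (at x) b)"
    by (simp add: linear_sum[OF linear_frechet_derivative[OF assms]]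
        linear_scale[OF linear_frechet_derivative[OF assms]])
  finally show ?thesis .
qed

lemma Ck_on_compose:
  fixes g :: "'b::euclidean_space \<Rightarrow> 'c::real_normed_vector" and f :: "'a::euclidean_space \<Rightarrow> 'b"
  assumes "open S" "open T" "f ` S \<subseteq> T" "Ck_on k T g" "Ck_on k S f"
  shows "Ck_on k S (\<lambda>x. g (f x))"
  using assms(4,5)
proof (induction k arbitrary: g)
  case 0
  then show ?case using assms(3) continuous_on_compose2 by (metis Ck_on.simps(1))
next
  case (Suc k)
  have g: "g differentiable (at (f x))" if "x \<in> S" for x
    using that Suc.prems assms(3) by auto
  show ?case
  proof (rule Ck_on_SucI[OF \<open>open S\<close>])
    fix x assume x: "x \<in> S"
    have "((\<lambda>x. g (f x)) has_derivative (\<lambda>v. frechet_derivative g (at (f x)) (frechet_derivative f (at x) v))) (at x)"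
      using Suc.prems(2) x by (intro has_derivative_compose[where f=f and g=g, OF has_derivative_frechet has_derivative_frechet[OF g[OF x]]]) auto
    then show "((\<lambda>x. g (f x)) has_derivative
        (\<lambda>v. \<Sum>b\<in>Basis. (frechet_derivative f (at x) v \<bullet> b) *\<^sub>R frechet_derivative g (at (f x)) b)) (at x)"
      by (rule has_derivative_eq_rhs) (rule ext, rule frechet_derivative_euclidean_sum[OF g[OF x]])
  next
    fix v
    have *: "Ck_on k S (\<lambda>x. frechet_derivative f (at x) v \<bullet> b)" for b
      using Suc.prems(2) by (intro Ck_on_bilinear[OF bounded_bilinear_inner assms(1)]) auto
    have **: "Ck_on k S (\<lambda>x. frechet_derivative g (at (f x)) b)" for b
      using Suc.prems(1) by (intro Suc.IH[OF _ Ck_on_Suc_imp[OF Suc.prems(2)]]) auto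
    show "Ck_on k S (\<lambda>x. \<Sum>b\<in>Basis. (frechet_derivative f (at x) v \<bullet> b) *\<^sub>R frechet_derivative g (at (f x)) b)"
      by (rule Ck_on_sum[OF \<open>open S\<close> Ck_on_bilinear[OF bounded_bilinear_scaleR \<open>open S\<close> * **]])
  qed
qed

text \<open>The derivative of \<open>inverse\<close> is a polynomial in \<open>inverse\<close>, so
  the induction hypothesis applies to it.\<close>

lemma Ck_on_inverse: "Ck_on k {x::real. x \<noteq> 0} inverse"
proof (induction k)
  case 0
  then show ?case by (auto intro!: continuous_intros)
next
  case (Suc k)
  have o: "open {x::real. x \<noteq> 0}" by (intro open_Collect_neq continuous_intros)
  show ?case
  proof (rule Ck_on_SucI[OF o])
    show "(inverse has_derivative (\<lambda>v. - (inverse x * v * inverse x))) (at x)" if "x \<in> {x::real. x \<noteq> 0}" for x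
      using that has_derivative_inverse' by auto
    have "Ck_on k {x::real. x \<noteq> 0} (\<lambda>x. (inverse x * inverse x) * (- v))" for v
      by (intro Ck_on_bilinear[OF bounded_bilinear_mult] o Suc Ck_on_const)
    then show "Ck_on k {x::real. x \<noteq> 0} (\<lambda>x. - (inverse x * v * inverse x))" for v
      by (simp add: mult_ac)
  qed
qed

lemma Ck_on_sqrt: "Ck_on k {x::real. 0 < x} sqrt"
proof (induction k)
  case 0
  then show ?case by (auto intro!: continuous_intros)
next
  case (Suc k)
  have o: "open {x::real. 0 < x}" by (intro open_Collect_less continuous_intros)
  have o': "open {x::real. x \<noteq> 0}" by (intro open_Collect_neq continuous_intros)
  show ?case
  proof (rule Ck_on_SucI[OF o])
    show "(sqrt has_derivative (\<lambda>v. inverse (sqrt x) * (v / 2))) (at x)" if "x \<in> {x::real. 0 < x}" for x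
      using DERIV_real_sqrt[of x] that
      by (auto simp: has_field_derivative_def divide_simps mult_ac elim!: has_derivative_eq_rhs)
    have "Ck_on k {x::real. 0 < x} (\<lambda>x. inverse (sqrt x))"
      by (rule Ck_on_compose[OF o o' _ Ck_on_inverse Suc]) auto
    then show "Ck_on k {x::real. 0 < x} (\<lambda>x. inverse (sqrt x) * (v / 2))" for v
      by (intro Ck_on_bilinear[OF bounded_bilinear_mult] o Ck_on_const)
  qed
qed

section \<open>Smooth functions and the smoothness of derivatives\<close>

lemma smooth_on_subset: "smooth_on S f \<Longrightarrow> T \<subseteq> S \<Longrightarrow> smooth_on T f"
  by (auto simp: smooth_on_def intro: Ck_on_subset)

lemma smooth_on_cong:
  assumes "smooth_on S f" "open S" "\<And>x. x \<in> S \<Longrightarrow> f x = g x"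
  shows "smooth_on S g"
  using assms Ck_on_cong unfolding smooth_on_def by blast

lemma smooth_on_local:
  assumes "\<And>x. x \<in> S \<Longrightarrow> \<exists>T. open T \<and> x \<in> T \<and> smooth_on (S \<inter> T) f" "open S"
  shows "smooth_on S f"
  using assms Ck_on_local unfolding smooth_on_def by metis

lemma smooth_on_const [simp]: "smooth_on S (\<lambda>x. c)"
  by (simp add: smooth_on_def)

lemma smooth_on_bounded_linear: "bounded_linear f \<Longrightarrow> smooth_on S f"
  by (simp add: smooth_on_def Ck_on_bounded_linear)

lemma smooth_on_ident [simp]: "smooth_on S (\<lambda>x. x)"
  by (rule smooth_on_bounded_linear) (rule bounded_linear_ident)

lemma smooth_on_add: "open S \<Longrightarrow> smooth_on S f \<Longrightarrow> smooth_on S g \<Longrightarrow> smooth_on S (\<lambda>x. f x + g x)"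
  by (simp add: smooth_on_def Ck_on_add)

lemma smooth_on_sum:
  "open S \<Longrightarrow> (\<And>i. i \<in> I \<Longrightarrow> smooth_on S (f i)) \<Longrightarrow> smooth_on S (\<lambda>x. \<Sum>i\<in>I. f i x)"
  by (simp add: smooth_on_def Ck_on_sum)

lemma smooth_on_bilinear:
  "bounded_bilinear B \<Longrightarrow> open S \<Longrightarrow> smooth_on S f \<Longrightarrow> smooth_on S g \<Longrightarrow> smooth_on S (\<lambda>x. B (f x) (g x))"
  by (simp add: smooth_on_def Ck_on_bilinear)

lemmas smooth_on_scaleR = smooth_on_bilinear[OF bounded_bilinear_scaleR]
  and smooth_on_mult = smooth_on_bilinear[OF bounded_bilinear_mult]
  and smooth_on_inner = smooth_on_bilinear[OF bounded_bilinear_inner]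

lemma smooth_on_compose:
  fixes g :: "'b::euclidean_space \<Rightarrow> 'c::real_normed_vector" and f :: "'a::euclidean_space \<Rightarrow> 'b"
  assumes "smooth_on T g" "smooth_on S f" "open S" "open T" "f ` S \<subseteq> T"
  shows "smooth_on S (\<lambda>x. g (f x))"
  using assms Ck_on_compose unfolding smooth_on_def by blast

lemma smooth_on_linear_compose:
  fixes f :: "'a::euclidean_space \<Rightarrow> 'b::euclidean_space"
  assumes "bounded_linear L" "open S" "smooth_on S f"
  shows "smooth_on S (\<lambda>x. L (f x))"
  using smooth_on_compose[OF smooth_on_bounded_linear[OF assms(1)] assms(3,2) open_UNIV] by auto

lemma smooth_on_minus:
  "open S \<Longrightarrow> smooth_on S f \<Longrightarrow> smooth_on S (\<lambda>x. - f x)"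
  using smooth_on_scaleR[of S "\<lambda>x. -1" f] by simp

lemma smooth_on_diff:
  "open S \<Longrightarrow> smooth_on S f \<Longrightarrow> smooth_on S g \<Longrightarrow> smooth_on S (\<lambda>x. f x - g x)"
  using smooth_on_add[of S f "\<lambda>x. - g x"] smooth_on_minus[of S g] by simp

lemma smooth_on_fst:
  fixes f :: "'a::euclidean_space \<Rightarrow> 'b::euclidean_space \<times> 'c::euclidean_space"
  shows "open S \<Longrightarrow> smooth_on S f \<Longrightarrow> smooth_on S (\<lambda>x. fst (f x))"
  by (rule smooth_on_linear_compose[OF bounded_linear_fst])

lemma smooth_on_snd:
  fixes f :: "'a::euclidean_space \<Rightarrow> 'b::euclidean_space \<times> 'c::euclidean_space"
  shows "open S \<Longrightarrow> smooth_on S f \<Longrightarrow> smooth_on S (\<lambda>x. snd (f x))"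
  by (rule smooth_on_linear_compose[OF bounded_linear_snd])

lemma smooth_on_Pair:
  fixes f :: "'a::euclidean_space \<Rightarrow> 'b::euclidean_space" and g :: "'a \<Rightarrow> 'c::euclidean_space"
  assumes "open S" "smooth_on S f" "smooth_on S g"
  shows "smooth_on S (\<lambda>x. (f x, g x))"
proof -
  have 1: "bounded_linear (\<lambda>u::'b. (u, 0::'c))" and 2: "bounded_linear (\<lambda>u::'c. (0::'b, u))"
    by (rule bounded_linear_Pair, rule bounded_linear_ident, rule bounded_linear_zero,
        rule bounded_linear_Pair, rule bounded_linear_zero, rule bounded_linear_ident)
  have "smooth_on S (\<lambda>x. (f x, 0) + (0, g x))"
    by (rule smooth_on_add[OF assms(1) smooth_on_linear_compose[OF 1 assms(1,2)]
        smooth_on_linear_compose[OF 2 assms(1,3)]])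
  then show ?thesis by simp
qed

lemma smooth_on_inverse:
  fixes f :: "'a::euclidean_space \<Rightarrow> real"
  assumes "open S" "smooth_on S f" "\<And>x. x \<in> S \<Longrightarrow> f x \<noteq> 0"
  shows "smooth_on S (\<lambda>x. inverse (f x))"
proof (rule smooth_on_compose[OF _ assms(2,1)])
  show "smooth_on {x::real. x \<noteq> 0} inverse" by (simp add: smooth_on_def Ck_on_inverse)
  show "open {x::real. x \<noteq> 0}" by (intro open_Collect_neq continuous_intros)
qed (use assms(3) in auto)

lemma smooth_on_sqrt:
  fixes f :: "'a::euclidean_space \<Rightarrow> real"
  assumes "open S" "smooth_on S f" "\<And>x. x \<in> S \<Longrightarrow> 0 < f x"
  shows "smooth_on S (\<lambda>x. sqrt (f x))"
proof (rule smooth_on_compose[OF _ assms(2,1)])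
  show "smooth_on {x::real. 0 < x} sqrt" by (simp add: smooth_on_def Ck_on_sqrt)
  show "open {x::real. 0 < x}" by (intro open_Collect_less continuous_intros)
qed (use assms(3) in auto)

lemma smooth_on_imp_continuous_on: "smooth_on S f \<Longrightarrow> continuous_on S f"
  using Ck_on_imp_continuous_on smooth_on_def by blast

lemma smooth_on_imp_differentiable:
  assumes "smooth_on S f" "x \<in> S"
  shows "f differentiable (at x)"
proof -
  have "Ck_on (Suc 0) S f" using assms(1) smooth_on_def by blast
  then show ?thesis using assms(2) by simp
qed

lemma smooth_on_has_derivative:
  "smooth_on S f \<Longrightarrow> x \<in> S \<Longrightarrow> (f has_derivative frechet_derivative f (at x)) (at x)"
  by (intro has_derivative_frechet smooth_on_imp_differentiable)

lemma smooth_on_frechet_derivative: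
  "smooth_on S f \<Longrightarrow> smooth_on S (\<lambda>x. frechet_derivative f (at x) v)"
  by (metis Ck_on.simps(2) smooth_on_def)

lemma smooth_on_frechet_apply:
  fixes f :: "'b::euclidean_space \<Rightarrow> 'c::real_normed_vector" and g w :: "'a::euclidean_space \<Rightarrow> 'b"
  assumes "smooth_on T f" "smooth_on S g" "smooth_on S w" "open S" "open T" "g ` S \<subseteq> T"
  shows "smooth_on S (\<lambda>x. frechet_derivative f (at (g x)) (w x))"
proof (rule smooth_on_cong[OF _ assms(4)])
  show "smooth_on S (\<lambda>x. \<Sum>b\<in>Basis. (w x \<bullet> b) *\<^sub>R frechet_derivative f (at (g x)) b)"
    by (rule smooth_on_sum[OF assms(4)], rule smooth_on_scaleR[OF assms(4)],
        rule smooth_on_inner[OF assms(4,3)], simp,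
        rule smooth_on_compose[OF smooth_on_frechet_derivative[OF assms(1)] assms(2,4,5,6)])
  show "(\<Sum>b\<in>Basis. (w x \<bullet> b) *\<^sub>R frechet_derivative f (at (g x)) b) = frechet_derivative f (at (g x)) (w x)"
    if "x \<in> S" for x
  proof -
    have "f differentiable (at (g x))"
      using assms that by (intro smooth_on_imp_differentiable[OF assms(1)]) auto
    then show ?thesis by (rule frechet_derivative_euclidean_sum[symmetric])
  qed
qed

text \<open>\<open>S\<close> is covered by the two open sets \<open>U\<close> and the complement of
  \<open>C\<close>; on the second one the function is zero.\<close>

lemma smooth_on_extend_zero:
  assumes "smooth_on (S \<inter> U) f" "open S" "open U" "closed C" "C \<subseteq> U" "\<And>x. x \<in> S - C \<Longrightarrow> f x = 0"
  shows "smooth_on S f"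
proof (rule smooth_on_local[OF _ assms(2)])
  fix x assume x: "x \<in> S"
  show "\<exists>T. open T \<and> x \<in> T \<and> smooth_on (S \<inter> T) f"
  proof (cases "x \<in> U")
    case True
    then show ?thesis using assms by blast
  next
    case False
    have o: "open (S \<inter> - C)" using assms by (intro open_Int open_Compl)
    have "smooth_on (S \<inter> - C) f"
      by (rule smooth_on_cong[OF smooth_on_const[of _ 0] o]) (use assms(6) in auto)
    then show ?thesis using False x assms by (intro exI[of _ "- C"]) auto
  qed
qed

section \<open>Symmetry of second derivatives\<close>

lemma symmetric_second_derivative_real:
  fixes f :: "'a::euclidean_space \<Rightarrow> real"
  assumes f: "smooth_on UNIV f"
  shows "frechet_derivative (\<lambda>x. frechet_derivative f (at x) v) (at p) w =
         frechet_derivative (\<lambda>x. frechet_derivative f (at x) w) (at p) v"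
proof -
  define d where "d = (\<lambda>g (v::'a) x. frechet_derivative g (at x) v :: real)"
  have sm: "smooth_on UNIV g \<Longrightarrow> smooth_on UNIV (d g v)" for g v
    unfolding d_def by (rule smooth_on_frechet_derivative)
  have line: "DERIV (\<lambda>t. g (q + t *\<^sub>R v)) t :> d g v (q + t *\<^sub>R v)" if "smooth_on UNIV g" for g q v t
  proof -
    have g: "(g has_derivative (\<lambda>v. d g v (q + t *\<^sub>R v'))) (at (q + t *\<^sub>R v'))" for v'
      unfolding d_def using smooth_on_has_derivative[OF that] by auto
    have "((\<lambda>t. q + t *\<^sub>R v) has_derivative (\<lambda>h. h *\<^sub>R v)) (at t)"
      by (auto intro!: derivative_eq_intros)
    from has_derivative_compose[OF this g]
    have "((\<lambda>t. g (q + t *\<^sub>R v)) has_derivative (\<lambda>h. d g (h *\<^sub>R v) (q + t *\<^sub>R v))) (at t)" .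
    moreover have "d g (h *\<^sub>R v) x = d g v x * h" for h x
      unfolding d_def using linear_scale[OF linear_frechet_derivative] smooth_on_imp_differentiable[OF that]
      by (metis UNIV_I mult.commute real_scaleR_def)
    ultimately show ?thesis by (simp add: has_field_derivative_def)
  qed
  \<comment> \<open>The second difference over the parallelogram with sides
    \<open>s *\<^sub>R v\<close> and \<open>s *\<^sub>R w\<close> is symmetric in \<open>v\<close>
    and \<open>w\<close>. The mean value theorem, applied along one side and then along the other,
    turns it into a mixed derivative at a point of the parallelogram; the side taken first decides
    the order of differentiation.\<close>
  have key: "\<exists>\<xi> \<eta>. 0 < \<xi> \<and> \<xi> < s \<and> 0 < \<eta> \<and> \<eta> < s \<and>
      f (p + s *\<^sub>R v + s *\<^sub>R w) - f (p + s *\<^sub>R v) - f (p + s *\<^sub>R w) + f p = s * (s * d (d f v) w (p + \<xi> *\<^sub>R v + \<eta> *\<^sub>R w))"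
    if "s > 0" for s v w
  proof -
    have "DERIV (\<lambda>t. f ((p + s *\<^sub>R w) + t *\<^sub>R v) - f (p + t *\<^sub>R v)) t :>
        d f v ((p + s *\<^sub>R w) + t *\<^sub>R v) - d f v (p + t *\<^sub>R v)" for t
      by (intro DERIV_diff line f)
    from MVT2[OF that this] obtain \<xi> where \<xi>: "0 < \<xi>" "\<xi> < s"
      "f ((p + s *\<^sub>R w) + s *\<^sub>R v) - f (p + s *\<^sub>R v) - (f (p + s *\<^sub>R w) - f p) =
       s * (d f v ((p + s *\<^sub>R w) + \<xi> *\<^sub>R v) - d f v (p + \<xi> *\<^sub>R v))"
      by auto
    from MVT2[OF that line[OF sm[OF f]], of v "p + \<xi> *\<^sub>R v" w] obtain \<eta> where \<eta>: "0 < \<eta>" "\<eta> < s"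
      "d f v (p + \<xi> *\<^sub>R v + s *\<^sub>R w) - d f v (p + \<xi> *\<^sub>R v) = s * d (d f v) w (p + \<xi> *\<^sub>R v + \<eta> *\<^sub>R w)"
      by auto
    show ?thesis using \<xi> \<eta> by (intro exI[of _ \<xi>] exI[of _ \<eta>]) (simp add: algebra_simps)
  qed
  define a b where "a = d (d f v) w" and "b = d (d f w) v"
  have "a p = b p"
  proof (rule ccontr)
    assume ne: "a p \<noteq> b p"
    define e where "e = \<bar>a p - b p\<bar> / 2"
    have e: "e > 0" using ne by (simp add: e_def)
    have "isCont a p" "isCont b p"
      using smooth_on_imp_continuous_on[OF sm[OF sm[OF f]]] unfolding a_def b_def
      by (simp_all add: continuous_on_eq_continuous_at)
    then obtain d1 d2 where d: "d1 > 0" "d2 > 0" "\<And>y. dist y p < d1 \<Longrightarrow> dist (a y) (a p) < e"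
      "\<And>y. dist y p < d2 \<Longrightarrow> dist (b y) (b p) < e"
      using e unfolding continuous_at_eps_delta by metis
    \<comment> \<open>So small that the whole parallelogram lies in both neighbourhoods; the summand
      1 keeps the denominator positive when \<open>v\<close> and \<open>w\<close> are zero.\<close>
    define s where "s = min d1 d2 / (norm v + norm w + 1)"
    have nn: "norm v + norm w + 1 > 0" by (smt (verit) norm_ge_zero)
    have s: "s > 0" using d nn by (simp add: s_def)
    have near: "dist (p + \<xi> *\<^sub>R v' + \<eta> *\<^sub>R w') p < min d1 d2"
      if "0 < \<xi>" "\<xi> < s" "0 < \<eta>" "\<eta> < s" "(v' = v \<and> w' = w) \<or> (v' = w \<and> w' = v)" for \<xi> \<eta> v' w'
    proof -
      have "dist (p + \<xi> *\<^sub>R v' + \<eta> *\<^sub>R w') p = norm (\<xi> *\<^sub>R v' + \<eta> *\<^sub>R w')"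
        by (simp add: dist_norm)
      also have "\<dots> \<le> \<xi> * norm v' + \<eta> * norm w'"
        using that norm_triangle_ineq[of "\<xi> *\<^sub>R v'" "\<eta> *\<^sub>R w'"] by simp
      also have "\<dots> \<le> s * norm v' + s * norm w'"
        using that by (intro add_mono mult_right_mono) auto
      also have "\<dots> < s * (norm v + norm w + 1)"
        using that s by (auto simp: algebra_simps)
      also have "\<dots> = min d1 d2" using nn by (simp add: s_def)
      finally show ?thesis .
    qed
    from key[OF s, of v w] obtain x1 x2 where x: "0 < x1" "x1 < s" "0 < x2" "x2 < s"
      "f (p + s *\<^sub>R v + s *\<^sub>R w) - f (p + s *\<^sub>R v) - f (p + s *\<^sub>R w) + f p = s * (s * a (p + x1 *\<^sub>R v + x2 *\<^sub>R w))"
      unfolding a_def by blast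
    from key[OF s, of w v] obtain y1 y2 where y: "0 < y1" "y1 < s" "0 < y2" "y2 < s"
      "f (p + s *\<^sub>R w + s *\<^sub>R v) - f (p + s *\<^sub>R w) - f (p + s *\<^sub>R v) + f p = s * (s * b (p + y1 *\<^sub>R w + y2 *\<^sub>R v))"
      unfolding b_def by blast
    have "s * (s * a (p + x1 *\<^sub>R v + x2 *\<^sub>R w)) = s * (s * b (p + y1 *\<^sub>R w + y2 *\<^sub>R v))"
      using x(5) y(5) by (simp add: algebra_simps)
    then have "a (p + x1 *\<^sub>R v + x2 *\<^sub>R w) = b (p + y1 *\<^sub>R w + y2 *\<^sub>R v)"
      using s by simp
    moreover have "dist (a (p + x1 *\<^sub>R v + x2 *\<^sub>R w)) (a p) < e"
      using near[OF x(1-4)] by (intro d(3)) auto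
    moreover have "dist (b (p + y1 *\<^sub>R w + y2 *\<^sub>R v)) (b p) < e"
      using near[OF y(1-4)] by (intro d(4)) auto
    ultimately show False unfolding e_def dist_real_def by (simp add: abs_if split: if_splits)
  qed
  then show ?thesis by (simp add: a_def b_def d_def)
qed

lemma frechet_derivative_inner:
  fixes f :: "'a::real_normed_vector \<Rightarrow> 'b::real_inner"
  assumes "f differentiable (at x)"
  shows "frechet_derivative (\<lambda>x. f x \<bullet> e) (at x) = (\<lambda>v. frechet_derivative f (at x) v \<bullet> e)"
  by (intro frechet_derivative_eqI has_derivative_inner_left has_derivative_frechet assms)

lemma symmetric_second_derivative:
  fixes f :: "'a::euclidean_space \<Rightarrow> 'b::euclidean_space"
  assumes f: "smooth_on UNIV f"
  shows "frechet_derivative (\<lambda>x. frechet_derivative f (at x) v) (at p) w =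
         frechet_derivative (\<lambda>x. frechet_derivative f (at x) w) (at p) v"
proof (rule euclidean_eqI)
  fix e :: 'b
  have 1: "frechet_derivative (\<lambda>x. f x \<bullet> e) (at x) = (\<lambda>v. frechet_derivative f (at x) v \<bullet> e)" for x
    using frechet_derivative_inner smooth_on_imp_differentiable[OF f] by auto
  have 2: "frechet_derivative (\<lambda>x. frechet_derivative f (at x) v \<bullet> e) (at p) w =
      frechet_derivative (\<lambda>x. frechet_derivative f (at x) v) (at p) w \<bullet> e" for v w
    using frechet_derivative_inner smooth_on_imp_differentiable[OF smooth_on_frechet_derivative[OF f]]
    by (metis UNIV_I)
  show "frechet_derivative (\<lambda>x. frechet_derivative f (at x) v) (at p) w \<bullet> e =
      frechet_derivative (\<lambda>x. frechet_derivative f (at x) w) (at p) v \<bullet> e"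
    using symmetric_second_derivative_real[OF smooth_on_inner[OF open_UNIV f smooth_on_const], of e v p w]
    unfolding 1 2 .
qed

section \<open>Bump functions\<close>

definition exp_recip :: "nat \<Rightarrow> real \<Rightarrow> real" where
  "exp_recip n t = (if t > 0 then inverse t ^ n / exp (inverse t) else 0)"

lemma exp_recip_tendsto: "(exp_recip n \<longlongrightarrow> 0) (at_right 0)"
proof -
  have "((\<lambda>t::real. inverse t ^ n / exp (inverse t)) \<longlongrightarrow> 0) (at_right 0)"
    by (rule filterlim_compose[OF tendsto_power_div_exp_0 filterlim_inverse_at_top_right])
  then show ?thesis
    by (rule Lim_transform_eventually) (simp add: eventually_at_filter exp_recip_def)
qed

text \<open>The powers of \<open>inverse t\<close> are part of the family so that it is closed under
  differentiation; smoothness then follows by induction on the order for all \<open>n\<close> at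
  once. The bump function itself uses only \<open>n = 0\<close>.\<close>

lemma exp_recip_has_derivative:
  "((exp_recip n) has_real_derivative (exp_recip (n + 2) t - n * exp_recip (n + 1) t)) (at t)"
proof -
  consider "t > 0" | "t < 0" | "t = 0" by linarith
  then show ?thesis
  proof cases
    case 1
    have "((\<lambda>t. inverse t ^ n * exp (- inverse t)) has_real_derivative
        (real n * inverse t ^ (n - 1) * (- (inverse t)\<^sup>2)) * exp (- inverse t) +
        inverse t ^ n * (exp (- inverse t) * (inverse t)\<^sup>2)) (at t)"
      using 1 by (auto intro!: derivative_eq_intros simp: power2_eq_square)
    moreover have "(real n * inverse t ^ (n - 1) * (- (inverse t)\<^sup>2)) * exp (- inverse t) +
        inverse t ^ n * (exp (- inverse t) * (inverse t)\<^sup>2) = exp_recip (n + 2) t - n * exp_recip (n + 1) t"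
      using 1 by (cases n) (simp_all add: exp_recip_def exp_minus divide_inverse power2_eq_square algebra_simps)
    ultimately have "((\<lambda>t. inverse t ^ n / exp (inverse t)) has_real_derivative
        (exp_recip (n + 2) t - n * exp_recip (n + 1) t)) (at t)"
      by (simp add: exp_minus divide_inverse)
    then show ?thesis
      by (rule has_field_derivative_transform_within_open[where S = "{0<..}"])
        (use 1 in \<open>auto simp: exp_recip_def\<close>)
  next
    case 2
    have "((\<lambda>t. 0) has_real_derivative (exp_recip (n + 2) t - n * exp_recip (n + 1) t)) (at t)"
      using 2 by (simp add: exp_recip_def)
    then show ?thesis
      by (rule has_field_derivative_transform_within_open[where S = "{..<0}"])
        (use 2 in \<open>auto simp: exp_recip_def\<close>)
  next
    case 3
    \<comment> \<open>To the right of 0 the difference quotient is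
      \<open>exp_recip (n + 1)\<close>.\<close>
    have "((\<lambda>h. exp_recip n h / h) \<longlongrightarrow> 0) (at_right 0)"
      by (rule Lim_transform_eventually[OF exp_recip_tendsto[of "n + 1"]])
        (simp add: eventually_at_filter exp_recip_def field_simps)
    moreover have "((\<lambda>h. exp_recip n h / h) \<longlongrightarrow> 0) (at_left 0)"
      by (rule Lim_transform_eventually[OF tendsto_const])
        (simp add: eventually_at_filter exp_recip_def)
    ultimately have "((\<lambda>h. exp_recip n h / h) \<longlongrightarrow> 0) (at 0)"
      by (rule filterlim_split_at[rotated])
    then show ?thesis using 3 by (simp add: DERIV_def exp_recip_def)
  qed
qed

lemma smooth_exp_recip: "smooth_on UNIV (exp_recip n)"
proof -
  have "Ck_on k UNIV (exp_recip n)" for k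
  proof (induction k arbitrary: n)
    case 0
    have "isCont (exp_recip n) t" for t
      using exp_recip_has_derivative by (rule DERIV_isCont)
    then show ?case by (simp add: continuous_at_imp_continuous_on)
  next
    case (Suc k)
    show ?case
    proof (rule Ck_on_SucI[OF open_UNIV])
      show "(exp_recip n has_derivative (\<lambda>v. (exp_recip (n + 2) t + (- real n) * exp_recip (n + 1) t) * v)) (at t)" for t
        using exp_recip_has_derivative[of n t] by (simp add: has_field_derivative_def)
      show "Ck_on k UNIV (\<lambda>t. (exp_recip (n + 2) t + (- real n) * exp_recip (n + 1) t) * v)" for v
        by (intro Ck_on_bilinear[OF bounded_bilinear_mult open_UNIV] Ck_on_add Suc Ck_on_const open_UNIV)
    qed
  qed
  then show ?thesis by (simp add: smooth_on_def)
qed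

text \<open>Compact support admits \<open>h\<close> as a coefficient in \<open>Cc_span\<close>, the
  closed set \<open>C\<close> inside \<open>U\<close> allows local data multiplied by
  \<open>h\<close> to be extended by zero, and \<open>h\<close> can be divided out on
  \<open>V\<close>.\<close>

lemma bump_exists:
  fixes p :: "'a::euclidean_space"
  assumes "open U" "p \<in> U"
  obtains h :: "'a \<Rightarrow> real" and C V where "smooth_compact_support h" "closed C" "C \<subseteq> U"
    "\<And>x. x \<notin> C \<Longrightarrow> h x = 0" "open V" "p \<in> V" "\<And>x. x \<in> V \<Longrightarrow> h x \<noteq> 0"
proof -
  obtain r where r: "r > 0" "cball p r \<subseteq> U"
    using assms open_contains_cball by blast
  define h where "h = (\<lambda>x. exp_recip 0 (r\<^sup>2 - (x - p) \<bullet> (x - p)))"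
  have pos: "0 < r\<^sup>2 - (x - p) \<bullet> (x - p) \<longleftrightarrow> x \<in> ball p r" for x
  proof -
    have "(x - p) \<bullet> (x - p) < r\<^sup>2 \<longleftrightarrow> norm (x - p) < r"
      using r by (metis abs_le_square_iff abs_of_pos abs_norm_cancel linorder_not_le power2_norm_eq_inner)
    then show ?thesis by (simp add: dist_norm norm_minus_commute)
  qed
  have nz: "h x \<noteq> 0 \<longleftrightarrow> x \<in> ball p r" for x
    using pos[of x] by (auto simp: h_def exp_recip_def)
  have "smooth_on UNIV (\<lambda>x. r\<^sup>2 - (x - p) \<bullet> (x - p))"
    by (intro smooth_on_diff smooth_on_inner open_UNIV smooth_on_const smooth_on_ident)
  from smooth_on_compose[OF smooth_exp_recip[of 0] this open_UNIV open_UNIV subset_UNIV]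
  have "smooth_on UNIV h"
    unfolding h_def .
  moreover have "{x. h x \<noteq> 0} = ball p r" using nz by blast
  ultimately have s: "smooth_compact_support h"
    using r by (simp add: smooth_compact_support_def closure_ball)
  show ?thesis
  proof (rule that[of h "cball p r" "ball p r"])
    show "h x = 0" if "x \<notin> cball p r" for x
      using nz[of x] that by (auto simp: ball_def cball_def)
    show "h x \<noteq> 0" if "x \<in> ball p r" for x using nz that by blast
  qed (use s r in auto)
qed

section \<open>Octonions\<close>

lemma UNIV_8: "(UNIV :: 8 set) = {0, 1, 2, 3, 4, 5, 6, 7}"
proof (rule card_subset_eq[symmetric])
  show "card {0, 1, 2, 3, 4, 5, 6, 7 :: 8} = card (UNIV :: 8 set)"
    by simp
qed auto

lemma sum_8: "sum f (UNIV :: 8 set) = f 0 + f 1 + f 2 + f 3 + f 4 + f 5 + f 6 + f 7"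
  unfolding UNIV_8 by (simp add: add.assoc)

lemma oct_eq_iff:
  fixes a b :: oct
  shows "a = b \<longleftrightarrow> a $ 0 = b $ 0 \<and> a $ 1 = b $ 1 \<and> a $ 2 = b $ 2 \<and> a $ 3 = b $ 3 \<and>
    a $ 4 = b $ 4 \<and> a $ 5 = b $ 5 \<and> a $ 6 = b $ 6 \<and> a $ 7 = b $ 7"
proof -
  have "a = b \<longleftrightarrow> (\<forall>i\<in>UNIV. a $ i = b $ i)" by (simp add: vec_eq_iff)
  then show ?thesis unfolding UNIV_8 by simp
qed

text \<open>With the multiplication table written out, conjugation of products, adjointness and left
  alternativity become polynomial identities in real coordinates. Later facts are deduced from these
  few without returning to coordinates.\<close>

lemma oct_mult_nth:
  "(a \<odot> b) $ 0 = a$0*b$0 - a$1*b$1 - a$2*b$2 - a$3*b$3 - a$4*b$4 - a$5*b$5 - a$6*b$6 - a$7*b$7"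
  "(a \<odot> b) $ 1 = a$0*b$1 + a$1*b$0 + a$2*b$3 - a$3*b$2 + a$4*b$5 - a$5*b$4 + a$7*b$6 - a$6*b$7"
  "(a \<odot> b) $ 2 = a$0*b$2 + a$2*b$0 + a$3*b$1 - a$1*b$3 + a$4*b$6 - a$6*b$4 + a$5*b$7 - a$7*b$5"
  "(a \<odot> b) $ 3 = a$0*b$3 + a$3*b$0 + a$1*b$2 - a$2*b$1 + a$4*b$7 - a$7*b$4 + a$6*b$5 - a$5*b$6"
  "(a \<odot> b) $ 4 = a$0*b$4 + a$4*b$0 + a$5*b$1 - a$1*b$5 + a$6*b$2 - a$2*b$6 + a$7*b$3 - a$3*b$7"
  "(a \<odot> b) $ 5 = a$0*b$5 + a$5*b$0 + a$1*b$4 - a$4*b$1 + a$7*b$2 - a$2*b$7 + a$3*b$6 - a$6*b$3"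
  "(a \<odot> b) $ 6 = a$0*b$6 + a$6*b$0 + a$1*b$7 - a$7*b$1 + a$2*b$4 - a$4*b$2 + a$5*b$3 - a$3*b$5"
  "(a \<odot> b) $ 7 = a$0*b$7 + a$7*b$0 + a$6*b$1 - a$1*b$6 + a$2*b$5 - a$5*b$2 + a$3*b$4 - a$4*b$3"
proof -
  have "UNIV - {0::8} = {1, 2, 3, 4, 5, 6, 7}" unfolding UNIV_8 by auto
  then show
  "(a \<odot> b) $ 0 = a$0*b$0 - a$1*b$1 - a$2*b$2 - a$3*b$3 - a$4*b$4 - a$5*b$5 - a$6*b$6 - a$7*b$7"
  "(a \<odot> b) $ 1 = a$0*b$1 + a$1*b$0 + a$2*b$3 - a$3*b$2 + a$4*b$5 - a$5*b$4 + a$7*b$6 - a$6*b$7"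
  "(a \<odot> b) $ 2 = a$0*b$2 + a$2*b$0 + a$3*b$1 - a$1*b$3 + a$4*b$6 - a$6*b$4 + a$5*b$7 - a$7*b$5"
  "(a \<odot> b) $ 3 = a$0*b$3 + a$3*b$0 + a$1*b$2 - a$2*b$1 + a$4*b$7 - a$7*b$4 + a$6*b$5 - a$5*b$6"
  "(a \<odot> b) $ 4 = a$0*b$4 + a$4*b$0 + a$5*b$1 - a$1*b$5 + a$6*b$2 - a$2*b$6 + a$7*b$3 - a$3*b$7"
  "(a \<odot> b) $ 5 = a$0*b$5 + a$5*b$0 + a$1*b$4 - a$4*b$1 + a$7*b$2 - a$2*b$7 + a$3*b$6 - a$6*b$3"
  "(a \<odot> b) $ 6 = a$0*b$6 + a$6*b$0 + a$1*b$7 - a$7*b$1 + a$2*b$4 - a$4*b$2 + a$5*b$3 - a$3*b$5"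
  "(a \<odot> b) $ 7 = a$0*b$7 + a$7*b$0 + a$6*b$1 - a$1*b$6 + a$2*b$5 - a$5*b$2 + a$3*b$4 - a$4*b$3"
    by (simp_all add: oct_mult_def sum_8 oct_basis_mult_def oct_eps_def oct_triples_def oct_e_def axis_def)
qed

lemma oct_cnj_nth:
  "oct_cnj a $ 0 = a $ 0" "oct_cnj a $ 1 = - a $ 1" "oct_cnj a $ 2 = - a $ 2" "oct_cnj a $ 3 = - a $ 3"
  "oct_cnj a $ 4 = - a $ 4" "oct_cnj a $ 5 = - a $ 5" "oct_cnj a $ 6 = - a $ 6" "oct_cnj a $ 7 = - a $ 7"
  by (simp_all add: oct_cnj_def oct_e_def inner_axis' inner_axis) (simp_all add: axis_def)

lemma oct_inner: "a \<bullet> b = a$0*b$0 + a$1*b$1 + a$2*b$2 + a$3*b$3 + a$4*b$4 + a$5*b$5 + a$6*b$6 + a$7*b$7"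
  for a b :: oct
  by (simp add: inner_vec_def sum_8)

section \<open>Conjugation, adjointness and alternativity\<close>

lemma oct_cnj_mult: "oct_cnj (a \<odot> b) = oct_cnj b \<odot> oct_cnj a"
  unfolding oct_eq_iff oct_cnj_nth oct_mult_nth by (intro conjI; algebra)

lemma oct_inner_mult_left: "(a \<odot> b) \<bullet> c = b \<bullet> (oct_cnj a \<odot> c)"
  unfolding oct_inner oct_cnj_nth oct_mult_nth by algebra

lemma oct_inner_mult_right: "(a \<odot> b) \<bullet> c = a \<bullet> (c \<odot> oct_cnj b)"
  unfolding oct_inner oct_cnj_nth oct_mult_nth by algebra

lemma oct_cnj_alternative_left: "oct_cnj a \<odot> (a \<odot> b) = (a \<bullet> a) *\<^sub>R b"
  unfolding oct_eq_iff oct_inner oct_cnj_nth oct_mult_nth vector_scaleR_component real_scaleR_def by (intro conjI; algebra)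

lemma oct_cnj_cnj [simp]: "oct_cnj (oct_cnj a) = a"
  unfolding oct_eq_iff oct_cnj_nth by simp

lemma oct_cnj_inner [simp]: "oct_cnj a \<bullet> oct_cnj b = a \<bullet> b"
  unfolding oct_inner oct_cnj_nth by simp

lemma bounded_linear_oct_cnj: "bounded_linear oct_cnj"
  unfolding linear_conv_bounded_linear[symmetric]
  by (rule linearI) (simp_all add: oct_cnj_def inner_add_left algebra_simps)

lemma bounded_bilinear_oct_mult: "bounded_bilinear (\<odot>)"
  unfolding bilinear_conv_bounded_bilinear[symmetric] bilinear_def
  by (intro conjI allI linearI)
    (simp_all add: oct_mult_def algebra_simps sum.distrib scaleR_sum_right)

lemmas oct_cnj_linear_simps =
  linear_add[OF bounded_linear.linear[OF bounded_linear_oct_cnj]]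
  linear_scale[OF bounded_linear.linear[OF bounded_linear_oct_cnj]]
  linear_neg[OF bounded_linear.linear[OF bounded_linear_oct_cnj]]
  linear_diff[OF bounded_linear.linear[OF bounded_linear_oct_cnj]]

lemmas oct_mult_linear_simps =
  bounded_bilinear.add_left[OF bounded_bilinear_oct_mult]
  bounded_bilinear.add_right[OF bounded_bilinear_oct_mult]
  bounded_bilinear.diff_left[OF bounded_bilinear_oct_mult]
  bounded_bilinear.diff_right[OF bounded_bilinear_oct_mult]
  bounded_bilinear.minus_left[OF bounded_bilinear_oct_mult]
  bounded_bilinear.minus_right[OF bounded_bilinear_oct_mult]
  bounded_bilinear.scaleR_left[OF bounded_bilinear_oct_mult]
  bounded_bilinear.scaleR_right[OF bounded_bilinear_oct_mult]
  bounded_bilinear.zero_left[OF bounded_bilinear_oct_mult]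
  bounded_bilinear.zero_right[OF bounded_bilinear_oct_mult]

lemma oct_alternative_left: "a \<odot> (oct_cnj a \<odot> b) = (a \<bullet> a) *\<^sub>R b"
  using oct_cnj_alternative_left[of "oct_cnj a" b] by simp

text \<open>Conjugation reverses products and so carries the left law to the right law.\<close>

lemma oct_alternative_right: "(b \<odot> a) \<odot> oct_cnj a = (a \<bullet> a) *\<^sub>R b"
proof -
  have "oct_cnj ((b \<odot> a) \<odot> oct_cnj a) = oct_cnj ((a \<bullet> a) *\<^sub>R b)"
    by (simp add: oct_cnj_mult oct_alternative_left oct_cnj_linear_simps)
  then show ?thesis by (metis oct_cnj_cnj)
qed

lemma oct_cnj_alternative_right: "(b \<odot> oct_cnj a) \<odot> a = (a \<bullet> a) *\<^sub>R b"
  using oct_alternative_right[of b "oct_cnj a"] by simp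

text \<open>Polarisation of \<open>oct_alternative_left\<close>: expand it at \<open>a + c\<close>
  and subtract the diagonal terms. Together with its right-hand version this takes the place of
  associativity.\<close>

lemma oct_alternative_left_polar:
  "a \<odot> (oct_cnj c \<odot> b) + c \<odot> (oct_cnj a \<odot> b) = (2 * (a \<bullet> c)) *\<^sub>R b"
  using oct_alternative_left[of "a + c" b] oct_alternative_left[of a b] oct_alternative_left[of c b]
  by (simp add: oct_mult_linear_simps oct_cnj_linear_simps inner_add_left inner_add_right
      inner_commute[of c a] algebra_simps)

lemma oct_alternative_right_polar:
  "(b \<odot> a) \<odot> oct_cnj c + (b \<odot> c) \<odot> oct_cnj a = (2 * (a \<bullet> c)) *\<^sub>R b"
  using oct_alternative_right[of b "a + c"] oct_alternative_right[of b a] oct_alternative_right[of b c]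
  by (simp add: oct_mult_linear_simps oct_cnj_linear_simps inner_add_left inner_add_right
      inner_commute[of c a] algebra_simps)

lemma oct_mult_inner_self: "(a \<odot> b) \<bullet> (a \<odot> b) = (a \<bullet> a) * (b \<bullet> b)"
  by (simp add: oct_inner_mult_left oct_cnj_alternative_left)

section \<open>Target map and anchor\<close>

text \<open>The non-radial part of the anchor.\<close>

fun OH_Phi :: "oct \<times> oct \<Rightarrow> oct \<times> oct \<Rightarrow> oct \<times> oct" where
  "OH_Phi (x, y) (u, v) =
     ((x \<bullet> x) *\<^sub>R u + (x \<odot> oct_cnj y) \<odot> v, (y \<bullet> y) *\<^sub>R v + oct_cnj (x \<odot> oct_cnj y) \<odot> u)"

lemma OH_Phi_linear: "linear (OH_Phi p)"
  by (cases p, rule linearI) (auto simp: oct_mult_linear_simps algebra_simps)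

lemmas OH_Phi_linear_simps = linear_add[OF OH_Phi_linear] linear_scale[OF OH_Phi_linear]
  linear_neg[OF OH_Phi_linear] linear_diff[OF OH_Phi_linear] linear_0[OF OH_Phi_linear]

text \<open>The diagonal blocks are scalars, and the off-diagonal blocks are left multiplications by
  \<open>z\<close> and by \<open>oct_cnj z\<close>, which are adjoint to each other.\<close>

lemma OH_Phi_sym: "OH_Phi p f \<bullet> g = OH_Phi p g \<bullet> f"
proof -
  obtain x y F G F' G' where [simp]: "p = (x, y)" "f = (F, G)" "g = (F', G')"
    by (metis surj_pair)
  define z where "z = x \<odot> oct_cnj y"
  have "(z \<odot> G) \<bullet> F' = G \<bullet> (oct_cnj z \<odot> F')" "(z \<odot> G') \<bullet> F = G' \<bullet> (oct_cnj z \<odot> F)"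
    by (rule oct_inner_mult_left)+
  then show ?thesis
    by (simp add: z_def[symmetric] inner_add_left inner_add_right inner_commute)
qed

lemma OH_anchor_eq: "OH_anchor p w = OH_Phi p w - (p \<bullet> w) *\<^sub>R p"
  by (cases p; cases w) (simp add: power2_norm_eq_inner oct_cnj_mult algebra_simps)

text \<open>For the anchor, which subtracts \<open>(p \<bullet> f) *\<^sub>R p\<close>, this says
  that the squared norms of \<open>x\<close> and of \<open>y\<close> have derivative zero along it.
  The proof moves \<open>z = x \<odot> oct_cnj y\<close> to the other side of the inner product,
  where it meets \<open>x\<close> or \<open>y\<close> and cancels by alternativity.\<close>

lemma OH_Phi_radial:
  "fst p \<bullet> fst (OH_Phi p f) = (fst p \<bullet> fst p) * (p \<bullet> f)"
  "snd p \<bullet> snd (OH_Phi p f) = (snd p \<bullet> snd p) * (p \<bullet> f)"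
proof -
  obtain x y F G where [simp]: "p = (x, y)" "f = (F, G)"
    by (metis surj_pair)
  have "x \<bullet> ((x \<odot> oct_cnj y) \<odot> G) = (oct_cnj (x \<odot> oct_cnj y) \<odot> x) \<bullet> G"
    by (metis inner_commute oct_inner_mult_left)
  then have 1: "x \<bullet> ((x \<odot> oct_cnj y) \<odot> G) = (x \<bullet> x) * (y \<bullet> G)"
    by (simp add: oct_cnj_mult oct_cnj_alternative_right)
  have "y \<bullet> (oct_cnj (x \<odot> oct_cnj y) \<odot> F) = ((x \<odot> oct_cnj y) \<odot> y) \<bullet> F"
    by (metis inner_commute oct_inner_mult_left)
  then have 2: "y \<bullet> (oct_cnj (x \<odot> oct_cnj y) \<odot> F) = (y \<bullet> y) * (x \<bullet> F)"
    by (simp add: oct_cnj_alternative_right)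
  show "fst p \<bullet> fst (OH_Phi p f) = (fst p \<bullet> fst p) * (p \<bullet> f)"
    "snd p \<bullet> snd (OH_Phi p f) = (snd p \<bullet> snd p) * (p \<bullet> f)"
    using 1 2 by (simp_all add: inner_add_right algebra_simps)
qed

text \<open>The third infinitesimal invariance: \<open>x \<odot> oct_cnj y\<close> has derivative
  zero along the anchor, since its radial part contributes exactly the right-hand side with the
  opposite sign.\<close>

lemma OH_Phi_cross:
  "fst (OH_Phi p f) \<odot> oct_cnj (snd p) + fst p \<odot> oct_cnj (snd (OH_Phi p f)) =
    (2 * (p \<bullet> f)) *\<^sub>R (fst p \<odot> oct_cnj (snd p))"
proof -
  obtain x y F G where [simp]: "p = (x, y)" "f = (F, G)"
    by (metis surj_pair)
  define z where "z = x \<odot> oct_cnj y"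
  have zy: "z \<odot> y = (y \<bullet> y) *\<^sub>R x" by (simp add: z_def oct_cnj_alternative_right)
  have xz: "oct_cnj x \<odot> z = (x \<bullet> x) *\<^sub>R oct_cnj y" by (simp add: z_def oct_cnj_alternative_left)
  \<comment> \<open>The scalar multiples of \<open>x\<close> and \<open>oct_cnj y\<close> are
    rewritten backwards as products with \<open>z\<close>, so that the four terms form two polarised
    pairs.\<close>
  have "fst (OH_Phi p f) \<odot> oct_cnj (snd p) + fst p \<odot> oct_cnj (snd (OH_Phi p f)) =
    (F \<odot> (oct_cnj x \<odot> z) + x \<odot> (oct_cnj F \<odot> z)) + ((z \<odot> G) \<odot> oct_cnj y + (z \<odot> y) \<odot> oct_cnj G)"
    unfolding zy xz by (simp add: z_def[symmetric] oct_mult_linear_simps oct_cnj_linear_simps oct_cnj_mult)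
  also have "\<dots> = (2 * (p \<bullet> f)) *\<^sub>R z"
    unfolding oct_alternative_left_polar oct_alternative_right_polar
    by (simp add: inner_commute scaleR_add_left[symmetric] del: scaleR_add_left)
  finally show ?thesis by (simp add: z_def)
qed

text \<open>The squared norm of \<open>z\<close> is the product of those of \<open>x\<close> and
  \<open>y\<close>, so a common factor can be taken out of all terms; adjointness identifies what
  remains with the quadratic form.\<close>

lemma OH_Phi_norm:
  "fst (OH_Phi p f) \<bullet> fst (OH_Phi p f) = (fst p \<bullet> fst p) * (f \<bullet> OH_Phi p f)"
  "snd (OH_Phi p f) \<bullet> snd (OH_Phi p f) = (snd p \<bullet> snd p) * (f \<bullet> OH_Phi p f)"
proof -
  obtain x y F G where [simp]: "p = (x, y)" "f = (F, G)"
    by (metis surj_pair)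
  define z where "z = x \<odot> oct_cnj y"
  have "z \<bullet> z = (x \<bullet> x) * (y \<bullet> y)" by (simp add: z_def oct_mult_inner_self)
  moreover have "G \<bullet> (oct_cnj z \<odot> F) = F \<bullet> (z \<odot> G)"
    by (metis inner_commute oct_inner_mult_left)
  ultimately show 
    "fst (OH_Phi p f) \<bullet> fst (OH_Phi p f) = (fst p \<bullet> fst p) * (f \<bullet> OH_Phi p f)"
    "snd (OH_Phi p f) \<bullet> snd (OH_Phi p f) = (snd p \<bullet> snd p) * (f \<bullet> OH_Phi p f)"
    by (simp_all add: z_def[symmetric] inner_add_left inner_add_right oct_mult_inner_self
        inner_commute[of "z \<odot> G"] inner_commute[of "oct_cnj z \<odot> F"] algebra_simps)
qed

lemma OH_Phi_mult:
  "fst (OH_Phi p f) \<odot> oct_cnj (snd (OH_Phi p f)) = (f \<bullet> OH_Phi p f) *\<^sub>R (fst p \<odot> oct_cnj (snd p))"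
proof -
  obtain x y F G where [simp]: "p = (x, y)" "f = (F, G)"
    by (metis surj_pair)
  define z where "z = x \<odot> oct_cnj y"
  define C where "C = oct_cnj z \<odot> F"
  have zz: "z \<bullet> z = (x \<bullet> x) * (y \<bullet> y)" by (simp add: z_def oct_mult_inner_self)
  have sw: "G \<bullet> C = F \<bullet> (z \<odot> G)"
    unfolding C_def by (metis inner_commute oct_inner_mult_left)
  have zC: "(z \<bullet> z) *\<^sub>R F = z \<odot> C" by (simp add: C_def oct_alternative_left)
  have Fz: "oct_cnj F \<odot> z = oct_cnj C" by (simp add: C_def oct_cnj_mult)
  \<comment> \<open>The term with \<open>F \<odot> oct_cnj G\<close> carries the squared norm of
    \<open>z\<close> as its coefficient. Absorbing this into \<open>F\<close> yields
    \<open>z \<odot> C\<close>, which pairs with the other mixed term under polarised right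
    alternativity, with no division and hence no case \<open>z = 0\<close>.\<close>
  have "(z \<odot> C) \<odot> oct_cnj G + (z \<odot> G) \<odot> oct_cnj C = (2 * (F \<bullet> (z \<odot> G))) *\<^sub>R z"
    unfolding oct_alternative_right_polar inner_commute[of C] sw ..
  moreover have "(z \<odot> C) \<odot> oct_cnj G = ((x \<bullet> x) * (y \<bullet> y)) *\<^sub>R (F \<odot> oct_cnj G)"
    by (simp add: zC[symmetric] zz oct_mult_linear_simps)
  ultimately have 1: "((x \<bullet> x) * (y \<bullet> y)) *\<^sub>R (F \<odot> oct_cnj G) + (z \<odot> G) \<odot> oct_cnj C = (2 * (F \<bullet> (z \<odot> G))) *\<^sub>R z"
    by simp
  have 2: "F \<odot> oct_cnj C = (F \<bullet> F) *\<^sub>R z"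
    by (simp add: Fz[symmetric] oct_alternative_left)
  have "fst (OH_Phi p f) \<odot> oct_cnj (snd (OH_Phi p f)) =
     (((x \<bullet> x) * (y \<bullet> y)) *\<^sub>R (F \<odot> oct_cnj G) + (z \<odot> G) \<odot> oct_cnj C)
     + (x \<bullet> x) *\<^sub>R (F \<odot> oct_cnj C) + (y \<bullet> y) *\<^sub>R ((z \<odot> G) \<odot> oct_cnj G)"
    by (simp add: z_def[symmetric] C_def[symmetric] oct_mult_linear_simps oct_cnj_linear_simps algebra_simps)
  also have "\<dots> = (f \<bullet> OH_Phi p f) *\<^sub>R z"
    unfolding 1 2 by (simp add: z_def[symmetric] C_def[symmetric] oct_alternative_right inner_add_right sw algebra_simps)
  finally show ?thesis by (simp add: z_def)
qed

lemma OH_Phi_cong: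
  assumes "fst p \<bullet> fst p = fst q \<bullet> fst q" "snd p \<bullet> snd p = snd q \<bullet> snd q"
    "fst p \<odot> oct_cnj (snd p) = fst q \<odot> oct_cnj (snd q)"
  shows "OH_Phi p = OH_Phi q"
  using assms by (cases p; cases q) (auto simp: fun_eq_iff)

text \<open>The radicand of \<open>OH_lambda\<close>, kept apart because it is a quadratic
  polynomial in \<open>f\<close> that can be expanded before roots are taken.\<close>

definition OH_L :: "oct \<times> oct \<Rightarrow> oct \<times> oct \<Rightarrow> real" where
  "OH_L f p = 1 + 2 * (p \<bullet> f) + f \<bullet> OH_Phi p f"

lemma OH_lambda_eq: "OH_lambda (f, p) = sqrt (OH_L f p)"
proof -
  obtain x y F G where [simp]: "p = (x, y)" "f = (F, G)"
    by (metis surj_pair)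
  define z where "z = x \<odot> oct_cnj y"
  have 1: "G \<bullet> (oct_cnj z \<odot> F) = F \<bullet> (z \<odot> G)"
    by (metis inner_commute oct_inner_mult_left)
  have 2: "z \<bullet> (F \<odot> oct_cnj G) = F \<bullet> (z \<odot> G)"
    by (metis inner_commute oct_inner_mult_right oct_cnj_cnj)
  show ?thesis
    by (simp add: OH_L_def z_def[symmetric] 1 2 power2_norm_eq_inner inner_add_right algebra_simps)
qed

lemma OH_target_eq: "OH_target (f, p) = inverse (OH_lambda (f, p)) *\<^sub>R (p + OH_Phi p f)"
  by (cases f; cases p) (simp add: power2_norm_eq_inner oct_cnj_mult divide_inverse algebra_simps del: OH_lambda.simps)

text \<open>All three invariants are quadratic in the point, and the numerator of the target scales
  them by the same factor \<open>OH_L f p\<close>. Dividing the numerator by the square root of this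
  factor restores them; this is where the normalisation by \<open>OH_lambda\<close> comes
  from.\<close>

lemma OH_flow_invariants:
  defines "N \<equiv> \<lambda>p f. p + OH_Phi p f"
  shows "fst (N p f) \<bullet> fst (N p f) = OH_L f p * (fst p \<bullet> fst p)"
    "snd (N p f) \<bullet> snd (N p f) = OH_L f p * (snd p \<bullet> snd p)"
    "fst (N p f) \<odot> oct_cnj (snd (N p f)) = OH_L f p *\<^sub>R (fst p \<odot> oct_cnj (snd p))"
proof -
  show "fst (N p f) \<bullet> fst (N p f) = OH_L f p * (fst p \<bullet> fst p)"
    "snd (N p f) \<bullet> snd (N p f) = OH_L f p * (snd p \<bullet> snd p)"
    by (simp_all add: N_def OH_L_def inner_add_left inner_add_right OH_Phi_norm OH_Phi_radial
        inner_commute[of "fst (OH_Phi p f)" "fst p"] inner_commute[of "snd (OH_Phi p f)" "snd p"] algebra_simps)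
  have "fst (N p f) \<odot> oct_cnj (snd (N p f)) = fst p \<odot> oct_cnj (snd p) +
     (fst (OH_Phi p f) \<odot> oct_cnj (snd p) + fst p \<odot> oct_cnj (snd (OH_Phi p f))) +
     fst (OH_Phi p f) \<odot> oct_cnj (snd (OH_Phi p f))"
    by (simp add: N_def oct_mult_linear_simps oct_cnj_linear_simps)
  then show "fst (N p f) \<odot> oct_cnj (snd (N p f)) = OH_L f p *\<^sub>R (fst p \<odot> oct_cnj (snd p))"
    unfolding OH_Phi_cross OH_Phi_mult by (simp add: OH_L_def algebra_simps)
qed

text \<open>Away from \<open>p = 0\<close> it is a quotient of squared norms, by
  \<open>OH_flow_invariants\<close>; at \<open>p = 0\<close> it is 1. As \<open>sqrt\<close> is an
  odd function on all reals, this is what makes the square of \<open>OH_lambda\<close> equal to the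
  radicand.\<close>

lemma OH_L_nonneg: "OH_L f p \<ge> 0"
proof (cases "p = 0")
  case True
  then show ?thesis by (cases f) (simp add: OH_L_def zero_prod_def oct_mult_linear_simps oct_cnj_linear_simps
       linear_0[OF bounded_linear.linear[OF bounded_linear_oct_cnj]])
next
  case False
  then consider "fst p \<noteq> 0" | "snd p \<noteq> 0" by (metis prod_eq_iff fst_zero snd_zero)
  then show ?thesis
    using OH_flow_invariants(1,2)[of p f] by cases (metis inner_ge_zero inner_gt_zero_iff zero_le_mult_iff not_le)+
qed

lemma OH_lambda_sq: "(OH_lambda (f, p))\<^sup>2 = OH_L f p"
  by (simp add: OH_lambda_eq OH_L_nonneg)

lemma OH_lambda_nonneg: "OH_lambda (f, p) \<ge> 0"
  by (simp add: OH_lambda_eq OH_L_nonneg)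

text \<open>The finite form of constancy along leaves: source and target of an arrow define the same
  operator.\<close>

lemma OH_Phi_target:
  assumes "OH_lambda (f, p) \<noteq> 0"
  shows "OH_Phi (OH_target (f, p)) = OH_Phi p"
proof -
  define l where "l = OH_lambda (f, p)"
  have l: "OH_L f p = l * l" "l \<noteq> 0"
    using assms by (simp_all add: l_def OH_lambda_sq[symmetric] power2_eq_square)
  define N where "N = p + OH_Phi p f"
  have "fst N \<bullet> fst N = (l * l) * (fst p \<bullet> fst p)" "snd N \<bullet> snd N = (l * l) * (snd p \<bullet> snd p)"
    "fst N \<odot> oct_cnj (snd N) = (l * l) *\<^sub>R (fst p \<odot> oct_cnj (snd p))"
    unfolding N_def OH_flow_invariants l(1) by simp_all
  then show ?thesis
    unfolding OH_target_eq l_def[symmetric] N_def[symmetric]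
    by (intro OH_Phi_cong) (use l(2) in \<open>simp_all add: oct_mult_linear_simps oct_cnj_linear_simps field_simps\<close>)
qed

text \<open>Expand the quadratic polynomial \<open>OH_L\<close> at the sum. Symmetry of
  \<open>OH_Phi p\<close> merges the mixed terms into the inner product of \<open>f'\<close> with
  the numerator of the target, and \<open>OH_Phi\<close> is the same at the target, so a factor
  \<open>l * l\<close> splits off.\<close>

lemma OH_lambda_mult:
  assumes "OH_lambda (f, p) \<noteq> 0"
  shows "OH_lambda (f + OH_lambda (f, p) *\<^sub>R f', p) = OH_lambda (f, p) * OH_lambda (f', OH_target (f, p))"
proof -
  define l where "l = OH_lambda (f, p)"
  have l: "OH_L f p = l * l" "l \<noteq> 0" "l \<ge> 0"
    using assms OH_lambda_nonneg by (simp_all add: l_def OH_lambda_sq[symmetric] power2_eq_square)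
  have 1: "OH_Phi p f \<bullet> f' = OH_Phi p f' \<bullet> f" by (rule OH_Phi_sym)
  have "OH_L (f + l *\<^sub>R f') p = OH_L f p + 2 * l * ((p + OH_Phi p f) \<bullet> f') + l * l * (f' \<bullet> OH_Phi p f')"
    by (simp add: OH_L_def OH_Phi_linear_simps inner_add_left inner_add_right inner_commute[of f] 1 
        inner_commute[of f'] algebra_simps)
  moreover have "p + OH_Phi p f = l *\<^sub>R OH_target (f, p)"
    using l by (simp add: OH_target_eq l_def)
  ultimately have "OH_L (f + l *\<^sub>R f') p = (l * l) * OH_L f' (OH_target (f, p))"
    using l OH_Phi_target[OF assms] by (simp add: OH_L_def algebra_simps)
  then show ?thesis
    using l by (simp add: OH_lambda_eq[of "f + _"] OH_lambda_eq[of f'] real_sqrt_mult l_def[symmetric])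
qed

lemma OH_target_mult:
  assumes "OH_lambda (f, p) \<noteq> 0" "OH_lambda (f', OH_target (f, p)) \<noteq> 0"
  shows "OH_target (f + OH_lambda (f, p) *\<^sub>R f', p) = OH_target (f', OH_target (f, p))"
proof -
  define l where "l = OH_lambda (f, p)"
  define t where "t = OH_target (f, p)"
  have t: "p + OH_Phi p f = l *\<^sub>R t"
    using assms by (simp add: OH_target_eq l_def t_def)
  have "OH_target (f + l *\<^sub>R f', p) = inverse (l * OH_lambda (f', t)) *\<^sub>R (p + OH_Phi p f + l *\<^sub>R OH_Phi p f')"
    using assms by (simp add: OH_target_eq OH_lambda_mult l_def t_def OH_Phi_linear_simps algebra_simps)
  also have "\<dots> = inverse (OH_lambda (f', t)) *\<^sub>R (t + OH_Phi p f')"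
    unfolding t using assms(1) by (simp add: l_def[symmetric] scaleR_add_right[symmetric] del: scaleR_add_right)
  also have "\<dots> = OH_target (f', t)"
    using OH_Phi_target[OF assms(1)] by (simp add: OH_target_eq t_def)
  finally show ?thesis by (simp add: l_def t_def)
qed

lemma OH_lambda_zero [simp]: "OH_lambda (0, p) = 1"
  by (simp add: OH_lambda_eq OH_L_def)

lemma OH_target_zero [simp]: "OH_target (0, p) = p"
  by (simp add: OH_target_eq OH_Phi_linear_simps)

text \<open>The fibre coordinate of the inverse solves
  \<open>f + OH_lambda (f, p) *\<^sub>R f' = 0\<close>, so the composite is a unit and the two
  multiplication formulas can be solved for the inverse.\<close>

lemma OH_inverse:
  assumes "OH_lambda (f, p) \<noteq> 0"
  shows "OH_lambda (- (1 / OH_lambda (f, p)) *\<^sub>R f, OH_target (f, p)) = 1 / OH_lambda (f, p)"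
    "OH_target (- (1 / OH_lambda (f, p)) *\<^sub>R f, OH_target (f, p)) = p"
proof -
  let ?f = "- (1 / OH_lambda (f, p)) *\<^sub>R f"
  have 0: "f + OH_lambda (f, p) *\<^sub>R ?f = 0" using assms by simp
  show 1: "OH_lambda (?f, OH_target (f, p)) = 1 / OH_lambda (f, p)"
    using OH_lambda_mult[OF assms, of ?f] assms unfolding 0 OH_lambda_zero by (simp add: field_simps)
  show "OH_target (?f, OH_target (f, p)) = p"
    using OH_target_mult[OF assms, of ?f] 1 assms unfolding 0 OH_target_zero by simp
qed

section \<open>The Lie algebroid\<close>

lemma smooth_on_oct_cnj:
  fixes f :: "'a::euclidean_space \<Rightarrow> oct"
  shows "open S \<Longrightarrow> smooth_on S f \<Longrightarrow> smooth_on S (\<lambda>x. oct_cnj (f x))"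
  by (rule smooth_on_linear_compose[OF bounded_linear_oct_cnj])

lemmas smooth_on_oct_mult = smooth_on_bilinear[OF bounded_bilinear_oct_mult]

text \<open>The defining equation matches on explicit pairs; the rules for smoothness and
  derivatives need projections of arbitrary arguments.\<close>

lemma OH_Phi_eq: "OH_Phi p w =
   ((fst p \<bullet> fst p) *\<^sub>R fst w + (fst p \<odot> oct_cnj (snd p)) \<odot> snd w,
    (snd p \<bullet> snd p) *\<^sub>R snd w + (snd p \<odot> oct_cnj (fst p)) \<odot> fst w)"
  by (cases p; cases w) (simp add: oct_cnj_mult)

lemma smooth_on_OH_Phi:
  fixes f w :: "'a::euclidean_space \<Rightarrow> oct \<times> oct"
  assumes "open S" "smooth_on S f" "smooth_on S w"
  shows "smooth_on S (\<lambda>x. OH_Phi (f x) (w x))"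
  unfolding OH_Phi_eq
  by (intro smooth_on_Pair smooth_on_add smooth_on_scaleR smooth_on_inner smooth_on_fst smooth_on_snd
      smooth_on_oct_mult smooth_on_oct_cnj assms)

lemma smooth_on_OH_anchor:
  fixes f w :: "'a::euclidean_space \<Rightarrow> oct \<times> oct"
  assumes "open S" "smooth_on S f" "smooth_on S w"
  shows "smooth_on S (\<lambda>x. OH_anchor (f x) (w x))"
  unfolding OH_anchor_eq
  by (intro smooth_on_diff smooth_on_OH_Phi smooth_on_scaleR smooth_on_inner assms)

lemma linear_OH_anchor: "linear (OH_anchor p)"
  by (rule linearI) (simp_all add: OH_anchor_eq OH_Phi_linear_simps inner_add_right algebra_simps)

lemmas OH_anchor_linear_simps = linear_add[OF linear_OH_anchor] linear_scale[OF linear_OH_anchor]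
  linear_diff[OF linear_OH_anchor]

lemma OH_anchor_sym: "OH_anchor p v \<bullet> w = OH_anchor p w \<bullet> v"
  using OH_Phi_sym[of p v w] by (simp add: OH_anchor_eq inner_diff_left)

lemma smooth_on_OH_bracket:
  assumes "smooth_on UNIV a" "smooth_on UNIV b"
  shows "smooth_on UNIV (OH_bracket a b)"
proof -
  have "smooth_on UNIV (\<lambda>p. frechet_derivative b (at p) (OH_anchor p (a p)))"
    "smooth_on UNIV (\<lambda>p. frechet_derivative a (at p) (OH_anchor p (b p)))"
    using assms by (auto intro!: smooth_on_frechet_apply smooth_on_OH_anchor)
  then have "smooth_on UNIV (\<lambda>p. OH_bracket a b p)"
    unfolding OH_bracket_def OH_const_bracket_def
    by (intro smooth_on_add smooth_on_diff smooth_on_scaleR smooth_on_inner assms open_UNIV smooth_on_ident)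
  then show ?thesis by simp
qed

lemma OH_frame_image: "(\<lambda>i. OH_frame i p) ` {..<16} = Basis"
proof -
  have "{..<16::nat} = {0, 1, 2, 3, 4, 5, 6, 7, 8, 9, 10, 11, 12, 13, 14, 15}"
    by (auto simp: lessThan_nat_numeral)
  then have "(\<lambda>i. OH_frame i p) ` {..<16} = (\<lambda>u. (u, 0)) ` oct_e ` {0, 1, 2, 3, 4, 5, 6, 7} \<union>
      (\<lambda>v. (0, v)) ` oct_e ` {0, 1, 2, 3, 4, 5, 6, 7}"
    by (simp only: image_insert image_empty OH_frame_def) auto
  moreover have "(Basis :: oct set) = oct_e ` {0, 1, 2, 3, 4, 5, 6, 7}"
    unfolding UNIV_8[symmetric] by (auto simp: Basis_vec_def oct_e_def)
  ultimately show ?thesis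
    by (simp only: Basis_prod_def)
qed

lemma OH_frame_bij: "bij_betw (\<lambda>i. OH_frame i p) {..<16} Basis"
proof -
  have "card ((\<lambda>i. OH_frame i p) ` {..<16}) = card {..<16::nat}"
    unfolding OH_frame_image by simp
  then show ?thesis
    by (simp add: bij_betw_def OH_frame_image eq_card_imp_inj_on)
qed

lemma OH_section_iff: "smooth_section OH_algebroid a \<longleftrightarrow> smooth_on UNIV a"
proof
  assume "smooth_section OH_algebroid a"
  then obtain f where f: "\<forall>i<16. smooth_on UNIV (f i)" "\<forall>p. a p = (\<Sum>i<16. f i p *\<^sub>R OH_frame i p)"
    unfolding smooth_section_def by (auto simp: OH_algebroid_def)
  \<comment> \<open>The frame does not depend on the base point, so its value at 0 serves everywhere
    and only the coefficients vary.\<close>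
  have "smooth_on UNIV (\<lambda>p. \<Sum>i<16. f i p *\<^sub>R OH_frame i 0)"
    by (intro smooth_on_sum smooth_on_scaleR open_UNIV smooth_on_const) (use f(1) in auto)
  moreover have "OH_frame i 0 = OH_frame i p" for i p
    by (simp add: OH_frame_def)
  ultimately show "smooth_on UNIV a"
    using f(2) by (metis (no_types, lifting) ext)
next
  assume a: "smooth_on UNIV a"
  have "a p = (\<Sum>i<16. (a p \<bullet> OH_frame i 0) *\<^sub>R OH_frame i p)" for p
  proof -
    have "a p = (\<Sum>b\<in>Basis. (a p \<bullet> b) *\<^sub>R b)" by (simp add: euclidean_representation)
    also have "\<dots> = (\<Sum>i<16. (a p \<bullet> OH_frame i p) *\<^sub>R OH_frame i p)"
      by (rule sum.reindex_bij_betw[OF OH_frame_bij, symmetric])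
    finally show ?thesis by (simp add: OH_frame_def)
  qed
  moreover have "\<forall>i<16. smooth_on UNIV (\<lambda>p. a p \<bullet> OH_frame i 0)"
    using a by (auto intro: smooth_on_inner)
  ultimately show "smooth_section OH_algebroid a"
    unfolding smooth_section_def OH_algebroid_def by (auto intro!: exI[of _ "\<lambda>i p. a p \<bullet> OH_frame i 0"])
qed

lemma OH_vector_bundle: "vector_bundle OH_algebroid"
proof -
  have "\<exists>g :: nat \<Rightarrow> nat \<Rightarrow> oct \<times> oct \<Rightarrow> real. (\<forall>i<16. \<forall>j<16. smooth_on UNIV (g i j)) \<and>
      (\<forall>x. \<forall>j<16. OH_frame j x = (\<Sum>i<16. g i j x *\<^sub>R OH_frame i x))"
    by (rule exI[of _ "\<lambda>i j x. if i = j then 1 else 0"])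
      (auto simp: if_distrib[of "\<lambda>c. c *\<^sub>R _"] cong: if_cong)
  moreover have "inj_on (\<lambda>i. OH_frame i p) {..<16}" for p
    using OH_frame_bij by (rule bij_betw_imp_inj_on)
  ultimately show ?thesis
    unfolding vector_bundle_def OH_algebroid_def
    by (simp add: OH_frame_image independent_Basis span_Basis)
qed

section \<open>Derivatives of the anchor and the bracket, and the Jacobi identity\<close>

lemma OH_anchor_has_derivative:
  assumes "(w has_derivative w') (at p)"
  shows "((\<lambda>q. OH_anchor q (w q)) has_derivative (\<lambda>\<xi>.
     ((2 * (fst p \<bullet> fst \<xi>)) *\<^sub>R fst (w p) + (fst \<xi> \<odot> oct_cnj (snd p) + fst p \<odot> oct_cnj (snd \<xi>)) \<odot> snd (w p),
      (2 * (snd p \<bullet> snd \<xi>)) *\<^sub>R snd (w p) + (snd \<xi> \<odot> oct_cnj (fst p) + snd p \<odot> oct_cnj (fst \<xi>)) \<odot> fst (w p))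
     - (\<xi> \<bullet> w p) *\<^sub>R p - (p \<bullet> w p) *\<^sub>R \<xi> + OH_anchor p (w' \<xi>))) (at p)"
  unfolding OH_anchor_eq OH_Phi_eq
  by (rule derivative_eq_intros bounded_bilinear.FDERIV[OF bounded_bilinear_oct_mult]
      bounded_linear.has_derivative[OF bounded_linear_oct_cnj] assms refl)+
    (auto simp: fun_eq_iff oct_mult_linear_simps inner_commute algebra_simps prod_eq_iff inner_add_left inner_add_right)

text \<open>Because \<open>OH_Phi\<close> is constant along the leaves, only the radial part of the anchor is
  differentiated.\<close>

lemma OH_anchor_derivative_along_leaf:
  assumes "(w has_derivative w') (at p)"
  shows "frechet_derivative (\<lambda>q. OH_anchor q (w q)) (at p) (OH_anchor p v) =
    OH_anchor p (w' (OH_anchor p v)) - (OH_anchor p v \<bullet> w p) *\<^sub>R p - (p \<bullet> w p) *\<^sub>R OH_anchor p v"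
proof -
  define \<xi> where "\<xi> = OH_anchor p v"
  have 1: "fst p \<bullet> fst \<xi> = 0" "snd p \<bullet> snd \<xi> = 0"
    by (simp_all add: \<xi>_def OH_anchor_eq inner_diff_right OH_Phi_radial)
  have 2: "fst \<xi> \<odot> oct_cnj (snd p) + fst p \<odot> oct_cnj (snd \<xi>) = 0"
    using OH_Phi_cross[of p v]
    by (simp add: \<xi>_def OH_anchor_eq oct_mult_linear_simps oct_cnj_linear_simps algebra_simps
        flip: scaleR_2)
  have "oct_cnj (fst \<xi> \<odot> oct_cnj (snd p) + fst p \<odot> oct_cnj (snd \<xi>)) = 0"
    unfolding 2 using bounded_linear.linear[OF bounded_linear_oct_cnj] by (rule linear_0)
  then have 3: "snd \<xi> \<odot> oct_cnj (fst p) + snd p \<odot> oct_cnj (fst \<xi>) = 0"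
    by (simp add: oct_cnj_linear_simps oct_cnj_mult add.commute)
  show ?thesis
    unfolding frechet_derivative_eqI[OF OH_anchor_has_derivative[OF assms]] \<xi>_def[symmetric] 1 2 3
    by (simp add: oct_mult_linear_simps zero_prod_def[symmetric])
qed

text \<open>Expanding \<open>w q\<close> in the basis leaves second derivatives with a basis vector
  in the inner slot. Symmetry exchanges the slots, so that the sum over the basis can be folded back
  into \<open>w p\<close>.\<close>

lemma frechet_derivative_frechet_apply:
  fixes c :: "'a::euclidean_space \<Rightarrow> 'b::euclidean_space"
  assumes c: "smooth_on UNIV c" and w: "(w has_derivative w') (at p)"
  shows "((\<lambda>q. frechet_derivative c (at q) (w q)) has_derivative
    (\<lambda>\<xi>. frechet_derivative (\<lambda>q. frechet_derivative c (at q) \<xi>) (at p) (w p) + frechet_derivative c (at p) (w' \<xi>))) (at p)"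
proof -
  have dc: "c differentiable (at q)" for q
    using smooth_on_imp_differentiable[OF c] by auto
  have d2: "((\<lambda>q. frechet_derivative c (at q) b) has_derivative
      (\<lambda>\<xi>. frechet_derivative (\<lambda>q. frechet_derivative c (at q) b) (at p) \<xi>)) (at p)" for b
    using smooth_on_has_derivative[OF smooth_on_frechet_derivative[OF c]] by auto
  have "((\<lambda>q. \<Sum>b\<in>Basis. (w q \<bullet> b) *\<^sub>R frechet_derivative c (at q) b) has_derivative
     (\<lambda>\<xi>. \<Sum>b\<in>Basis. (w p \<bullet> b) *\<^sub>R frechet_derivative (\<lambda>q. frechet_derivative c (at q) b) (at p) \<xi> +
         (w' \<xi> \<bullet> b) *\<^sub>R frechet_derivative c (at p) b)) (at p)"
    by (intro has_derivative_sum has_derivative_scaleR has_derivative_inner_left w d2)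
  moreover have "(\<Sum>b\<in>Basis. (w p \<bullet> b) *\<^sub>R frechet_derivative (\<lambda>q. frechet_derivative c (at q) b) (at p) \<xi> +
         (w' \<xi> \<bullet> b) *\<^sub>R frechet_derivative c (at p) b) =
      frechet_derivative (\<lambda>q. frechet_derivative c (at q) \<xi>) (at p) (w p) + frechet_derivative c (at p) (w' \<xi>)" for \<xi>
    unfolding symmetric_second_derivative[OF c, of _ p \<xi>] sum.distrib
    by (subst frechet_derivative_euclidean_sum[OF smooth_on_imp_differentiable[OF smooth_on_frechet_derivative[OF c]], of p \<xi> "w p"],
        simp, subst frechet_derivative_euclidean_sum[OF dc, of p "w' \<xi>"], simp)
  ultimately show ?thesis
    by (simp add: frechet_derivative_euclidean_sum[OF dc, symmetric])
qed

text \<open>In the Jacobi expression brackets are differentiated only along the anchor. Restricting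
  to such directions removes the derivative of \<open>OH_Phi\<close> in the base point, and with it
  every octonion product.\<close>

lemma OH_bracket_derivative:
  fixes p :: "oct \<times> oct"
  assumes "smooth_on UNIV b" "smooth_on UNIV c"
  defines "D \<equiv> \<lambda>f. frechet_derivative f (at p)"
  defines "H \<equiv> \<lambda>f \<xi> \<eta>. frechet_derivative (\<lambda>q. frechet_derivative f (at q) \<xi>) (at p) \<eta>"
  defines "\<rho> \<equiv> OH_anchor p"
  shows "D (OH_bracket b c) (\<rho> v) =
     (\<rho> v \<bullet> b p + p \<bullet> D b (\<rho> v)) *\<^sub>R c p + (p \<bullet> b p) *\<^sub>R D c (\<rho> v)
     - ((\<rho> v \<bullet> c p + p \<bullet> D c (\<rho> v)) *\<^sub>R b p + (p \<bullet> c p) *\<^sub>R D b (\<rho> v))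
     + (H c (\<rho> v) (\<rho> (b p)) + D c (\<rho> (D b (\<rho> v)) - (\<rho> v \<bullet> b p) *\<^sub>R p - (p \<bullet> b p) *\<^sub>R \<rho> v))
     - (H b (\<rho> v) (\<rho> (c p)) + D b (\<rho> (D c (\<rho> v)) - (\<rho> v \<bullet> c p) *\<^sub>R p - (p \<bullet> c p) *\<^sub>R \<rho> v))"
proof -
  have D: "(f has_derivative D f) (at p)" if "smooth_on UNIV f" for f :: "oct \<times> oct \<Rightarrow> oct \<times> oct"
    unfolding D_def using smooth_on_has_derivative[OF that] by auto
  have an: "((\<lambda>q. OH_anchor q (f q)) has_derivative frechet_derivative (\<lambda>q. OH_anchor q (f q)) (at p)) (at p)"
    if "smooth_on UNIV f" for f
    by (rule smooth_on_has_derivative[OF smooth_on_OH_anchor[OF open_UNIV smooth_on_ident that]]) simp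
  have "((\<lambda>q. OH_bracket b c q) has_derivative (\<lambda>\<xi>.
      ((p \<bullet> b p) *\<^sub>R D c \<xi> + (p \<bullet> D b \<xi> + \<xi> \<bullet> b p) *\<^sub>R c p
      - ((p \<bullet> c p) *\<^sub>R D b \<xi> + (p \<bullet> D c \<xi> + \<xi> \<bullet> c p) *\<^sub>R b p)
      + (H c \<xi> (OH_anchor p (b p)) + D c (frechet_derivative (\<lambda>q. OH_anchor q (b q)) (at p) \<xi>))
      - (H b \<xi> (OH_anchor p (c p)) + D b (frechet_derivative (\<lambda>q. OH_anchor q (c q)) (at p) \<xi>))))) (at p)"
    unfolding OH_bracket_def OH_const_bracket_def H_def D_def
    by (intro has_derivative_add has_derivative_diff has_derivative_scaleR has_derivative_inner
        has_derivative_ident D[OF assms(1), unfolded D_def] D[OF assms(2), unfolded D_def]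
        frechet_derivative_frechet_apply[OF assms(1) an[OF assms(2)]]
        frechet_derivative_frechet_apply[OF assms(2) an[OF assms(1)]])
  then have E: "frechet_derivative (OH_bracket b c) (at p) = (\<lambda>\<xi>.
      ((p \<bullet> b p) *\<^sub>R D c \<xi> + (p \<bullet> D b \<xi> + \<xi> \<bullet> b p) *\<^sub>R c p
      - ((p \<bullet> c p) *\<^sub>R D b \<xi> + (p \<bullet> D c \<xi> + \<xi> \<bullet> c p) *\<^sub>R b p)
      + (H c \<xi> (OH_anchor p (b p)) + D c (frechet_derivative (\<lambda>q. OH_anchor q (b q)) (at p) \<xi>))
      - (H b \<xi> (OH_anchor p (c p)) + D b (frechet_derivative (\<lambda>q. OH_anchor q (c q)) (at p) \<xi>))))"
    by (rule frechet_derivative_eqI)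
  have E': "D (OH_bracket b c) = frechet_derivative (OH_bracket b c) (at p)"
    by (simp only: D_def)
  show ?thesis
    unfolding E' E \<rho>_def
      OH_anchor_derivative_along_leaf[OF D[OF assms(1)]] OH_anchor_derivative_along_leaf[OF D[OF assms(2)]]
    by (simp add: add.commute)
qed

text \<open>After \<open>OH_bracket_derivative\<close> the claim is an identity in the values, first
  derivatives and second derivatives of the three sections at \<open>p\<close>, with the anchor an
  opaque linear map. Second derivatives cancel by their symmetry, and inner products with anchors
  cancel because the anchor is self-adjoint.\<close>

lemma OH_bracket_jacobi:
  assumes a: "smooth_on UNIV a" and b: "smooth_on UNIV b" and c: "smooth_on UNIV c"
  shows "OH_bracket a (OH_bracket b c) p + OH_bracket b (OH_bracket c a) p + OH_bracket c (OH_bracket a b) p = 0"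
proof -
  define D where "D = (\<lambda>f :: oct \<times> oct \<Rightarrow> oct \<times> oct. frechet_derivative f (at p))"
  define H where "H = (\<lambda>(f :: oct \<times> oct \<Rightarrow> oct \<times> oct) \<xi> \<eta>. frechet_derivative (\<lambda>q. frechet_derivative f (at q) \<xi>) (at p) \<eta>)"
  define \<rho> where "\<rho> = OH_anchor p"
  have lin: "linear (D f)" if "smooth_on UNIV f" for f
    unfolding D_def by (rule linear_frechet_derivative[OF smooth_on_imp_differentiable[OF that UNIV_I]])
  note l = linear_add[OF lin] linear_diff[OF lin] linear_scale[OF lin]
  have Hs: "H f \<xi> \<eta> = H f \<eta> \<xi>" if "smooth_on UNIV f" for f \<xi> \<eta>
    unfolding H_def by (rule symmetric_second_derivative[OF that])
  have s: "\<rho> v \<bullet> w = \<rho> w \<bullet> v" for v w unfolding \<rho>_def by (rule OH_anchor_sym)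
  have br: "OH_bracket f g p = (p \<bullet> f p) *\<^sub>R g p - (p \<bullet> g p) *\<^sub>R f p + D g (\<rho> (f p)) - D f (\<rho> (g p))" for f g
    by (simp add: OH_bracket_def OH_const_bracket_def D_def \<rho>_def)
  have dbr: "D (OH_bracket b c) (\<rho> v) =
     (\<rho> v \<bullet> b p + p \<bullet> D b (\<rho> v)) *\<^sub>R c p + (p \<bullet> b p) *\<^sub>R D c (\<rho> v)
     - ((\<rho> v \<bullet> c p + p \<bullet> D c (\<rho> v)) *\<^sub>R b p + (p \<bullet> c p) *\<^sub>R D b (\<rho> v))
     + (H c (\<rho> v) (\<rho> (b p)) + D c (\<rho> (D b (\<rho> v)) - (\<rho> v \<bullet> b p) *\<^sub>R p - (p \<bullet> b p) *\<^sub>R \<rho> v))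
     - (H b (\<rho> v) (\<rho> (c p)) + D b (\<rho> (D c (\<rho> v)) - (\<rho> v \<bullet> c p) *\<^sub>R p - (p \<bullet> c p) *\<^sub>R \<rho> v))"
    if "smooth_on UNIV b" "smooth_on UNIV c" for b c v
    unfolding D_def H_def \<rho>_def by (rule OH_bracket_derivative[OF that])
  have jac: "OH_bracket f (OH_bracket g h) p = (p \<bullet> f p) *\<^sub>R OH_bracket g h p - (p \<bullet> OH_bracket g h p) *\<^sub>R f p
     + D (OH_bracket g h) (\<rho> (f p)) - D f (\<rho> (OH_bracket g h p))" for f g h
    by (rule br)
  show ?thesis
    unfolding jac dbr[OF a b] dbr[OF b c] dbr[OF c a] br
    using Hs[OF a, of "\<rho> (b p)" "\<rho> (c p)"] Hs[OF b, of "\<rho> (a p)" "\<rho> (c p)"] Hs[OF c, of "\<rho> (a p)" "\<rho> (b p)"]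
      s[of "b p" "a p"] s[of "c p" "a p"] s[of "c p" "b p"]
    by (simp add: l[OF a] l[OF b] l[OF c] OH_anchor_linear_simps[of p, folded \<rho>_def] inner_add_right
       inner_diff_right algebra_simps)
qed

lemma OH_lie_algebroid: "lie_algebroid OH_algebroid"
proof -
  have sel: "vb_rank OH_algebroid = 16" "vb_fibre OH_algebroid = (\<lambda>_. UNIV)"
    "vb_frames OH_algebroid = {(UNIV, OH_frame)}" "la_anchor OH_algebroid = OH_anchor"
    "la_bracket OH_algebroid = OH_bracket"
    by (simp_all add: OH_algebroid_def)
  have const: "OH_frame i = (\<lambda>_. OH_frame i 0)" for i
    by (simp add: OH_frame_def fun_eq_iff)
  have fr: "smooth_on UNIV (\<lambda>x. OH_anchor x (OH_frame i x))" for i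
    by (rule smooth_on_OH_anchor[OF open_UNIV smooth_on_ident]) (subst const, rule smooth_on_const)
  have D: "(f has_derivative frechet_derivative f (at p)) (at p)" 
    if "smooth_on UNIV f" for f :: "oct \<times> oct \<Rightarrow> 'b::real_normed_vector" and p
    using smooth_on_has_derivative[OF that] by auto
  have lin: "linear (frechet_derivative f (at p))" if "smooth_on UNIV f" for f :: "oct \<times> oct \<Rightarrow> oct \<times> oct" and p
    by (rule linear_frechet_derivative[OF smooth_on_imp_differentiable[OF that UNIV_I]])
  have add: "OH_bracket a (\<lambda>x. r *\<^sub>R b x + s *\<^sub>R c x) = (\<lambda>x. r *\<^sub>R OH_bracket a b x + s *\<^sub>R OH_bracket a c x)"
    if "smooth_on UNIV a" "smooth_on UNIV b" "smooth_on UNIV c" for a b c and r s :: real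
  proof
    fix p
    have "((\<lambda>x. r *\<^sub>R b x + s *\<^sub>R c x) has_derivative
        (\<lambda>v. r *\<^sub>R frechet_derivative b (at p) v + s *\<^sub>R frechet_derivative c (at p) v)) (at p)"
      by (intro has_derivative_add has_derivative_scaleR_right D that)
    from frechet_derivative_eqI[OF this]
    show "OH_bracket a (\<lambda>x. r *\<^sub>R b x + s *\<^sub>R c x) p = r *\<^sub>R OH_bracket a b p + s *\<^sub>R OH_bracket a c p"
      by (simp add: OH_bracket_def OH_const_bracket_def OH_anchor_linear_simps inner_add_right
         linear_add[OF lin[OF that(1)]] linear_scale[OF lin[OF that(1)]] algebra_simps)
  qed
  have leib: "OH_bracket a (\<lambda>x. f x *\<^sub>R b x) = (\<lambda>x. f x *\<^sub>R OH_bracket a b x +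
      frechet_derivative f (at x) (OH_anchor x (a x)) *\<^sub>R b x)"
    if "smooth_on UNIV f" "smooth_on UNIV a" "smooth_on UNIV b" for f :: "oct \<times> oct \<Rightarrow> real" and a b
  proof
    fix p
    have "((\<lambda>x. f x *\<^sub>R b x) has_derivative
        (\<lambda>v. f p *\<^sub>R frechet_derivative b (at p) v + frechet_derivative f (at p) v *\<^sub>R b p)) (at p)"
      by (intro has_derivative_scaleR D that)
    from frechet_derivative_eqI[OF this]
    show "OH_bracket a (\<lambda>x. f x *\<^sub>R b x) p = f p *\<^sub>R OH_bracket a b p +
        frechet_derivative f (at p) (OH_anchor p (a p)) *\<^sub>R b p"
      by (simp add: OH_bracket_def OH_const_bracket_def OH_anchor_linear_simps
         linear_scale[OF lin[OF that(2)]] algebra_simps)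
  qed
  have anti: "OH_bracket a b = (\<lambda>x. - OH_bracket b a x)" for a b
    by (simp add: fun_eq_iff OH_bracket_def OH_const_bracket_def)
  show ?thesis
    unfolding lie_algebroid_def OH_section_iff sel
    apply (intro conjI)
    subgoal by (rule OH_vector_bundle)
    subgoal by (simp add: OH_anchor_linear_simps)
    subgoal using fr by simp
    subgoal by (intro allI impI smooth_on_OH_bracket) (simp_all only:)
    subgoal by (intro allI impI, rule add) (simp_all only:)
    subgoal by (intro allI impI, rule anti)
    subgoal by (intro allI impI OH_bracket_jacobi) (simp_all only:)
    subgoal by (intro allI impI, rule leib) (simp_all only:)
    done
qed

section \<open>The Lie groupoid\<close>

abbreviation OH_arrows :: "OH_arrow set" where
  "OH_arrows \<equiv> {g. OH_lambda g \<noteq> 0}"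

lemma OH_lambda_eq': "OH_lambda g = sqrt (OH_L (fst g) (snd g))"
  by (metis OH_lambda_eq prod.collapse)

lemma smooth_on_OH_L:
  fixes f p :: "'a::euclidean_space \<Rightarrow> oct \<times> oct"
  assumes "open S" "smooth_on S f" "smooth_on S p"
  shows "smooth_on S (\<lambda>x. OH_L (f x) (p x))"
  unfolding OH_L_def
  by (intro smooth_on_add smooth_on_mult smooth_on_inner smooth_on_OH_Phi smooth_on_const assms)

lemma open_OH_arrows: "open OH_arrows"
proof -
  have "continuous_on UNIV (\<lambda>g. OH_L (fst g) (snd g))"
    by (rule smooth_on_imp_continuous_on, rule smooth_on_OH_L)
      (intro open_UNIV smooth_on_fst smooth_on_snd smooth_on_ident)+
  then show ?thesis
    unfolding OH_lambda_eq' by (intro open_Collect_neq continuous_intros)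
qed

lemma smooth_on_OH_lambda: "smooth_on OH_arrows OH_lambda"
proof -
  have "smooth_on OH_arrows (\<lambda>g. sqrt (OH_L (fst g) (snd g)))"
  proof (rule smooth_on_sqrt[OF open_OH_arrows])
    show "smooth_on OH_arrows (\<lambda>g. OH_L (fst g) (snd g))"
      by (rule smooth_on_OH_L) (intro open_OH_arrows smooth_on_fst smooth_on_snd smooth_on_ident)+
    show "0 < OH_L (fst g) (snd g)" if "g \<in> OH_arrows" for g
      using that OH_L_nonneg[of "fst g" "snd g"] by (auto simp: OH_lambda_eq' less_le)
  qed
  then show ?thesis
    unfolding OH_lambda_eq'[symmetric] .
qed

lemma OH_target_eq': "OH_target g = inverse (OH_lambda g) *\<^sub>R (snd g + OH_Phi (snd g) (fst g))"
  by (metis OH_target_eq prod.collapse)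

lemma smooth_on_OH_target: "smooth_on OH_arrows OH_target"
proof -
  have "smooth_on OH_arrows (\<lambda>g. inverse (OH_lambda g) *\<^sub>R (snd g + OH_Phi (snd g) (fst g)))"
    by (intro smooth_on_scaleR smooth_on_inverse smooth_on_OH_lambda smooth_on_add smooth_on_OH_Phi
        open_OH_arrows smooth_on_fst smooth_on_snd smooth_on_ident) simp
  then show ?thesis
    unfolding OH_target_eq'[symmetric] .
qed

lemma smooth_on_OH_inv: "smooth_on OH_arrows OH_inv"
proof -
  have "smooth_on OH_arrows (\<lambda>g. (- (inverse (OH_lambda g)) *\<^sub>R fst g, OH_target g))"
    by (intro smooth_on_Pair smooth_on_scaleR smooth_on_minus smooth_on_inverse smooth_on_OH_lambda 
        smooth_on_OH_target open_OH_arrows smooth_on_fst smooth_on_ident) simp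
  then show ?thesis
    unfolding OH_inv_def[abs_def] by (simp add: inverse_eq_divide)
qed

lemma OH_inv_props:
  assumes "g \<in> OH_arrows"
  shows "OH_inv g \<in> OH_arrows" "OH_target (OH_inv g) = snd g" "OH_inv (OH_inv g) = g"
    "OH_lambda (OH_inv g) = 1 / OH_lambda g"
proof -
  obtain f p where g: "g = (f, p)" by (cases g)
  show 1: "OH_lambda (OH_inv g) = 1 / OH_lambda g"
    using OH_inverse(1)[of f p] assms by (simp add: g OH_inv_def del: OH_lambda.simps OH_target.simps)
  show "OH_inv g \<in> OH_arrows"
    using 1 assms by auto
  show 2: "OH_target (OH_inv g) = snd g"
    using OH_inverse(2)[of f p] assms by (simp add: g OH_inv_def del: OH_lambda.simps OH_target.simps)
  show "OH_inv (OH_inv g) = g"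
    unfolding OH_inv_def[of "OH_inv g"] 1 2 using assms by (simp add: OH_inv_def g del: OH_lambda.simps OH_target.simps)
qed

lemma OH_mult_props:
  assumes "h \<in> OH_arrows" "g \<in> OH_arrows" "snd h = OH_target g"
  shows "OH_mult h g \<in> OH_arrows" "OH_target (OH_mult h g) = OH_target h" 
    "OH_lambda (OH_mult h g) = OH_lambda g * OH_lambda h"
proof -
  obtain f p where g: "g = (f, p)" by (cases g)
  have h: "h = (fst h, OH_target g)" using assms(3) by (simp add: prod_eq_iff)
  have m: "OH_mult h g = (f + OH_lambda (f, p) *\<^sub>R fst h, p)"
    by (simp add: OH_mult_def g del: OH_lambda.simps)
  show l: "OH_lambda (OH_mult h g) = OH_lambda g * OH_lambda h"
    unfolding m using assms OH_lambda_mult[of f p "fst h"] h by (simp add: g del: OH_lambda.simps OH_target.simps)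
  show "OH_mult h g \<in> OH_arrows" using l assms by auto
  show "OH_target (OH_mult h g) = OH_target h"
    unfolding m using assms OH_target_mult[of f p "fst h"] h by (simp add: g del: OH_lambda.simps OH_target.simps)
qed

lemma chart_diff_id:
  assumes "open S" "p \<in> S"
  shows "chart_diff (S, id) f p = frechet_derivative f (at p)"
proof -
  have "inv_into S id q = q" if "q \<in> S" for q
    using inv_into_f_f[of id S q] that by simp
  then have "frechet_derivative (f \<circ> inv_into S id) (at p) = frechet_derivative f (at p)"
    using frechet_derivative_cong_open[OF assms, of "f \<circ> inv_into S id" f] by (metis o_apply)
  then show ?thesis
    by (simp add: chart_diff_def)
qed

text \<open>The target composed with inversion is the source, a linear projection onto the base. The
  chain rule at the inverse arrow therefore exhibits a right inverse of the derivative.\<close>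

lemma surj_OH_target_derivative:
  assumes "g \<in> OH_arrows"
  shows "surj (frechet_derivative OH_target (at g))"
proof -
  define h where "h = OH_inv g"
  have h: "h \<in> OH_arrows" "OH_inv h = g" using OH_inv_props[OF assms] by (simp_all add: h_def)
  have d: "(OH_inv has_derivative frechet_derivative OH_inv (at h)) (at h)"
    by (rule smooth_on_has_derivative[OF smooth_on_OH_inv h(1)])
  have t: "(OH_target has_derivative frechet_derivative OH_target (at g)) (at (OH_inv h))"
    unfolding h by (rule smooth_on_has_derivative[OF smooth_on_OH_target assms])
  have "((\<lambda>k. OH_target (OH_inv k)) has_derivative
      (\<lambda>v. frechet_derivative OH_target (at g) (frechet_derivative OH_inv (at h) v))) (at h)"
    by (rule has_derivative_compose[OF d t])
  then have "(snd has_derivative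
      (\<lambda>v. frechet_derivative OH_target (at g) (frechet_derivative OH_inv (at h) v))) (at h)"
    by (rule has_derivative_transform_within_open[OF _ open_OH_arrows h(1)]) (rule OH_inv_props(2))
  moreover have "(snd has_derivative snd) (at h)"
    by (rule bounded_linear_imp_has_derivative[OF bounded_linear_snd])
  ultimately have "frechet_derivative OH_target (at g) (frechet_derivative OH_inv (at h) v) = snd v" for v
    using has_derivative_unique by metis
  then show ?thesis
    by (intro surjI[where f = "\<lambda>x. frechet_derivative OH_inv (at h) (0, x)"]) (simp only: snd_conv)
qed

lemma smooth_map_id_charts:
  assumes "open S" "smooth_on S f" "D \<subseteq> S" "f ` D \<subseteq> T"
  shows "smooth_map {(S, id)} D {(T, id)} f"
  unfolding smooth_map_def using assms
  by (auto intro!: exI[of _ S] exI[of _ f])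

lemma smooth_atlas_id:
  assumes "open S"
  shows "smooth_atlas (top_of_set S) {(S, id)}"
proof -
  have "inv_into S id q = q" if "q \<in> S" for q
    using inv_into_f_f[of id S q] that by simp
  then have "smooth_on S (id \<circ> inv_into S id)"
    by (intro smooth_on_cong[OF smooth_on_ident assms]) auto
  moreover have "homeomorphic_map (top_of_set S) (top_of_set S) id"
    by simp
  ultimately show ?thesis
    using assms by (simp add: smooth_atlas_def subtopology_subtopology)
qed

lemma OH_lie_groupoid: "lie_groupoid OH_groupoid"
proof -
  have sel: "gp_top OH_groupoid = top_of_set OH_arrows" "gp_charts OH_groupoid = {(OH_arrows, id)}"
    "gp_source OH_groupoid = snd" "gp_target OH_groupoid = OH_target" "gp_unit OH_groupoid = (\<lambda>p. (0, p))"
    "gp_mult OH_groupoid = OH_mult" "gp_inv OH_groupoid = OH_inv"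
    by (simp_all add: OH_groupoid_def)
  have comp: "gp_composable OH_groupoid = {(h, g). h \<in> OH_arrows \<and> g \<in> OH_arrows \<and> snd h = OH_target g}"
    by (simp add: gp_composable_def sel)
  have unit: "(0, p) \<in> OH_arrows" for p
    by (simp del: OH_lambda.simps)
  have ax: "OH_mult g (0, snd g) = g" "OH_mult (0, OH_target g) g = g" for g
    by (simp_all add: OH_mult_def zero_prod_def[symmetric] del: OH_lambda.simps)
  have inv: "OH_mult (OH_inv g) g = (0, snd g)" "OH_mult g (OH_inv g) = (0, OH_target g)" if "g \<in> OH_arrows" for g
    using that OH_inv_props(4)[OF that]
    by (simp_all add: OH_mult_def OH_inv_def[of g] del: OH_lambda.simps OH_target.simps)
  have assoc: "OH_mult k (OH_mult h g) = OH_mult (OH_mult k h) g"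
    if "h \<in> OH_arrows" "g \<in> OH_arrows" "snd h = OH_target g" for k h g
    using OH_mult_props(3)[OF that] by (simp add: OH_mult_def algebra_simps del: OH_lambda.simps)
  \<comment> \<open>The formula makes sense for all pairs of arrows; this supplies the smooth
    extension beyond the composable pairs that \<open>smooth_map\<close> asks for.\<close>
  have m: "smooth_on (OH_arrows \<times> OH_arrows) (\<lambda>(h, g). OH_mult h g)"
  proof -
    have o: "open (OH_arrows \<times> OH_arrows)" by (intro open_Times open_OH_arrows)
    have "smooth_on (OH_arrows \<times> OH_arrows) (\<lambda>q. OH_lambda (snd q))"
      by (rule smooth_on_compose[OF smooth_on_OH_lambda _ o open_OH_arrows])
        (intro smooth_on_snd o smooth_on_ident, auto)
    then have "smooth_on (OH_arrows \<times> OH_arrows)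
        (\<lambda>q. (fst (snd q) + OH_lambda (snd q) *\<^sub>R fst (fst q), snd (snd q)))"
      by (intro smooth_on_Pair smooth_on_add smooth_on_scaleR smooth_on_fst smooth_on_snd o smooth_on_ident)
    then show ?thesis by (simp add: OH_mult_def[abs_def] case_prod_beta')
  qed
  have pr: "prod_atlas {(OH_arrows, id)} {(OH_arrows, id)} = {(OH_arrows \<times> OH_arrows, id)}"
    by (simp add: prod_atlas_def prod.map_id0)
  have ds: "frechet_derivative snd (at g) = snd" for g :: OH_arrow
    by (rule frechet_derivative_eqI[OF bounded_linear_imp_has_derivative[OF bounded_linear_snd]])
  show ?thesis
    unfolding lie_groupoid_def comp unfolding sel pr euclidean_atlas_def topspace_euclidean_subtopology
    apply (intro conjI)
    subgoal using unit by (simp del: OH_lambda.simps OH_target.simps)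
    subgoal using OH_mult_props by (auto simp: OH_mult_def simp del: OH_lambda.simps OH_target.simps)
    subgoal using assoc by blast
    subgoal using ax by simp
    subgoal using OH_inv_props inv by (simp add: OH_inv_def del: OH_lambda.simps OH_target.simps)
    subgoal by (rule smooth_atlas_id[OF open_OH_arrows])
    subgoal by (rule smooth_map_id_charts[OF open_OH_arrows smooth_on_bounded_linear[OF bounded_linear_snd]]) auto
    subgoal by (rule smooth_map_id_charts[OF open_OH_arrows smooth_on_OH_target]) auto
    subgoal using surj_OH_target_derivative ds range_snd
      by (simp add: chart_diff_id[OF open_OH_arrows] del: OH_lambda.simps split_paired_All)
    subgoal by (rule smooth_map_id_charts[OF open_UNIV smooth_on_Pair[OF open_UNIV smooth_on_const smooth_on_ident]])
        (use unit in auto)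
    subgoal by (rule smooth_map_id_charts[OF open_OH_arrows smooth_on_OH_inv]) (use OH_inv_props(1) in auto)
    subgoal by (rule smooth_map_id_charts[OF open_Times[OF open_OH_arrows open_OH_arrows] m])
        (use OH_mult_props(1) in auto)
    done
qed

text \<open>Along the curve \<open>(s *\<^sub>R f, p)\<close> the numerator contributes
  \<open>OH_Phi p f\<close>, and the factor \<open>1 / OH_lambda\<close> contributes the radial term
  \<open>- (p \<bullet> f) *\<^sub>R p\<close> of the anchor.\<close>

lemma OH_target_derivative_unit:
  "frechet_derivative OH_target (at (0, p)) (f, 0) = OH_anchor p f"
proof -
  have u: "(0, p) \<in> OH_arrows" by (simp del: OH_lambda.simps)
  have "(OH_target has_derivative frechet_derivative OH_target (at (0, p))) (at (0 *\<^sub>R f, p))"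
    using smooth_on_has_derivative[OF smooth_on_OH_target u] by simp
  moreover have "((\<lambda>s::real. (s *\<^sub>R f, p)) has_derivative (\<lambda>s. (s *\<^sub>R f, 0))) (at 0)"
    by (auto intro!: derivative_eq_intros)
  ultimately have "((\<lambda>s. OH_target (s *\<^sub>R f, p)) has_derivative
      (\<lambda>s. frechet_derivative OH_target (at (0, p)) (s *\<^sub>R f, 0))) (at 0)"
    by (intro has_derivative_compose[where f = "\<lambda>s::real. (s *\<^sub>R f, p)" and g = OH_target])
  moreover have "((\<lambda>s. OH_target (s *\<^sub>R f, p)) has_derivative (\<lambda>s. s *\<^sub>R OH_anchor p f)) (at 0)"
  proof -
    have e: "OH_target (s *\<^sub>R f, p) =
        inverse (sqrt (1 + 2 * (s * (p \<bullet> f)) + s * (s * (f \<bullet> OH_Phi p f)))) *\<^sub>R (p + s *\<^sub>R OH_Phi p f)" for s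
      by (simp add: OH_target_eq OH_lambda_eq OH_L_def OH_Phi_linear_simps)
    show ?thesis
      unfolding e
      by (auto intro!: derivative_eq_intros simp: OH_anchor_eq algebra_simps)
  qed
  ultimately have "(\<lambda>s::real. frechet_derivative OH_target (at (0, p)) (s *\<^sub>R f, 0)) = (\<lambda>s. s *\<^sub>R OH_anchor p f)"
    by (rule has_derivative_unique)
  from fun_cong[OF this, of 1] show ?thesis by simp
qed

lemma OH_groupoid_foliation: "groupoid_foliation OH_groupoid = OH_foliation"
proof -
  let ?\<kappa> = "(OH_arrows, id) :: OH_arrow set \<times> (OH_arrow \<Rightarrow> OH_arrow)"
  have sel: "gp_charts OH_groupoid = {?\<kappa>}"
    "gp_source OH_groupoid = snd" "gp_target OH_groupoid = OH_target" "gp_unit OH_groupoid = (\<lambda>p. (0, p))"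
    by (simp_all add: OH_groupoid_def)
  have unit: "(0, p) \<in> OH_arrows" for p
    by (simp del: OH_lambda.simps)
  have ds: "frechet_derivative snd (at g) = snd" for g :: OH_arrow
    by (rule frechet_derivative_eqI[OF bounded_linear_imp_has_derivative[OF bounded_linear_snd]])
  have sec: "groupoid_section OH_groupoid a \<longleftrightarrow> smooth_on UNIV (a ?\<kappa>) \<and> (\<forall>x. snd (a ?\<kappa> x) = 0)" for a
    unfolding groupoid_section_def sel using unit
    by (simp add: chart_diff_id[OF open_OH_arrows] ds del: OH_lambda.simps OH_target.simps)
  have gen: "{X. \<exists>a. groupoid_section OH_groupoid a \<and>
      (\<forall>\<kappa>\<in>gp_charts OH_groupoid. \<forall>x. gp_unit OH_groupoid x \<in> fst \<kappa> \<longrightarrow>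
        X x = chart_diff \<kappa> (gp_target OH_groupoid) (gp_unit OH_groupoid x) (a \<kappa> x))} =
     {(\<lambda>x. OH_anchor x (w x)) | w. smooth_on UNIV w}" (is "?A = ?B")
  proof (intro equalityI subsetI)
    fix X assume "X \<in> ?A"
    then obtain a where a: "smooth_on UNIV (a ?\<kappa>)" "\<And>x. snd (a ?\<kappa> x) = 0"
      "\<And>x. X x = frechet_derivative OH_target (at (0, x)) (a ?\<kappa> x)"
      unfolding sec using unit
      by (auto simp: sel chart_diff_id[OF open_OH_arrows] simp del: OH_lambda.simps OH_target.simps)
    have "X x = OH_anchor x (fst (a ?\<kappa> x))" for x
      using a(2)[of x] unfolding a(3) OH_target_derivative_unit[symmetric] by (metis prod.collapse)
    then show "X \<in> ?B"
      using smooth_on_fst[OF open_UNIV a(1)] by (auto simp: fun_eq_iff)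
  next
    fix X assume "X \<in> ?B"
    then obtain w where w: "smooth_on UNIV w" "X = (\<lambda>x. OH_anchor x (w x))" by blast
    have "smooth_on UNIV (\<lambda>x. (w x, 0 :: oct \<times> oct))"
      by (intro smooth_on_Pair w open_UNIV smooth_on_const)
    then show "X \<in> ?A"
      unfolding mem_Collect_eq sec w(2) OH_target_derivative_unit[symmetric] using unit
      by (intro exI[of _ "\<lambda>_ x. (w x, 0)"])
        (auto simp: sel chart_diff_id[OF open_OH_arrows] simp del: OH_lambda.simps OH_target.simps)
  qed
  have an: "la_anchor OH_algebroid = OH_anchor" by (simp add: OH_algebroid_def)
  show ?thesis
    unfolding groupoid_foliation_def OH_foliation_def algebroid_foliation_def gen OH_section_iff an ..
qed

lemma second_countable_euclidean: "second_countable (euclidean :: 'a::euclidean_space topology)"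
proof -
  obtain B :: "'a set set" where "countable B" "topological_basis B"
    using ex_countable_basis by blast
  moreover have "\<exists>V\<in>B. x \<in> V \<and> V \<subseteq> U" if "open U" "x \<in> U" for U and x :: 'a
    using topological_basisE[OF \<open>topological_basis B\<close> that] by metis
  moreover have "\<forall>V\<in>B. open V"
    using \<open>topological_basis B\<close> topological_basis_open by blast
  ultimately show ?thesis
    unfolding second_countable_def open_openin[symmetric] by blast
qed

lemma OH_groupoid_topology:
  "Hausdorff_space (gp_top OH_groupoid)" "second_countable (gp_top OH_groupoid)"
  by (simp_all add: OH_groupoid_def Hausdorff_space_subtopology second_countable_subtopology
      second_countable_euclidean)

lemma smooth_on_isCont:
  "smooth_on S f \<Longrightarrow> open S \<Longrightarrow> x \<in> S \<Longrightarrow> isCont f x"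
  using smooth_on_imp_continuous_on continuous_on_eq_continuous_at by blast

section \<open>Minimality\<close>

text \<open>At \<open>(e, 0)\<close> the anchor projects the first component orthogonally to
  \<open>e\<close> and kills the second one; at \<open>(0, e)\<close> the roles are exchanged.
  Summing eight such projections gives 8 - 1 = 7 times the identity. Hence a vector killed by the
  anchor at every base point is zero.\<close>

lemma sum_OH_anchor_Basis: "(\<Sum>b\<in>Basis. OH_anchor b v) = 7 *\<^sub>R v"
proof -
  obtain u w where v: "v = (u, w)" by (cases v)
  have one: "(\<Sum>e\<in>Basis. z - (e \<bullet> z) *\<^sub>R e) = 7 *\<^sub>R z" for z :: oct
  proof -
    have "(\<Sum>e\<in>Basis. z - (e \<bullet> z) *\<^sub>R e) = (\<Sum>e\<in>(Basis :: oct set). z) - (\<Sum>e\<in>Basis. (z \<bullet> e) *\<^sub>R e)"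
      by (simp add: sum_subtractf inner_commute)
    also have "(\<Sum>e\<in>(Basis :: oct set). z) = 8 *\<^sub>R z"
      unfolding sum_constant_scaleR by simp
    also have "8 *\<^sub>R z - (\<Sum>e\<in>Basis. (z \<bullet> e) *\<^sub>R e) = 7 *\<^sub>R z"
      by (simp add: euclidean_representation) (simp add: scaleR_left_diff_distrib[of 8 1 z, simplified, symmetric])
    finally show ?thesis .
  qed
  have c0: "oct_cnj 0 = 0" using bounded_linear.linear[OF bounded_linear_oct_cnj] by (rule linear_0)
  have l: "OH_anchor (e, 0) v = (u - (e \<bullet> u) *\<^sub>R e, 0)" if "e \<in> Basis" for e
    using that by (simp add: v c0 oct_mult_linear_simps)
  have r: "OH_anchor (0, e) v = (0, w - (e \<bullet> w) *\<^sub>R e)" if "e \<in> Basis" for e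
    using that by (simp add: v c0 oct_mult_linear_simps)
  have pr: "(\<Sum>i\<in>I. (f i, 0)) = (sum f I, 0)" "(\<Sum>i\<in>I. (0, f i)) = (0, sum f I)" for f :: "oct \<Rightarrow> oct" and I
    by (simp_all add: prod_eq_iff fst_sum snd_sum)
  have "(\<Sum>b\<in>Basis. OH_anchor b v) = (\<Sum>e\<in>Basis. OH_anchor (e, 0) v) + (\<Sum>e\<in>Basis. OH_anchor (0, e) v)"
    by (simp add: sum_Basis_prod_eq del: OH_anchor.simps)
  also have "(\<Sum>e\<in>Basis. OH_anchor (e, 0) v) = (\<Sum>e\<in>Basis. (u - (e \<bullet> u) *\<^sub>R e, 0))"
    by (rule sum.cong[OF refl l])
  also have "(\<Sum>e\<in>Basis. OH_anchor (0, e) v) = (\<Sum>e\<in>Basis. (0, w - (e \<bullet> w) *\<^sub>R e))"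
    by (rule sum.cong[OF refl r])
  also have "(\<Sum>e\<in>Basis. (u - (e \<bullet> u) *\<^sub>R e, 0)) + (\<Sum>e\<in>Basis. (0, w - (e \<bullet> w) *\<^sub>R e)) = 7 *\<^sub>R v"
    unfolding pr one by (simp add: v)
  finally show ?thesis .
qed

lemma OH_anchor_homogeneous: "OH_anchor (t *\<^sub>R p) v = (t * t) *\<^sub>R OH_anchor p v"
  by (simp add: OH_anchor_eq OH_Phi_eq oct_mult_linear_simps oct_cnj_linear_simps algebra_simps)

text \<open>The anchor is homogeneous quadratic in the base point and no nonzero constant section is
  in its kernel, so a relation between the generators has coefficients vanishing at the origin:
  this is why the fibre of the foliation at the origin has dimension 16.\<close>

lemma OH_anchor_kernel_at_0:
  assumes "isCont g 0" "open U" "0 \<in> U" "\<And>x. x \<in> U \<Longrightarrow> OH_anchor x (g x) = 0"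
  shows "g 0 = 0"
proof -
  have "OH_anchor b (g 0) = 0" for b
  proof -
    have t0: "((\<lambda>t::real. t *\<^sub>R b) \<longlongrightarrow> 0) (at 0)"
      by (auto intro!: tendsto_eq_intros)
    have "((\<lambda>t. g (t *\<^sub>R b)) \<longlongrightarrow> g 0) (at 0)"
      using assms(1) t0 by (rule isCont_tendsto_compose)
    then have "((\<lambda>t. OH_anchor b (g (t *\<^sub>R b))) \<longlongrightarrow> OH_anchor b (g 0)) (at 0)"
      by (rule bounded_linear.tendsto[OF linear_OH_anchor[unfolded linear_conv_bounded_linear]])
    moreover have "\<forall>\<^sub>F t in at 0. t *\<^sub>R b \<in> U"
      using topological_tendstoD[OF t0 assms(2,3)] .
    then have "\<forall>\<^sub>F t in at 0. OH_anchor b (g (t *\<^sub>R b)) = 0"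
      using eventually_neq_at_within[of "0::real" 0 UNIV]
    proof eventually_elim
      case (elim t)
      have "(t * t) *\<^sub>R OH_anchor b (g (t *\<^sub>R b)) = 0"
        using assms(4)[OF elim(1)] unfolding OH_anchor_homogeneous .
      then show ?case using elim(2) by (simp del: OH_anchor.simps)
    qed
    then have "((\<lambda>t. OH_anchor b (g (t *\<^sub>R b))) \<longlongrightarrow> 0) (at 0)"
      by (rule tendsto_eventually)
    ultimately show ?thesis
      by (rule tendsto_unique[OF trivial_limit_at])
  qed
  then have "7 *\<^sub>R g 0 = 0"
    using sum_OH_anchor_Basis[of "g 0"] by (simp del: OH_anchor.simps)
  then show ?thesis by simp
qed

lemma OH_foliation_eq: "OH_foliation = Cc_span {(\<lambda>x. OH_anchor x (w x)) | w. smooth_on UNIV w}"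
  unfolding OH_foliation_def algebroid_foliation_def OH_section_iff by (simp add: OH_algebroid_def)

text \<open>Linearity of the anchor on fibres collapses the finite combination into the anchor of a
  single section.\<close>

lemma OH_foliation_section:
  assumes "X \<in> OH_foliation"
  obtains w where "smooth_on UNIV w" "X = (\<lambda>x. OH_anchor x (w x))"
proof -
  obtain n f Y where Y: "\<forall>i<n. smooth_compact_support (f i) \<and> (\<exists>w. Y i = (\<lambda>x. OH_anchor x (w x)) \<and> smooth_on UNIV w)"
    and X: "X = (\<lambda>x. \<Sum>i<n::nat. f i x *\<^sub>R Y i x)"
    using assms unfolding OH_foliation_eq Cc_span_def by blast
  then obtain w where w: "\<forall>i<n. Y i = (\<lambda>x. OH_anchor x (w i x)) \<and> smooth_on UNIV (w i)"
    by metis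
  show ?thesis
  proof
    show "smooth_on UNIV (\<lambda>x. \<Sum>i<n. f i x *\<^sub>R w i x)"
      using Y w by (intro smooth_on_sum smooth_on_scaleR) (auto simp: smooth_compact_support_def)
    have "(\<Sum>i<n. f i x *\<^sub>R Y i x) = OH_anchor x (\<Sum>i<n. f i x *\<^sub>R w i x)" for x
      by (simp add: linear_sum[OF linear_OH_anchor] OH_anchor_linear_simps w)
    then show "X = (\<lambda>x. OH_anchor x (\<Sum>i<n. f i x *\<^sub>R w i x))"
      by (simp add: X fun_eq_iff del: OH_anchor.simps)
  qed
qed

lemma Cc_span_scale:
  assumes "smooth_compact_support h" "Y \<in> S"
  shows "(\<lambda>x. h x *\<^sub>R Y x) \<in> Cc_span S"
  unfolding Cc_span_def using assms
  by (auto intro!: exI[of _ "1::nat"] exI[of _ "\<lambda>_. h"] exI[of _ "\<lambda>_. Y"])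

lemma OH_foliation_scale_anchor:
  assumes "smooth_compact_support h"
  shows "(\<lambda>x. h x *\<^sub>R OH_anchor x v) \<in> OH_foliation"
  unfolding OH_foliation_eq
  by (rule Cc_span_scale[OF assms]) (auto intro!: exI[of _ "\<lambda>_. v"])

text \<open>\<open>R i\<close> represents \<open>B i\<close> in the fibre of the foliation at the
  origin, identified with the space of constant sections. The \<open>B i\<close> themselves need not
  lie in the foliation, only multiples \<open>h x *\<^sub>R B i x\<close> with \<open>h 0\<close>
  nonzero; such a multiple is the anchor of some section \<open>w\<close>, and \<open>R i\<close> is
  \<open>w 0\<close> divided by \<open>h 0\<close>.\<close>

lemma OH_foliation_frame_coefficients:
  assumes I: "finite I"
    and B: "\<And>i. i \<in> I \<Longrightarrow> \<exists>h :: oct \<times> oct \<Rightarrow> real. isCont h 0 \<and> h 0 \<noteq> 0 \<and> (\<lambda>x. h x *\<^sub>R B i x) \<in> OH_foliation"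
  obtains R where "\<And>h v f U. isCont h 0 \<Longrightarrow> open U \<Longrightarrow> 0 \<in> U \<Longrightarrow> (\<And>i. i \<in> I \<Longrightarrow> isCont (f i) 0) \<Longrightarrow>
      (\<And>x. x \<in> U \<Longrightarrow> h x *\<^sub>R OH_anchor x v = (\<Sum>i\<in>I. f i x *\<^sub>R B i x)) \<Longrightarrow>
      h 0 *\<^sub>R v = (\<Sum>i\<in>I. f i 0 *\<^sub>R R i)"
proof -
  \<comment> \<open>The witnesses for one index are packed into a triple so that a single choice
    provides them for all indices.\<close>
  define P where "P = (\<lambda>i (h, w, V). isCont h 0 \<and> isCont w 0 \<and> open V \<and> 0 \<in> V \<and>
      (\<forall>x\<in>V. h x \<in> - {0 :: real}) \<and> (\<forall>x. h x *\<^sub>R B i x = OH_anchor x (w x)))"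
  have "\<exists>t. P i t" if i: "i \<in> I" for i
  proof -
    obtain h where h: "isCont h 0" "h 0 \<noteq> (0::real)" "(\<lambda>x. h x *\<^sub>R B i x) \<in> OH_foliation"
      using B[OF i] by blast
    obtain w where w: "smooth_on UNIV w" "(\<lambda>x. h x *\<^sub>R B i x) = (\<lambda>x. OH_anchor x (w x))"
      using OH_foliation_section[OF h(3)] .
    have "isCont w 0"
      by (rule smooth_on_isCont[OF w(1) open_UNIV UNIV_I])
    moreover obtain V where "open V" "0 \<in> V" "\<forall>x\<in>V. h x \<in> - {0}"
      using h(1)[unfolded continuous_at_open, rule_format, of "- {0}"] h(2) by auto
    moreover have "\<forall>x. h x *\<^sub>R B i x = OH_anchor x (w x)"
      using w(2) by (simp add: fun_eq_iff del: OH_anchor.simps)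
    ultimately have "P i (h, w, V)" using h(1) by (simp add: P_def del: OH_anchor.simps)
    then show ?thesis ..
  qed
  then obtain t where "\<forall>i\<in>I. P i (t i)"
    using bchoice[of I P] by blast
  moreover define h w V where "h = (\<lambda>i. fst (t i))" and "w = (\<lambda>i. fst (snd (t i)))" and "V = (\<lambda>i. snd (snd (t i)))"
  ultimately have "P i (h i, w i, V i)" if "i \<in> I" for i
    using that by simp
  then have hw: "\<And>i. i \<in> I \<Longrightarrow> isCont (h i) 0" "\<And>i. i \<in> I \<Longrightarrow> isCont (w i) 0"
    "\<And>i. i \<in> I \<Longrightarrow> open (V i)" "\<And>i. i \<in> I \<Longrightarrow> 0 \<in> V i" "\<And>i x. i \<in> I \<Longrightarrow> x \<in> V i \<Longrightarrow> h i x \<noteq> 0"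
    "\<And>i x. i \<in> I \<Longrightarrow> h i x *\<^sub>R B i x = OH_anchor x (w i x)"
    unfolding P_def by auto
  show ?thesis
  proof (rule that[of "\<lambda>i. inverse (h i 0) *\<^sub>R w i 0"])
    fix k v f U
    assume k: "isCont k 0" and U: "open U" "0 \<in> U" and f: "\<And>i. i \<in> I \<Longrightarrow> isCont (f i) 0"
      and eq: "\<And>x. x \<in> U \<Longrightarrow> k x *\<^sub>R OH_anchor x v = (\<Sum>i\<in>I. f i x *\<^sub>R B i x)"
    \<comment> \<open>The difference of two sections that have the same anchor near the origin; its
      value at 0 vanishes by \<open>OH_anchor_kernel_at_0\<close>.\<close>
    define g where "g = (\<lambda>x. k x *\<^sub>R v - (\<Sum>i\<in>I. f i x *\<^sub>R inverse (h i x) *\<^sub>R w i x))"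
    have "g 0 = 0"
    proof (rule OH_anchor_kernel_at_0)
      show "isCont g 0"
        unfolding g_def using hw(1,2,4,5) k f by (intro continuous_intros) auto
      show "open (U \<inter> (\<Inter>i\<in>I. V i))" "0 \<in> U \<inter> (\<Inter>i\<in>I. V i)"
        by (intro open_Int open_INT I U(1) ballI hw(3), assumption) (simp add: U(2) hw(4))
      fix x assume x: "x \<in> U \<inter> (\<Inter>i\<in>I. V i)"
      have "B i x = inverse (h i x) *\<^sub>R OH_anchor x (w i x)" if "i \<in> I" for i
        using hw(5)[OF that, of x] x that by (simp add: hw(6)[OF that, symmetric] del: OH_anchor.simps)
      then have "k x *\<^sub>R OH_anchor x v = (\<Sum>i\<in>I. f i x *\<^sub>R inverse (h i x) *\<^sub>R OH_anchor x (w i x))"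
        using eq[of x] x by (simp del: OH_anchor.simps)
      then show "OH_anchor x (g x) = 0"
        by (simp add: g_def OH_anchor_linear_simps linear_sum[OF linear_OH_anchor] del: OH_anchor.simps)
    qed
    then show "k 0 *\<^sub>R v = (\<Sum>i\<in>I. f i 0 *\<^sub>R inverse (h i 0) *\<^sub>R w i 0)"
      by (simp add: g_def)
  qed
qed

section \<open>The rank bound for Lie algebroids\<close>

lemma lie_algebroid_anchor_linear:
  assumes "lie_algebroid E" "v \<in> vb_fibre E x" "w \<in> vb_fibre E x"
  shows "la_anchor E x (r *\<^sub>R v + s *\<^sub>R w) = r *\<^sub>R la_anchor E x v + s *\<^sub>R la_anchor E x w"
proof -
  have "\<forall>x. \<forall>v\<in>vb_fibre E x. \<forall>w\<in>vb_fibre E x. \<forall>r s :: real.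
        la_anchor E x (r *\<^sub>R v + s *\<^sub>R w) = r *\<^sub>R la_anchor E x v + s *\<^sub>R la_anchor E x w"
    using assms(1) unfolding lie_algebroid_def by (elim conjE)
  with assms(2,3) show ?thesis by simp
qed

lemma vector_bundle_frame:
  assumes "vector_bundle E"
  obtains U b where "(U, b) \<in> vb_frames E" "x \<in> U"
proof -
  have "\<exists>(U, b)\<in>vb_frames E. x \<in> U"
    using assms unfolding vector_bundle_def by (elim conjE) (erule spec)
  then show ?thesis using that by blast
qed

lemma vector_bundle_frameD:
  assumes "vector_bundle E" "(U, b) \<in> vb_frames E"
  shows "open U" "x \<in> U \<Longrightarrow> span ((\<lambda>i. b i x) ` {..<vb_rank E}) = vb_fibre E x"
proof -
  have "\<forall>(U, b)\<in>vb_frames E. open U \<and>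
        (\<forall>x\<in>U. inj_on (\<lambda>i. b i x) {..<vb_rank E} \<and>
                independent ((\<lambda>i. b i x) ` {..<vb_rank E}) \<and>
                span ((\<lambda>i. b i x) ` {..<vb_rank E}) = vb_fibre E x)"
    using assms(1) unfolding vector_bundle_def by (elim conjE)
  from bspec[OF this assms(2)]
  show "open U" "x \<in> U \<Longrightarrow> span ((\<lambda>i. b i x) ` {..<vb_rank E}) = vb_fibre E x" by auto
qed

lemma vector_bundle_frame_in_fibre:
  assumes "vector_bundle E" "(U, b) \<in> vb_frames E" "x \<in> U" "i < vb_rank E"
  shows "b i x \<in> vb_fibre E x"
  unfolding vector_bundle_frameD(2)[OF assms(1-3), symmetric] using assms(4) by (auto intro: span_base)

lemma vector_bundle_subspace:
  assumes "vector_bundle E"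
  shows "subspace (vb_fibre E x)"
  by (rule vector_bundle_frame[OF assms, of x]) (metis vector_bundle_frameD(2)[OF assms] subspace_span)

text \<open>The anchor is linear only on the fibre, so the induction has to keep the partial sums
  inside it.\<close>

lemma algebroid_anchor_sum:
  assumes E: "lie_algebroid E" and "finite I" and b: "\<And>i. i \<in> I \<Longrightarrow> b i \<in> vb_fibre E x"
  shows "la_anchor E x (\<Sum>i\<in>I. c i *\<^sub>R b i) = (\<Sum>i\<in>I. c i *\<^sub>R la_anchor E x (b i))"
proof -
  have vb: "vector_bundle E" using E unfolding lie_algebroid_def by (elim conjE)
  note lin = lie_algebroid_anchor_linear[OF E]
  have sub: "subspace (vb_fibre E x)" by (rule vector_bundle_subspace[OF vb])
  have z: "la_anchor E x 0 = 0"
    using lin[of 0 x 0 0 0] subspace_0[OF sub] by simp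
  show ?thesis
    using \<open>finite I\<close> b
  proof (induction I rule: finite_induct)
    case (insert i I)
    have "(\<Sum>i\<in>I. c i *\<^sub>R b i) \<in> vb_fibre E x"
      using insert.prems by (intro subspace_sum[OF sub] subspace_scale[OF sub]) auto
    with insert lin[of "b i" x "\<Sum>i\<in>I. c i *\<^sub>R b i" "c i" 1] show ?case by simp
  qed (simp add: z)
qed

text \<open>In another frame over \<open>W\<close> the coefficients are \<open>h\<close> times an
  entry of the transition matrix. They are given on the overlap only, but vanish off
  \<open>C\<close> and so extend by zero to all of \<open>W\<close>.\<close>

lemma smooth_section_bump:
  fixes E :: "('m::euclidean_space, 'e::real_vector, 'z) vbundle_scheme"
  assumes vb: "vector_bundle E" and U: "(U, b) \<in> vb_frames E" and i: "i < vb_rank E"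
    and h: "smooth_compact_support h" "closed C" "C \<subseteq> U" "\<And>x. x \<notin> C \<Longrightarrow> h x = 0"
  shows "smooth_section E (\<lambda>x. if x \<in> U then h x *\<^sub>R b i x else 0)"
  unfolding smooth_section_def
proof (intro conjI allI ballI)
  fix x
  show "(if x \<in> U then h x *\<^sub>R b i x else 0) \<in> vb_fibre E x"
    using vector_bundle_frame_in_fibre[OF vb U _ i] vector_bundle_subspace[OF vb, of x]
    by (simp add: subspace_scale subspace_0)
next
  fix Wc assume "Wc \<in> vb_frames E"
  then obtain W c where Wc: "Wc = (W, c)" and W: "(W, c) \<in> vb_frames E" by (cases Wc) auto
  have o: "open U" "open W"
    by (rule vector_bundle_frameD(1)[OF vb U], rule vector_bundle_frameD(1)[OF vb W])
  obtain g :: "nat \<Rightarrow> nat \<Rightarrow> 'm \<Rightarrow> real" where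
    g: "\<forall>i<vb_rank E. \<forall>j<vb_rank E. smooth_on (W \<inter> U) (g i j)"
       "\<forall>x\<in>W \<inter> U. \<forall>j<vb_rank E. b j x = (\<Sum>i<vb_rank E. g i j x *\<^sub>R c i x)"
  proof -
    have "\<forall>(U, b)\<in>vb_frames E. \<forall>(V, c)\<in>vb_frames E. \<exists>g :: nat \<Rightarrow> nat \<Rightarrow> 'm \<Rightarrow> real.
        (\<forall>i<vb_rank E. \<forall>j<vb_rank E. smooth_on (U \<inter> V) (g i j)) \<and>
        (\<forall>x\<in>U \<inter> V. \<forall>j<vb_rank E. c j x = (\<Sum>i<vb_rank E. g i j x *\<^sub>R b i x))"
      using vb unfolding vector_bundle_def by (elim conjE)
    from bspec[OF bspec[OF this W, unfolded split_conv] U] that show ?thesis by auto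
  qed
  define f where "f = (\<lambda>j x. if x \<in> U then h x * g j i x else 0)"
  have "smooth_on W (f j)" if "j < vb_rank E" for j
  proof (rule smooth_on_extend_zero[OF _ o(2,1) h(2,3)])
    have hs: "smooth_on (W \<inter> U) h"
      using h(1) smooth_on_subset unfolding smooth_compact_support_def by blast
    have "smooth_on (W \<inter> U) (\<lambda>x. h x * g j i x)"
      using g(1) that i by (intro smooth_on_mult hs open_Int o) auto
    then show "smooth_on (W \<inter> U) (f j)"
      by (rule smooth_on_cong[OF _ open_Int[OF o(2,1)]]) (simp add: f_def)
    show "f j x = 0" if "x \<in> W - C" for x
      using that h(4) by (simp add: f_def)
  qed
  moreover have "(if x \<in> U then h x *\<^sub>R b i x else 0) = (\<Sum>j<vb_rank E. f j x *\<^sub>R c j x)" if "x \<in> W" for x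
    using g(2) that i by (auto simp: f_def scaleR_sum_right)
  ultimately show "case Wc of (W, c) \<Rightarrow> \<exists>f :: nat \<Rightarrow> 'm \<Rightarrow> real. (\<forall>j<vb_rank E. smooth_on W (f j)) \<and>
      (\<forall>x\<in>W. (if x \<in> U then h x *\<^sub>R b i x else 0) = (\<Sum>j<vb_rank E. f j x *\<^sub>R c j x))"
    unfolding Wc by (auto intro!: exI[of _ f])
qed

lemma OH_algebroid_rank_minimal:
  fixes E :: "(oct \<times> oct, 'e::real_vector) algebroid"
  assumes E: "lie_algebroid E" and fol: "algebroid_foliation E = OH_foliation"
  shows "16 \<le> vb_rank E"
proof -
  define r where "r = vb_rank E"
  have vb: "vector_bundle E" using E unfolding lie_algebroid_def by (elim conjE)
  obtain U b where U: "(U, b) \<in> vb_frames E" "0 \<in> U"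
    by (rule vector_bundle_frame[OF vb])
  have oU: "open U" by (rule vector_bundle_frameD(1)[OF vb U(1)])
  have fib: "b i x \<in> vb_fibre E x" if "i < r" "x \<in> U" for i x
    using vector_bundle_frame_in_fibre[OF vb U(1) that(2)] that(1) by (simp add: r_def)
  define B where "B = (\<lambda>i x. la_anchor E x (b i x))"
  obtain h :: "oct \<times> oct \<Rightarrow> real" and C V where h: "smooth_compact_support h" "closed C" "C \<subseteq> U"
    "\<And>x. x \<notin> C \<Longrightarrow> h x = 0" "open V" "0 \<in> V" "\<And>x. x \<in> V \<Longrightarrow> h x \<noteq> 0"
    using bump_exists[OF oU U(2)] by metis
  have h0: "isCont h 0" "h 0 \<noteq> 0"
    using h smooth_on_isCont[of UNIV h 0] by (auto simp: smooth_compact_support_def)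
  \<comment> \<open>One factor \<open>h\<close> turns the local section \<open>b i\<close> into a
    global one; the other is the compactly supported coefficient that \<open>Cc_span\<close>
    requires.\<close>
  have inF: "(\<lambda>x. (h x * h x) *\<^sub>R B i x) \<in> OH_foliation" if i: "i < r" for i
  proof -
    let ?s = "\<lambda>x. if x \<in> U then h x *\<^sub>R b i x else 0"
    have "smooth_section E ?s"
      by (rule smooth_section_bump[OF vb U(1) _ h(1-4)]) (use i in \<open>simp add: r_def\<close>)
    then have "(\<lambda>x. h x *\<^sub>R la_anchor E x (?s x)) \<in> algebroid_foliation E"
      unfolding algebroid_foliation_def by (intro Cc_span_scale[OF h(1)] CollectI exI[of _ ?s] conjI refl)
    moreover have "h x *\<^sub>R la_anchor E x (?s x) = (h x * h x) *\<^sub>R B i x" for x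
    proof (cases "x \<in> U")
      case True
      then show ?thesis
        using algebroid_anchor_sum[OF E, of "{i}" "\<lambda>j. b j x" x "\<lambda>_. h x"] fib[OF i True]
        by (simp add: B_def)
    next
      case False
      then have "h x = 0" using h(3) by (intro h(4)) blast
      then show ?thesis by simp
    qed
    ultimately show ?thesis unfolding fol by simp
  qed
  obtain R where R: "\<And>h v f U. isCont h 0 \<Longrightarrow> open U \<Longrightarrow> 0 \<in> U \<Longrightarrow> (\<And>i. i \<in> {..<r} \<Longrightarrow> isCont (f i) 0) \<Longrightarrow>
      (\<And>x. x \<in> U \<Longrightarrow> h x *\<^sub>R OH_anchor x v = (\<Sum>i<r. f i x *\<^sub>R B i x)) \<Longrightarrow>
      h 0 *\<^sub>R v = (\<Sum>i<r. f i 0 *\<^sub>R R i)"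
  proof (rule OH_foliation_frame_coefficients[of "{..<r}" B])
    show "\<exists>k :: oct \<times> oct \<Rightarrow> real. isCont k 0 \<and> k 0 \<noteq> 0 \<and> (\<lambda>x. k x *\<^sub>R B i x) \<in> OH_foliation" if "i \<in> {..<r}" for i
      using inF[of i] that h0 by (intro exI[of _ "\<lambda>x. h x * h x"]) (auto intro: isCont_mult)
  qed auto
  have "v \<in> span (R ` {..<r})" for v
  proof -
    have "(\<lambda>x. h x *\<^sub>R OH_anchor x v) \<in> algebroid_foliation E"
      unfolding fol by (rule OH_foliation_scale_anchor[OF h(1)])
    then obtain n f Y where Y: "\<forall>k<n. smooth_compact_support (f k) \<and>
        (\<exists>a. Y k = (\<lambda>x. la_anchor E x (a x)) \<and> smooth_section E a)"
      and X: "(\<lambda>x. h x *\<^sub>R OH_anchor x v) = (\<lambda>x. \<Sum>k<n::nat. f k x *\<^sub>R Y k x)"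
      unfolding algebroid_foliation_def Cc_span_def by blast
    have "\<exists>g :: nat \<Rightarrow> oct \<times> oct \<Rightarrow> real. (\<forall>i<r. smooth_on U (g i)) \<and> (\<forall>x\<in>U. Y k x = (\<Sum>i<r. g i x *\<^sub>R B i x))"
      if "k < n" for k
    proof -
      obtain a where a: "Y k = (\<lambda>x. la_anchor E x (a x))" "smooth_section E a" using Y \<open>k < n\<close> by blast
      then obtain g :: "nat \<Rightarrow> oct \<times> oct \<Rightarrow> real" where
        g: "\<forall>i<r. smooth_on U (g i)" "\<forall>x\<in>U. a x = (\<Sum>i<r. g i x *\<^sub>R b i x)"
        using U(1) unfolding smooth_section_def r_def by fast
      have "Y k x = (\<Sum>i<r. g i x *\<^sub>R B i x)" if "x \<in> U" for x
        unfolding a(1) B_def bspec[OF g(2) that]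
        by (rule algebroid_anchor_sum[OF E]) (use fib that in auto)
      then show ?thesis using g(1) by blast
    qed
    then have "\<forall>k\<in>{..<n}. \<exists>g :: nat \<Rightarrow> oct \<times> oct \<Rightarrow> real. (\<forall>i<r. smooth_on U (g i)) \<and> (\<forall>x\<in>U. Y k x = (\<Sum>i<r. g i x *\<^sub>R B i x))"
      by (intro ballI) (simp only: lessThan_iff)
    from bchoice[OF this] obtain g :: "nat \<Rightarrow> nat \<Rightarrow> oct \<times> oct \<Rightarrow> real" where
      g: "\<And>k i. k < n \<Longrightarrow> i < r \<Longrightarrow> smooth_on U (g k i)"
      "\<And>k x. k < n \<Longrightarrow> x \<in> U \<Longrightarrow> Y k x = (\<Sum>i<r. g k i x *\<^sub>R B i x)"
      by auto
    define F where "F = (\<lambda>i x. \<Sum>k<n. f k x * g k i x)"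
    have "h 0 *\<^sub>R v = (\<Sum>i<r. F i 0 *\<^sub>R R i)"
    proof (rule R[OF h0(1) oU U(2)])
      show "isCont (F i) 0" if "i \<in> {..<r}" for i
      proof -
        have "isCont (f k) 0" "isCont (g k i) 0" if "k < n" for k
          using Y that \<open>i \<in> {..<r}\<close> smooth_on_isCont[of UNIV "f k" 0] smooth_on_isCont[OF g(1)[of k i] oU U(2)]
          by (auto simp: smooth_compact_support_def)
        then show ?thesis unfolding F_def by (intro continuous_intros) auto
      qed
      show "h x *\<^sub>R OH_anchor x v = (\<Sum>i<r. F i x *\<^sub>R B i x)" if "x \<in> U" for x
      proof -
        have "h x *\<^sub>R OH_anchor x v = (\<Sum>k<n. f k x *\<^sub>R Y k x)"
          using fun_cong[OF X] .
        also have "\<dots> = (\<Sum>k<n. \<Sum>i<r. (f k x * g k i x) *\<^sub>R B i x)"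
          using g(2)[OF _ that] by (simp add: scaleR_sum_right)
        also have "\<dots> = (\<Sum>i<r. F i x *\<^sub>R B i x)"
          unfolding F_def scaleR_sum_left by (rule sum.swap)
        finally show ?thesis .
      qed
    qed
    moreover have "(\<Sum>i<r. F i 0 *\<^sub>R R i) \<in> span (R ` {..<r})"
      by (intro span_sum span_scale span_base) auto
    ultimately have "inverse (h 0) *\<^sub>R (h 0 *\<^sub>R v) \<in> span (R ` {..<r})"
      by (simp only: span_scale)
    then show ?thesis using h0(2) by simp
  qed
  \<comment> \<open>The \<open>R i\<close> span everything; repetitions among them only lower the
    cardinality.\<close>
  then have "dim (UNIV :: (oct \<times> oct) set) \<le> card (R ` {..<r})"
    by (intro dim_le_card) auto
  also have "\<dots> \<le> r"
    using card_image_le[of "{..<r}" R] by simp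
  finally show ?thesis by (simp add: r_def)
qed

section \<open>Smooth maps and differentials in the charts of an atlas\<close>

context
  fixes X :: "'p topology" and A :: "('p set \<times> ('p \<Rightarrow> 'a::euclidean_space)) set"
  assumes atlas: "smooth_atlas X A"
begin

lemma chart_open: "(U, \<phi>) \<in> A \<Longrightarrow> openin X U" "(U, \<phi>) \<in> A \<Longrightarrow> open (\<phi> ` U)"
  and chart_homeo: "(U, \<phi>) \<in> A \<Longrightarrow> homeomorphic_map (subtopology X U) (top_of_set (\<phi> ` U)) \<phi>"
  using atlas unfolding smooth_atlas_def by blast+

lemma chart_transition:
  assumes "(U, \<phi>) \<in> A" "(V, \<psi>) \<in> A"
  shows "smooth_on (\<phi> ` (U \<inter> V)) (\<psi> \<circ> inv_into U \<phi>)"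
  using atlas assms unfolding smooth_atlas_def by blast

lemma chart_inj:
  assumes "(U, \<phi>) \<in> A"
  shows "inj_on \<phi> U"
proof -
  have "U \<subseteq> topspace X" using chart_open(1)[OF assms] by (rule openin_subset)
  then show ?thesis
    using homeomorphic_imp_injective_map[OF chart_homeo[OF assms]] by (simp add: Int_absorb1)
qed

lemma chart_image_open:
  assumes "(U, \<phi>) \<in> A" "openin X W"
  shows "open (\<phi> ` (U \<inter> W))"
proof -
  have "openin (subtopology X U) (U \<inter> W)"
    using assms(2) by (simp add: openin_subtopology_Int2)
  then have "openin (top_of_set (\<phi> ` U)) (\<phi> ` (U \<inter> W))"
    using homeomorphic_imp_open_map[OF chart_homeo[OF assms(1)]] unfolding open_map_def by blast
  then show ?thesis
    using chart_open(2)[OF assms(1)] openin_open_trans by blast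
qed

lemma chart_overlap_open:
  assumes "(U, \<phi>) \<in> A" "(V, \<psi>) \<in> A"
  shows "open (\<phi> ` (U \<inter> V))"
  by (rule chart_image_open[OF assms(1) chart_open(1)[OF assms(2)]])

text \<open>\<open>smooth_map\<close> grants smoothness near each point in some chart of the atlas;
  the transition map transfers it to the prescribed one.\<close>

lemma smooth_map_coordinates:
  assumes f: "smooth_map A (topspace X) euclidean_atlas f" and U: "(U, \<phi>) \<in> A"
  shows "smooth_on (\<phi> ` U) (f \<circ> inv_into U \<phi>)"
proof (rule smooth_on_local[OF _ chart_open(2)[OF U]])
  fix y assume "y \<in> \<phi> ` U"
  then obtain p where p: "p \<in> U" "y = \<phi> p" by blast
  have sub: "U \<subseteq> topspace X" using chart_open(1)[OF U] by (rule openin_subset)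
  obtain V \<psi> N F where V: "(V, \<psi>) \<in> A" "p \<in> V" and N: "open N" "\<psi> p \<in> N" "smooth_on N F"
    and F: "\<And>q. q \<in> topspace X \<inter> V \<Longrightarrow> \<psi> q \<in> N \<Longrightarrow> f q = F (\<psi> q)"
    using f p sub unfolding smooth_map_def euclidean_atlas_def by fastforce
  define \<tau> where "\<tau> = \<psi> \<circ> inv_into U \<phi>"
  have inv: "inv_into U \<phi> (\<phi> q) = q" if "q \<in> U" for q
    using chart_inj[OF U] that by (rule inv_into_f_f)
  have o: "open (\<phi> ` (U \<inter> V))" by (rule chart_overlap_open[OF U V(1)])
  have \<tau>: "smooth_on (\<phi> ` (U \<inter> V)) \<tau>" unfolding \<tau>_def by (rule chart_transition[OF U V(1)])
  define T where "T = \<phi> ` (U \<inter> V) \<inter> \<tau> -` N"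
  have T: "open T"
    unfolding T_def by (rule continuous_open_preimage[OF smooth_on_imp_continuous_on[OF \<tau>] o N(1)])
  have yT: "y \<in> T" using p V(2) N(2) by (auto simp: T_def \<tau>_def inv)
  have Ft: "smooth_on T (\<lambda>y. F (\<tau> y))"
    by (rule smooth_on_compose[OF N(3) smooth_on_subset[OF \<tau>] T N(1)]) (auto simp: T_def)
  have "smooth_on T (f \<circ> inv_into U \<phi>)"
  proof (rule smooth_on_cong[OF Ft T])
    fix z assume z: "z \<in> T"
    then have "z \<in> \<phi> ` (U \<inter> V)" unfolding T_def by (rule IntD1)
    then obtain q where q: "q \<in> U" "q \<in> V" "z = \<phi> q" by (elim imageE IntE)
    then have "\<psi> q \<in> N" using z by (simp add: T_def \<tau>_def inv)
    then have "f q = F (\<psi> q)" using q sub by (intro F) auto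
    then show "F (\<tau> z) = (f \<circ> inv_into U \<phi>) z"
      using q by (simp add: \<tau>_def inv)
  qed
  from smooth_on_subset[OF this Int_lower2] T yT
  show "\<exists>T. open T \<and> y \<in> T \<and> smooth_on (\<phi> ` U \<inter> T) (f \<circ> inv_into U \<phi>)"
    by (intro exI conjI)
qed

text \<open>\<open>smooth_map\<close> includes that a whole neighbourhood is mapped into a chart
  domain, which yields continuity. So the preimage of \<open>U\<close> is open, being locally the
  preimage of a chart overlap under the coordinate representation.\<close>

lemma smooth_map_from_euclidean:
  fixes u :: "'m::euclidean_space \<Rightarrow> 'p"
  assumes u: "smooth_map euclidean_atlas UNIV A u" and U: "(U, \<phi>) \<in> A"
  shows "open {x. u x \<in> U}" "smooth_on {x. u x \<in> U} (\<lambda>x. \<phi> (u x))"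
proof -
  have loc: "\<exists>T. open T \<and> x \<in> T \<and> T \<subseteq> {x. u x \<in> U} \<and> smooth_on T (\<lambda>x. \<phi> (u x))" if x: "u x \<in> U" for x
  proof -
    obtain V \<psi> N F where V: "(V, \<psi>) \<in> A" "u x \<in> V" and N: "open N" "x \<in> N" "smooth_on N F"
      and F: "\<And>q. q \<in> N \<Longrightarrow> u q \<in> V \<and> \<psi> (u q) = F q"
      using u unfolding smooth_map_def euclidean_atlas_def by fastforce
    have inv: "inv_into V \<psi> (\<psi> q) = q" if "q \<in> V" for q
      using chart_inj[OF V(1)] that by (rule inv_into_f_f)
    have o: "open (\<psi> ` (V \<inter> U))" by (rule chart_overlap_open[OF V(1) U])
    define T where "T = N \<inter> F -` (\<psi> ` (V \<inter> U))"
    have T: "open T"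
      unfolding T_def by (rule continuous_open_preimage[OF smooth_on_imp_continuous_on[OF N(3)] N(1) o])
    have TU: "u q \<in> U" if q: "q \<in> T" for q
    proof -
      obtain p where "p \<in> V" "p \<in> U" "\<psi> (u q) = \<psi> p" using q F[of q] by (auto simp: T_def)
      moreover have "u q \<in> V" using q F[of q] by (simp add: T_def)
      ultimately have "u q = p" using chart_inj[OF V(1)] by (auto dest: inj_onD)
      then show ?thesis using \<open>p \<in> U\<close> by simp
    qed
    have "smooth_on T (\<lambda>q. (\<phi> \<circ> inv_into V \<psi>) (F q))"
      by (rule smooth_on_compose[OF chart_transition[OF V(1) U] smooth_on_subset[OF N(3)] T o])
        (auto simp: T_def)
    then have "smooth_on T (\<lambda>x. \<phi> (u x))"
    proof (rule smooth_on_cong[OF _ T])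
      fix q assume "q \<in> T"
      then have "q \<in> N" unfolding T_def by (rule IntD1)
      from F[OF this] have q: "u q \<in> V" "F q = \<psi> (u q)" by auto
      show "(\<phi> \<circ> inv_into V \<psi>) (F q) = \<phi> (u q)"
        by (simp add: q inv)
    qed
    moreover have "F x \<in> \<psi> ` (V \<inter> U)"
      using F[OF N(2)] x V(2) by (metis IntI imageI)
    then have "x \<in> T" using N(2) by (simp add: T_def)
    moreover have "T \<subseteq> {x. u x \<in> U}" using TU by blast
    ultimately show ?thesis using T by (intro exI conjI)
  qed
  then show o: "open {x. u x \<in> U}" by (subst open_subopen) blast
  show "smooth_on {x. u x \<in> U} (\<lambda>x. \<phi> (u x))"
  proof (rule smooth_on_local[OF _ o])
    fix x assume "x \<in> {x. u x \<in> U}"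
    then obtain T where "open T" "x \<in> T" "smooth_on T (\<lambda>x. \<phi> (u x))" using loc by blast
    with smooth_on_subset[OF this(3) Int_lower2]
    show "\<exists>T. open T \<and> x \<in> T \<and> smooth_on ({x. u x \<in> U} \<inter> T) (\<lambda>x. \<phi> (u x))"
      by (intro exI conjI)
  qed
qed

lemma chart_diff_chain:
  fixes f :: "'p \<Rightarrow> 'b::euclidean_space"
  assumes U: "(U, \<phi>) \<in> A" and V: "(V, \<psi>) \<in> A" and p: "p \<in> U" "p \<in> V"
    and f: "(f \<circ> inv_into V \<psi>) differentiable (at (\<psi> p))"
  shows "chart_diff (V, \<psi>) f p (chart_diff (U, \<phi>) \<psi> p w) = chart_diff (U, \<phi>) f p w"
proof -
  have invU: "inv_into U \<phi> (\<phi> q) = q" if "q \<in> U" for q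
    using chart_inj[OF U] that by (rule inv_into_f_f)
  have invV: "inv_into V \<psi> (\<psi> q) = q" if "q \<in> V" for q
    using chart_inj[OF V] that by (rule inv_into_f_f)
  define \<tau> where "\<tau> = \<psi> \<circ> inv_into U \<phi>"
  have o: "open (\<phi> ` (U \<inter> V))" by (rule chart_overlap_open[OF U V])
  have pm: "\<phi> p \<in> \<phi> ` (U \<inter> V)" using p by blast
  have d1: "(\<tau> has_derivative frechet_derivative \<tau> (at (\<phi> p))) (at (\<phi> p))"
    unfolding \<tau>_def by (rule smooth_on_has_derivative[OF chart_transition[OF U V] pm])
  have \<tau>p: "\<tau> (\<phi> p) = \<psi> p" using p by (simp add: \<tau>_def invU)
  have d2: "((f \<circ> inv_into V \<psi>) has_derivative frechet_derivative (f \<circ> inv_into V \<psi>) (at (\<psi> p))) (at (\<tau> (\<phi> p)))"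
    unfolding \<tau>p by (rule has_derivative_frechet[OF f])
  have "((\<lambda>y. (f \<circ> inv_into V \<psi>) (\<tau> y)) has_derivative
      (\<lambda>w. frechet_derivative (f \<circ> inv_into V \<psi>) (at (\<psi> p)) (frechet_derivative \<tau> (at (\<phi> p)) w))) (at (\<phi> p))"
    by (rule has_derivative_compose[OF d1 d2])
  then have "((f \<circ> inv_into U \<phi>) has_derivative
      (\<lambda>w. frechet_derivative (f \<circ> inv_into V \<psi>) (at (\<psi> p)) (frechet_derivative \<tau> (at (\<phi> p)) w))) (at (\<phi> p))"
    by (rule has_derivative_transform_within_open[OF _ o pm]) (auto simp: \<tau>_def invU invV)
  from frechet_derivative_eqI[OF this] show ?thesis
    by (simp add: chart_diff_def \<tau>_def)
qed

end

section \<open>The dimension bound for Lie groupoids\<close>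

lemma dim_kernel_of_right_inverse:
  fixes f :: "'a::euclidean_space \<Rightarrow> 'b::euclidean_space" and g :: "'b \<Rightarrow> 'a"
  assumes f: "linear f" and g: "linear g" and fg: "\<And>x. f (g x) = x"
  shows "dim {x. f x = 0} + DIM('b) \<le> DIM('a)"
proof -
  let ?K = "{x. f x = 0}"
  have K: "subspace ?K" using f by (rule linear_subspace_kernel)
  have R: "subspace (range g)" using g linear_subspace_image subspace_UNIV by blast
  \<comment> \<open>A right inverse is injective, so its range is a copy of the codomain,
    independent of the kernel.\<close>
  have "?K \<inter> range g = {0}"
  proof -
    have "x = 0" if "f x = 0" "x = g y" for x y
      using that fg[of y] linear_0[OF g] by simp
    moreover have "0 \<in> ?K \<inter> range g" using subspace_0[OF K] subspace_0[OF R] by blast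
    ultimately show ?thesis by blast
  qed
  then have "dim {x + y |x y. x \<in> ?K \<and> y \<in> range g} = dim ?K + dim (range g)"
    using dim_sums_Int[OF K R] by simp
  moreover have "dim (range g) = DIM('b)"
    using dim_image_eq[OF g, of UNIV] fg by (metis dim_UNIV inj_on_inverseI span_UNIV)
  moreover have "dim {x + y |x y. x \<in> ?K \<and> y \<in> range g} \<le> DIM('a)"
    by (rule dim_subset_UNIV)
  ultimately show ?thesis by simp
qed

text \<open>The bound concerns only a neighbourhood of the unit at the origin, so one chart around
  that unit is fixed. Other charts enter because a section of the Lie algebroid has to be given in
  all of them.\<close>

locale OH_groupoid_inducing =
  fixes H :: "(oct \<times> oct, 'g, 'c::euclidean_space) groupoid"
    and U :: "'g set" and \<phi> :: "'g \<Rightarrow> 'c"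
  assumes H: "lie_groupoid H" and fol: "groupoid_foliation H = OH_foliation"
    and U: "(U, \<phi>) \<in> gp_charts H" and unit0: "gp_unit H 0 \<in> U"
begin

lemma atlas: "smooth_atlas (gp_top H) (gp_charts H)"
  using H unfolding lie_groupoid_def by (elim conjE)

lemma source_smooth: "smooth_map (gp_charts H) (gp_arrows H) euclidean_atlas (gp_source H)"
  using H unfolding lie_groupoid_def by (elim conjE)

lemma target_smooth: "smooth_map (gp_charts H) (gp_arrows H) euclidean_atlas (gp_target H)"
  using H unfolding lie_groupoid_def by (elim conjE)

lemma unit_smooth_map: "smooth_map euclidean_atlas UNIV (gp_charts H) (gp_unit H)"
  using H unfolding lie_groupoid_def by (elim conjE)

lemma source_unit: "gp_source H (gp_unit H x) = x"
proof -
  have "\<forall>x. gp_unit H x \<in> gp_arrows H \<and> gp_source H (gp_unit H x) = x \<and> gp_target H (gp_unit H x) = x"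
    using H unfolding lie_groupoid_def by (elim conjE)
  then show ?thesis by blast
qed

definition dom :: "'g set \<Rightarrow> (oct \<times> oct) set" where
  "dom V = {x. gp_unit H x \<in> V}"

abbreviation cd :: "'g set \<Rightarrow> ('g \<Rightarrow> 'c) \<Rightarrow> ('g \<Rightarrow> 'b::euclidean_space) \<Rightarrow> oct \<times> oct \<Rightarrow> 'c \<Rightarrow> 'b" where
  "cd V \<psi> f x \<equiv> chart_diff (V, \<psi>) f (gp_unit H x)"

lemma dom_open: "(V, \<psi>) \<in> gp_charts H \<Longrightarrow> open (dom V)"
  unfolding dom_def by (rule smooth_map_from_euclidean(1)[OF atlas unit_smooth_map])

lemma unit_smooth: "(V, \<psi>) \<in> gp_charts H \<Longrightarrow> smooth_on (dom V) (\<lambda>x. \<psi> (gp_unit H x))"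
  unfolding dom_def by (rule smooth_map_from_euclidean(2)[OF atlas unit_smooth_map])

lemma cd_eq: "cd V \<psi> f x = frechet_derivative (f \<circ> inv_into V \<psi>) (at (\<psi> (gp_unit H x)))"
  by (simp add: chart_diff_def)

text \<open>Covers the source and target maps as well as the coordinates of a second chart.\<close>

definition coord_smooth :: "'g set \<Rightarrow> ('g \<Rightarrow> 'b::euclidean_space) \<Rightarrow> bool" where
  "coord_smooth W f \<longleftrightarrow> (\<forall>(V, \<psi>)\<in>gp_charts H. open (\<psi> ` (V \<inter> W)) \<and> smooth_on (\<psi> ` (V \<inter> W)) (f \<circ> inv_into V \<psi>))"

lemma coord_smoothD:
  assumes "coord_smooth W f" "(V, \<psi>) \<in> gp_charts H"
  shows "open (\<psi> ` (V \<inter> W))" "smooth_on (\<psi> ` (V \<inter> W)) (f \<circ> inv_into V \<psi>)"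
  using assms unfolding coord_smooth_def by fast+

lemma coord_smooth_source: "coord_smooth UNIV (gp_source H)"
  and coord_smooth_target: "coord_smooth UNIV (gp_target H)"
  unfolding coord_smooth_def
  using smooth_map_coordinates[OF atlas source_smooth] smooth_map_coordinates[OF atlas target_smooth] chart_open(2)[OF atlas]
  by auto

lemma coord_smooth_chart: "(W, \<psi>) \<in> gp_charts H \<Longrightarrow> coord_smooth W \<psi>"
  unfolding coord_smooth_def using chart_transition[OF atlas] chart_overlap_open[OF atlas] by auto

lemma cd_smooth:
  assumes f: "coord_smooth W f" and V: "(V, \<psi>) \<in> gp_charts H"
    and S: "open S" "S \<subseteq> dom V \<inter> dom W" and w: "smooth_on S w"
  shows "smooth_on S (\<lambda>x. cd V \<psi> f x (w x))"
  unfolding cd_eq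
proof (rule smooth_on_frechet_apply[OF coord_smoothD(2)[OF f V] _ w S(1) coord_smoothD(1)[OF f V]])
  show "smooth_on S (\<lambda>x. \<psi> (gp_unit H x))"
    by (rule smooth_on_subset[OF unit_smooth[OF V]]) (use S(2) in blast)
  show "(\<lambda>x. \<psi> (gp_unit H x)) ` S \<subseteq> \<psi> ` (V \<inter> W)"
    using S(2) unfolding dom_def by blast
qed

lemma cd_differentiable:
  assumes "coord_smooth W f" "(V, \<psi>) \<in> gp_charts H" "x \<in> dom V \<inter> dom W"
  shows "(f \<circ> inv_into V \<psi>) differentiable (at (\<psi> (gp_unit H x)))"
  by (rule smooth_on_imp_differentiable[OF coord_smoothD(2)[OF assms(1,2)]])
    (use assms(3) in \<open>unfold dom_def, blast\<close>)

lemma cd_linear: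
  assumes "coord_smooth W f" "(V, \<psi>) \<in> gp_charts H" "x \<in> dom V \<inter> dom W"
  shows "linear (cd V \<psi> f x)"
  unfolding cd_eq by (rule linear_frechet_derivative[OF cd_differentiable[OF assms]])

lemma cd_chain:
  assumes "coord_smooth W f" "(V, \<psi>) \<in> gp_charts H" "(V', \<psi>') \<in> gp_charts H" "x \<in> dom V \<inter> dom V' \<inter> dom W"
  shows "cd V' \<psi>' f x (cd V \<psi> \<psi>' x w) = cd V \<psi> f x w"
  by (rule chart_diff_chain[OF atlas assms(2,3)]) (use assms(4) cd_differentiable[OF assms(1,3)] in \<open>auto simp: dom_def\<close>)

lemma dom_UNIV: "dom UNIV = UNIV" by (simp add: dom_def)

abbreviation du :: "oct \<times> oct \<Rightarrow> oct \<times> oct \<Rightarrow> 'c" where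
  "du x \<equiv> frechet_derivative (\<lambda>x. \<phi> (gp_unit H x)) (at x)"

abbreviation ds :: "oct \<times> oct \<Rightarrow> 'c \<Rightarrow> oct \<times> oct" where
  "ds x \<equiv> cd U \<phi> (gp_source H) x"

lemma du_linear: "x \<in> dom U \<Longrightarrow> linear (du x)"
  by (rule linear_frechet_derivative[OF smooth_on_imp_differentiable[OF unit_smooth[OF U]]])

lemma ds_linear: "x \<in> dom U \<Longrightarrow> linear (ds x)"
  by (rule cd_linear[OF coord_smooth_source U]) (simp add: dom_UNIV)

text \<open>Differentiate the identity that the source of the unit at \<open>x\<close> is
  \<open>x\<close>, in the coordinates of the fixed chart.\<close>

lemma ds_du:
  assumes x: "x \<in> dom U"
  shows "ds x (du x v) = v"
proof -
  have d1: "((\<lambda>x. \<phi> (gp_unit H x)) has_derivative du x) (at x)"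
    by (rule smooth_on_has_derivative[OF unit_smooth[OF U] x])
  have d2: "((gp_source H \<circ> inv_into U \<phi>) has_derivative ds x) (at (\<phi> (gp_unit H x)))"
    unfolding cd_eq by (rule has_derivative_frechet[OF cd_differentiable[OF coord_smooth_source U]])
      (use x in \<open>simp add: dom_UNIV\<close>)
  have "((\<lambda>y. (gp_source H \<circ> inv_into U \<phi>) (\<phi> (gp_unit H y))) has_derivative (\<lambda>v. ds x (du x v))) (at x)"
    by (rule has_derivative_compose[OF d1 d2])
  then have "((\<lambda>y. y) has_derivative (\<lambda>v. ds x (du x v))) (at x)"
    by (rule has_derivative_transform_within_open[OF _ dom_open[OF U] x])
      (use chart_inj[OF atlas U] in \<open>simp add: dom_def inv_into_f_f source_unit\<close>)
  from has_derivative_unique[OF this has_derivative_ident] show ?thesis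
    by (rule fun_cong)
qed

text \<open>The derivative of the unit map splits the derivative of the source map, so this is a smooth
  family of projections onto the fibres of the Lie algebroid.\<close>

definition proj :: "oct \<times> oct \<Rightarrow> 'c \<Rightarrow> 'c" where
  "proj x w = w - du x (ds x w)"

lemma ds_proj: "x \<in> dom U \<Longrightarrow> ds x (proj x w) = 0"
  by (simp add: proj_def linear_diff[OF ds_linear] ds_du)

lemma proj_id: "x \<in> dom U \<Longrightarrow> ds x w = 0 \<Longrightarrow> proj x w = w"
  by (simp add: proj_def linear_0[OF du_linear])

lemma proj_linear: "x \<in> dom U \<Longrightarrow> linear (proj x)"
  unfolding proj_def[abs_def]
  by (intro linear_compose_sub linear_ident linear_compose[OF ds_linear du_linear, unfolded o_def])

lemma proj_smooth: "smooth_on (dom U) (\<lambda>x. proj x w)"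
proof -
  have "smooth_on (dom U) (\<lambda>x. ds x w)"
    by (rule cd_smooth[OF coord_smooth_source U dom_open[OF U]]) (auto simp: dom_UNIV)
  then have "smooth_on (dom U) (\<lambda>x. du x (ds x w))"
    by (intro smooth_on_frechet_apply[OF unit_smooth[OF U] smooth_on_ident _ dom_open[OF U] dom_open[OF U]]) auto
  then show ?thesis
    unfolding proj_def by (intro smooth_on_diff dom_open[OF U] smooth_on_const)
qed

text \<open>Defined for every \<open>w\<close> of the model space, not just for vectors in the
  kernel of \<open>ds x\<close>; with \<open>w\<close> in a basis this generates near the origin
  without a local frame of the kernel.\<close>

definition gen :: "'c \<Rightarrow> oct \<times> oct \<Rightarrow> oct \<times> oct" where
  "gen w x = cd U \<phi> (gp_target H) x (proj x w)"

text \<open>As for algebroids, one factor \<open>h\<close> cuts off the local section and the other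
  is the coefficient in \<open>Cc_span\<close>.\<close>

lemma gen_bump_in_foliation:
  assumes h: "smooth_compact_support h" "closed C" "C \<subseteq> dom U" "\<And>x. x \<notin> C \<Longrightarrow> h x = 0"
  shows "(\<lambda>x. (h x * h x) *\<^sub>R gen w x) \<in> OH_foliation"
proof -
  \<comment> \<open>The vector given in the fixed chart is transported to every other chart by the
    derivative of the coordinate change; the value 0 off \<open>dom U\<close> fits because
    \<open>h\<close> vanishes off \<open>C\<close>.\<close>
  define a where "a = (\<lambda>(\<kappa> :: 'g set \<times> ('g \<Rightarrow> 'c)) x. if x \<in> dom U then cd U \<phi> (snd \<kappa>) x (h x *\<^sub>R proj x w) else 0)"
  define Y where "Y = (\<lambda>x. if x \<in> dom U then cd U \<phi> (gp_target H) x (h x *\<^sub>R proj x w) else 0)"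
  \<comment> \<open>By the chain rule the transported vector acts on any map as the original one
    does. Taking \<open>f\<close> to be the source, the target or the coordinates of a further chart
    gives the kernel condition, the anchor and the transformation law.\<close>
  have push: "cd V \<psi> f x (a (V, \<psi>) x) = (if x \<in> dom U then cd U \<phi> f x (h x *\<^sub>R proj x w) else 0)"
    if "coord_smooth W f" "(V, \<psi>) \<in> gp_charts H" "x \<in> dom V \<inter> dom W"
    for V \<psi> W x and f :: "'g \<Rightarrow> 'b::euclidean_space"
    using cd_chain[OF that(1) U that(2)] linear_0[OF cd_linear[OF that]] that(3) by (simp add: a_def)
  have sec: "groupoid_section H a"
    unfolding groupoid_section_def
  proof (intro conjI ballI allI impI)
    fix \<kappa> assume "\<kappa> \<in> gp_charts H"
    then obtain V \<psi> where \<kappa>: "\<kappa> = (V, \<psi>)" and V: "(V, \<psi>) \<in> gp_charts H" by (cases \<kappa>) auto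
    have o: "open (dom V \<inter> dom U)" by (intro open_Int dom_open[OF U] dom_open[OF V])
    have "smooth_on (dom V) (a (V, \<psi>))"
    proof (rule smooth_on_extend_zero[OF _ dom_open[OF V] dom_open[OF U] h(2,3)])
      have hs: "smooth_on (dom V \<inter> dom U) h"
        using h(1) smooth_on_subset[of UNIV h] by (simp add: smooth_compact_support_def)
      have "smooth_on (dom V \<inter> dom U) (\<lambda>x. cd U \<phi> \<psi> x (h x *\<^sub>R proj x w))"
        by (rule cd_smooth[OF coord_smooth_chart[OF V] U o])
          (auto intro!: smooth_on_scaleR[OF o hs] smooth_on_subset[OF proj_smooth])
      then show "smooth_on (dom V \<inter> dom U) (a (V, \<psi>))"
        by (rule smooth_on_cong[OF _ o]) (simp add: a_def)
      show "a (V, \<psi>) x = 0" if "x \<in> dom V - C" for x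
        using that h(4) linear_0[OF cd_linear[OF coord_smooth_chart[OF V] U]] by (simp add: a_def)
    qed
    then show "smooth_on {x. gp_unit H x \<in> fst \<kappa>} (a \<kappa>)" by (simp add: \<kappa> dom_def)
    fix x assume "gp_unit H x \<in> fst \<kappa>"
    then have x: "x \<in> dom V \<inter> dom UNIV" by (simp add: \<kappa> dom_def)
    have "x \<in> dom U \<Longrightarrow> ds x (h x *\<^sub>R proj x w) = 0"
      by (simp add: linear_scale[OF ds_linear] ds_proj)
    then show "chart_diff \<kappa> (gp_source H) (gp_unit H x) (a \<kappa> x) = 0"
      unfolding \<kappa> push[OF coord_smooth_source V x] by simp
  next
    fix \<kappa> \<kappa>' x assume k: "\<kappa> \<in> gp_charts H" "\<kappa>' \<in> gp_charts H" "gp_unit H x \<in> fst \<kappa> \<inter> fst \<kappa>'"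
    obtain V \<psi> V' \<psi>' where \<kappa>: "\<kappa> = (V, \<psi>)" "\<kappa>' = (V', \<psi>')" by (metis surj_pair)
    have V: "(V, \<psi>) \<in> gp_charts H" "(V', \<psi>') \<in> gp_charts H" and x: "x \<in> dom V \<inter> dom V'"
      using k by (simp_all add: \<kappa> dom_def)
    show "a \<kappa>' x = chart_diff \<kappa> (snd \<kappa>') (gp_unit H x) (a \<kappa> x)"
      unfolding \<kappa> snd_conv push[OF coord_smooth_chart[OF V(2)] V(1) x] by (simp add: a_def)
  qed
  have "Y x = chart_diff \<kappa> (gp_target H) (gp_unit H x) (a \<kappa> x)"
    if "\<kappa> \<in> gp_charts H" "gp_unit H x \<in> fst \<kappa>" for \<kappa> x
  proof -
    obtain V \<psi> where \<kappa>: "\<kappa> = (V, \<psi>)" by (cases \<kappa>)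
    have V: "(V, \<psi>) \<in> gp_charts H" and x: "x \<in> dom V \<inter> dom UNIV" using that by (simp_all add: \<kappa> dom_def)
    show ?thesis
      unfolding \<kappa> push[OF coord_smooth_target V x] by (simp add: Y_def)
  qed
  then have "(\<lambda>x. h x *\<^sub>R Y x) \<in> groupoid_foliation H"
    unfolding groupoid_foliation_def
    by (intro Cc_span_scale[OF h(1)] CollectI exI[of _ a] conjI sec ballI allI impI)
  moreover have "h x *\<^sub>R Y x = (h x * h x) *\<^sub>R gen w x" for x
  proof (cases "x \<in> dom U")
    case True
    then show ?thesis
      using linear_scale[OF cd_linear[OF coord_smooth_target U]] by (simp add: Y_def gen_def dom_UNIV)
  next
    case False
    then have "h x = 0" using h(3) by (intro h(4)) blast
    then show ?thesis by simp
  qed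
  ultimately show ?thesis unfolding fol by simp
qed

lemma zero_dom: "0 \<in> dom U" using unit0 by (simp add: dom_def)

text \<open>The basis has as many elements as the arrows have dimensions, so spanning by the
  \<open>R i\<close> alone would give only 16. The gain comes from restricting \<open>L\<close> to
  the kernel \<open>K\<close> of the source differential: \<open>L\<close> still maps
  \<open>K\<close> onto the whole fibre, and the range of \<open>du 0\<close> accounts for 16
  further dimensions.\<close>

lemma dim_arrows: "32 \<le> DIM('c)"
proof -
  note oU = dom_open[OF U]
  obtain h :: "oct \<times> oct \<Rightarrow> real" and C V where h: "smooth_compact_support h" "closed C" "C \<subseteq> dom U"
    "\<And>x. x \<notin> C \<Longrightarrow> h x = 0" "open V" "0 \<in> V" "\<And>x. x \<in> V \<Longrightarrow> h x \<noteq> 0"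
    using bump_exists[OF oU zero_dom] by metis
  have h0: "isCont h 0" "h 0 \<noteq> 0"
    using h(1) h(7)[OF h(6)] smooth_on_isCont[of UNIV h 0] by (auto simp: smooth_compact_support_def)
  obtain R where R: "\<And>h v f U. isCont h 0 \<Longrightarrow> open U \<Longrightarrow> 0 \<in> U \<Longrightarrow> (\<And>i. i \<in> (Basis :: 'c set) \<Longrightarrow> isCont (f i) 0) \<Longrightarrow>
      (\<And>x. x \<in> U \<Longrightarrow> h x *\<^sub>R OH_anchor x v = (\<Sum>i\<in>Basis. f i x *\<^sub>R gen i x)) \<Longrightarrow>
      h 0 *\<^sub>R v = (\<Sum>i\<in>Basis. f i 0 *\<^sub>R R i)"
  proof (rule OH_foliation_frame_coefficients[of "Basis :: 'c set" gen])
    show "\<exists>k :: oct \<times> oct \<Rightarrow> real. isCont k 0 \<and> k 0 \<noteq> 0 \<and> (\<lambda>x. k x *\<^sub>R gen i x) \<in> OH_foliation" for i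
      using gen_bump_in_foliation[OF h(1-4), of i] h0
      by (intro exI[of _ "\<lambda>x. h x * h x"]) (auto intro: isCont_mult)
  qed auto
  define K where "K = {w. ds 0 w = 0}"
  define L where "L = (\<lambda>w::'c. \<Sum>i\<in>Basis. (w \<bullet> i) *\<^sub>R R i)"
  have L: "linear L"
    unfolding L_def by (rule linearI) (simp_all add: inner_add_left scaleR_add_left sum.distrib scaleR_sum_right)
  have "v \<in> L ` K" for v
  proof -
    have "(\<lambda>x. h x *\<^sub>R OH_anchor x v) \<in> groupoid_foliation H"
      unfolding fol by (rule OH_foliation_scale_anchor[OF h(1)])
    then obtain n f Y where Y: "\<forall>k<n. smooth_compact_support (f k) \<and>
        (\<exists>a. groupoid_section H a \<and> (\<forall>\<kappa>\<in>gp_charts H. \<forall>x. gp_unit H x \<in> fst \<kappa> \<longrightarrow>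
        Y k x = chart_diff \<kappa> (gp_target H) (gp_unit H x) (a \<kappa> x)))"
      and X: "(\<lambda>x. h x *\<^sub>R OH_anchor x v) = (\<lambda>x. \<Sum>k<n::nat. f k x *\<^sub>R Y k x)"
      unfolding groupoid_foliation_def Cc_span_def by blast
    have "\<exists>a. smooth_on (dom U) a \<and> (\<forall>x\<in>dom U. ds x (a x) = 0 \<and> Y k x = cd U \<phi> (gp_target H) x (a x))"
      if k: "k < n" for k
    proof -
      obtain a where a: "groupoid_section H a" "\<forall>\<kappa>\<in>gp_charts H. \<forall>x. gp_unit H x \<in> fst \<kappa> \<longrightarrow>
        Y k x = chart_diff \<kappa> (gp_target H) (gp_unit H x) (a \<kappa> x)"
        using Y k by blast
      have 1: "smooth_on (dom U) (a (U, \<phi>))"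
        using a(1)[unfolded groupoid_section_def, THEN conjunct1, THEN bspec, OF U] by (simp add: dom_def)
      have 2: "ds x (a (U, \<phi>) x) = 0" if "x \<in> dom U" for x
        using a(1)[unfolded groupoid_section_def, THEN conjunct2, THEN conjunct1, THEN bspec, OF U] that
        by (simp add: dom_def del: split_paired_All)
      have 3: "Y k x = cd U \<phi> (gp_target H) x (a (U, \<phi>) x)" if "x \<in> dom U" for x
        using bspec[OF a(2) U] that by (simp add: dom_def del: split_paired_All)
      show ?thesis using 1 2 3 by (intro exI[of _ "a (U, \<phi>)"]) simp
    qed
    then have "\<forall>k\<in>{..<n}. \<exists>a. smooth_on (dom U) a \<and> (\<forall>x\<in>dom U. ds x (a x) = 0 \<and> Y k x = cd U \<phi> (gp_target H) x (a x))"
      by (intro ballI) (simp only: lessThan_iff)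
    from bchoice[OF this] obtain a where a: "\<And>k. k < n \<Longrightarrow> smooth_on (dom U) (a k)"
      "\<And>k x. k < n \<Longrightarrow> x \<in> dom U \<Longrightarrow> ds x (a k x) = 0"
      "\<And>k x. k < n \<Longrightarrow> x \<in> dom U \<Longrightarrow> Y k x = cd U \<phi> (gp_target H) x (a k x)"
      by auto
    define F where "F = (\<lambda>x. \<Sum>k<n. f k x *\<^sub>R a k x)"
    have F0: "ds x (F x) = 0" if "x \<in> dom U" for x
      using that a(2) by (simp add: F_def linear_sum[OF ds_linear] linear_scale[OF ds_linear])
    have FX: "h x *\<^sub>R OH_anchor x v = cd U \<phi> (gp_target H) x (F x)" if "x \<in> dom U" for x
    proof -
      have l: "linear (cd U \<phi> (gp_target H) x)"
        by (rule cd_linear[OF coord_smooth_target U]) (use that in \<open>simp add: dom_UNIV\<close>)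
      have "h x *\<^sub>R OH_anchor x v = (\<Sum>k<n. f k x *\<^sub>R Y k x)"
        using fun_cong[OF X] .
      then show ?thesis
        using a(3) that by (simp add: F_def linear_sum[OF l] linear_scale[OF l] del: OH_anchor.simps)
    qed
    have cF: "isCont F 0"
    proof -
      have "isCont (f k) 0" "isCont (a k) 0" if "k < n" for k
        using Y that smooth_on_isCont[of UNIV "f k" 0] smooth_on_isCont[OF a(1)[OF that] oU zero_dom]
        by (auto simp: smooth_compact_support_def)
      then show ?thesis unfolding F_def by (intro continuous_intros) auto
    qed
    have "h 0 *\<^sub>R v = (\<Sum>i\<in>Basis. (F 0 \<bullet> i) *\<^sub>R R i)"
    proof (rule R[of h "dom U" "\<lambda>i x. F x \<bullet> i"])
      show "isCont (\<lambda>x. F x \<bullet> i) 0" for i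
        using cF by (intro continuous_intros)
      fix x assume x: "x \<in> dom U"
      have l: "linear (\<lambda>w. cd U \<phi> (gp_target H) x (proj x w))"
        by (rule linear_compose[OF proj_linear[OF x] cd_linear[OF coord_smooth_target U], unfolded o_def])
          (use x in \<open>simp add: dom_UNIV\<close>)
      \<comment> \<open>\<open>F x\<close> lies in the kernel of \<open>ds x\<close>, so
        \<open>proj x\<close> fixes it; inserting \<open>proj x\<close> before expanding in the
        basis produces the fields \<open>gen i\<close>.\<close>
      have "h x *\<^sub>R OH_anchor x v = cd U \<phi> (gp_target H) x (proj x (\<Sum>i\<in>Basis. (F x \<bullet> i) *\<^sub>R i))"
        using FX[OF x] F0[OF x] by (simp add: euclidean_representation proj_id[OF x] del: OH_anchor.simps)
      also have "\<dots> = (\<Sum>i\<in>Basis. (F x \<bullet> i) *\<^sub>R gen i x)"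
        unfolding gen_def linear_sum[OF l] linear_scale[OF l] ..
      finally show "h x *\<^sub>R OH_anchor x v = (\<Sum>i\<in>Basis. (F x \<bullet> i) *\<^sub>R gen i x)" .
    qed (use h0 oU zero_dom in auto)
    then have "h 0 *\<^sub>R v = L (F 0)" by (simp add: L_def)
    then have "v = L (inverse (h 0) *\<^sub>R F 0)"
      unfolding linear_scale[OF L] using h0(2) by (metis scaleR_scaleR left_inverse scaleR_one)
    moreover have "inverse (h 0) *\<^sub>R F 0 \<in> K"
      using F0[OF zero_dom] by (simp add: K_def linear_scale[OF ds_linear[OF zero_dom]])
    ultimately show ?thesis by (rule image_eqI)
  qed
  then have "L ` K = UNIV" by blast
  then have "16 \<le> dim K"
    using dim_image_le[OF L, of K] by simp
  moreover have "dim K + DIM(oct \<times> oct) \<le> DIM('c)"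
    unfolding K_def by (rule dim_kernel_of_right_inverse[OF ds_linear[OF zero_dom] du_linear[OF zero_dom] ds_du[OF zero_dom]])
  ultimately show ?thesis by simp
qed

end

lemma OH_groupoid_dim_minimal:
  fixes H :: "(oct \<times> oct, 'g, 'c::euclidean_space) groupoid"
  assumes H: "lie_groupoid H" and fol: "groupoid_foliation H = OH_foliation"
  shows "32 \<le> DIM('c)"
proof -
  have at: "smooth_atlas (gp_top H) (gp_charts H)"
    using H unfolding lie_groupoid_def by (elim conjE)
  have "\<forall>x. gp_unit H x \<in> gp_arrows H \<and> gp_source H (gp_unit H x) = x \<and> gp_target H (gp_unit H x) = x"
    using H unfolding lie_groupoid_def by (elim conjE)
  then have "gp_unit H 0 \<in> gp_arrows H" by blast
  then obtain U \<phi> where "(U, \<phi>) \<in> gp_charts H" "gp_unit H 0 \<in> U"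
    using at unfolding smooth_atlas_def by blast
  then interpret OH_groupoid_inducing H U \<phi>
    using H fol by unfold_locales
  show ?thesis by (rule dim_arrows)
qed

theorem theorem4:
  shows "(lie_algebroid OH_algebroid \<and> algebroid_foliation OH_algebroid = OH_foliation \<and>
      (\<forall>E :: (oct \<times> oct, 'e::real_vector) algebroid.
         lie_algebroid E \<and> algebroid_foliation E = OH_foliation \<longrightarrow>
         vb_rank OH_algebroid \<le> vb_rank E)) \<and>
    (lie_groupoid OH_groupoid \<and>
      Hausdorff_space (gp_top OH_groupoid) \<and> second_countable (gp_top OH_groupoid) \<and>
      groupoid_foliation OH_groupoid = OH_foliation \<and>
      (\<forall>H :: (oct \<times> oct, 'g, 'c::euclidean_space) groupoid.
         lie_groupoid H \<and> groupoid_foliation H = OH_foliation \<longrightarrow>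
         gp_dim OH_groupoid \<le> gp_dim H))"
proof (intro conjI allI impI)
  show "algebroid_foliation OH_algebroid = OH_foliation"
    by (simp add: OH_foliation_def)
next
  fix E :: "(oct \<times> oct, 'e) algebroid"
  assume "lie_algebroid E \<and> algebroid_foliation E = OH_foliation"
  then have "16 \<le> vb_rank E" using OH_algebroid_rank_minimal by blast
  then show "vb_rank OH_algebroid \<le> vb_rank E" by (simp add: OH_algebroid_def)
next
  fix H :: "(oct \<times> oct, 'g, 'c) groupoid"
  assume "lie_groupoid H \<and> groupoid_foliation H = OH_foliation"
  then have "32 \<le> DIM('c)" using OH_groupoid_dim_minimal by blast
  then show "gp_dim OH_groupoid \<le> gp_dim H" by (simp add: gp_dim_def)
qed (rule OH_lie_algebroid OH_lie_groupoid OH_groupoid_topology OH_groupoid_foliation)+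

end
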